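(* Let $(x_n)_{n\ge 0}$ be the abstract van der Corput sequence defined by an abstract numeration system $S=(L,A,\le)$, where $L$ is recognized by a totally ordered Pisot automaton $\mathcal{A}_L=(\{0,1,\ldots,d\},A,\tau,d,\{1,\ldots,d\})$ (with $d\ge1$, states ordered as integers) such that the matrix $M_L=(\#\{a\in A:\tau(q,a)=r\})_{1\le q,r\le d}$ has characteristic polynomial irreducible over $\mathbb{Q}$, $\tau(0,a)=0$ for every $a\in A$, $\tau(q,a_0)>0$ for every $q\in\{1,\ldots,d\}$, and $\tau(q,a_0)>q$ for every $q\in\{1,\ldots,d-1\}$, where $a_0$ is the minimal letter of $A$. Let $u=u_1u_2\cdots\in L_\omega$. Then $D(N,[0,\langle u\rangle))$ is bounded in $N$ if and only if $\langle u\rangle\in\mathbb{Q}(\beta)$ and there exists some $m\ge 0$ such that, for every $v\in A^*$ and every $k>m$, $$\zeta_{\widetilde\tau(d,\widetilde v)}(y_k)=\begin{cases}1&\text{if } v a_0^\omega<u_ku_{k+1}\cdots\ \text{and}\ u_1\cdots u_{k-1}v\in L,\\0&\text{else,}\end{cases}$$ where $y_k=\sum_{j=k}^\infty\epsilon_j(u)\beta^{k-j-1}$.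
   Context: **Words.** $(A,\le)$ is a finite totally ordered alphabet, $A^*$ the set of finite words, $A^\omega$ the set of right-infinite words, $|w|$ the length of $w$, $a_0^\omega=a_0a_0\cdots$. $A^*$ carries the shortlex order: $v<w$ iff $|v|<|w|$, or $|v|=|w|$ and $v$ is lexicographically smaller than $w$. $A^\omega$ carries the lexicographical order. The mirror image of $w=w_1\cdots w_k$ is $\widetilde w=w_k\cdots w_1$, and $\widetilde L=\{\widetilde w:w\in L\}$. **Abstract numeration system.** A triple $S=(L,A,\le)$ with $L\subseteq A^*$ an infinite regular language; $\mathrm{val}_S(w)=\#\{v\in L:v<w\}$ for $w\in L$, and $\mathrm{rep}_S(n)=w$ iff $\mathrm{val}_S(w)=n$. **Automata.** A deterministic automaton $(Q,A,\tau,q_0,F)$ (states, alphabet, transition function $\tau:Q\times A\to Q$, initial state, final states), with $\tau$ extended to words by $\tau(q,\varepsilon)=q$, $\tau(q,wa)=\tau(\tau(q,w),a)$, recognizes $\{w:\tau(q_0,w)\in F\}$. It is totally ordered if there is a total order on $Q$ such that $q\le r$ implies $\tau(q,a)\le\tau(r,a)$ for all $a\in A$. It is a Pisot automaton if the incidence matrix $(\#\{a\in A:\tau(q,a)=r\})_{q,r}$ of its restriction to the states that are both accessible ($q=\tau(q_0,w)$ for some $w$) and co-accessible ($\tau(q,w)\in F$ for some $w$) has one simple eigenvalue $\beta>1$ and all other eigenvalues $\alpha$ satisfy $|\alpha|<1$. **Mirror transition function.** With $Q=\{0,\ldots,d\}$, $\widetilde\tau(r,a)=\#\{q\in Q:\tau(q,a)+r>d\}$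 for $r\in Q$, $a\in A$, extended to words by $\widetilde\tau(r,\varepsilon)=r$, $\widetilde\tau(r,wa)=\widetilde\tau(\widetilde\tau(r,w),a)$. **Normalized value.** Let $L$ have exponential growth, $\lim_{k\to\infty}\frac1k\log\#\{v\in L:|v|\le k\}=\log\beta>0$ (under the hypotheses of the claim this $\beta$ is the eigenvalue $\beta$ above, which is the Perron–Frobenius eigenvalue of $M_L$). $L_\omega$ is the set of $u\in A^\omega$ that are limits of words $w^{(k)}\in L$ (every finite prefix of $u$ is a prefix of all but finitely many $w^{(k)}$). For $u\in L_\omega$, $\mathrm{val}_S^\omega(u)=\lim_{k\to\infty}\mathrm{val}_S(w^{(k)})/\#\{v\in L:|v|\le|w^{(k)}|\}$, provided the limit exists and is independent of the choice of $(w^{(k)})$, and $\langle u\rangle=\frac{\beta\,\mathrm{val}_S^\omega(u)-1}{\beta-1}\in[0,1]$. For $w\in L$ that is a prefix of some word in $L_\omega$, $\langle w\rangle=\langle u\rangle$ where $u$ is the smallest word in $L_\omega$ with prefix $w$. **Abstract van der Corput sequence.** It is defined when $L$ has exponential growth, every $w\in L$ is a prefix of some $u\in L_\omega$, and $\mathrm{val}_S^\omega$ exists on $L_\omega$ (this is the case under the hypotheses of the claim). Let $L'=\{w\in L:\langle w\rangle\ne\langle v\rangle\text{ for every }v\in L\text{ with }v<w\}$ and $\widetilde{S'}=(\widetilde{L'},A,\le)$. Then $x_n=\langle w\rangle$ where $\widetilde w=\mathrm{rep}_{\widetilde{S'}}(n)$. **Discrepancy.** $D(N,I)=\#\{0\le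 n<N:x_n\in I\}-N\lambda(I)$, where $\lambda(I)$ is the length of the interval $I$. **The numbers $\eta_q,\epsilon_j,\theta_r,\zeta_r$.** $(\eta_1,\ldots,\eta_d)^t$ is the right eigenvector of $M_L$ for the eigenvalue $\beta$ with $\eta_d=1$, and $\eta_0=0$; so $\eta_q\in\mathbb{Q}(\beta)$. For $u\in L_\omega$, $\epsilon_j(u)=\sum_{a\in A,\,a<u_j}\eta_{\tau(d,u_1\cdots u_{j-1}a)}$. Let $\beta_1=\beta,\beta_2,\ldots,\beta_d$ be the conjugates of $\beta$ and, for $z\in\mathbb{Q}(\beta)$, let $z^{(i)}\in\mathbb{Q}(\beta_i)$ be the image of $z$ under the isomorphism $\mathbb{Q}(\beta)\to\mathbb{Q}(\beta_i)$ mapping $\beta$ to $\beta_i$. The numbers $\theta_1,\ldots,\theta_d\in\mathbb{Q}(\beta)$ are the constants such that $$\#\{v\in A^k:\tau(q,v)+r>d\}=\sum_{i=1}^d\eta_q^{(i)}\theta_r^{(i)}\beta_i^k\quad\text{for all }1\le q,r\le d,\ k\ge0,$$ and $\theta_0=0$. Finally $\zeta_r(z)=\sum_{i=1}^d\theta_r^{(i)}z^{(i)}$ for $r\in Q$, $z\in\mathbb{Q}(\beta)$. *)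

theory Defs
  imports
    "HOL-Analysis.Analysis"
    "HOL-Library.Stream"
    "HOL-Library.Sublist"
    "Jordan_Normal_Form.Spectral_Radius"
begin

text \<open>
  The alphabet is a type of class \<open>{finite, linorder}\<close>; finite words are lists, infinite words are
  streams. Streams are indexed from 0, so the letter \<open>u\<^sub>j\<close> (with \<open>j \<ge> 1\<close>) of the mathematical
  notation is \<open>u !! (j - 1)\<close>.
\<close>

definition shortlex_less :: "'a::linorder list \<Rightarrow> 'a list \<Rightarrow> bool" where
  "shortlex_less v w \<longleftrightarrow> (v, w) \<in> lenlex {(a, b). a < b}"

definition stream_lex_less :: "'a::linorder stream \<Rightarrow> 'a stream \<Rightarrow> bool" where
  "stream_lex_less u v \<longleftrightarrow> (\<exists>n. stake n u = stake n v \<and> u !! n < v !! n)"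

text \<open>The extension of a transition function \<open>\<tau>\<close> to words is \<open>foldl \<tau>\<close>.\<close>

definition det_automaton :: "'s set \<Rightarrow> ('s \<Rightarrow> 'a \<Rightarrow> 's) \<Rightarrow> 's \<Rightarrow> 's set \<Rightarrow> bool" where
  "det_automaton Q \<tau> q0 F \<longleftrightarrow>
     finite Q \<and> q0 \<in> Q \<and> F \<subseteq> Q \<and> (\<forall>q\<in>Q. \<forall>a. \<tau> q a \<in> Q)"

definition recognized_language :: "('s \<Rightarrow> 'a \<Rightarrow> 's) \<Rightarrow> 's \<Rightarrow> 's set \<Rightarrow> 'a list set" where
  "recognized_language \<tau> q0 F = {w. foldl \<tau> q0 w \<in> F}"

definition regular_language :: "'a list set \<Rightarrow> bool" where
  "regular_language L \<longleftrightarrow>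
     (\<exists>(Q :: nat set) \<tau> q0 F. det_automaton Q \<tau> q0 F \<and> L = recognized_language \<tau> q0 F)"

text \<open>The total order on the states is the one of the state type.\<close>

definition totally_ordered_automaton :: "'s::linorder set \<Rightarrow> ('s \<Rightarrow> 'a \<Rightarrow> 's) \<Rightarrow> bool" where
  "totally_ordered_automaton Q \<tau> \<longleftrightarrow>
     (\<forall>q\<in>Q. \<forall>r\<in>Q. q \<le> r \<longrightarrow> (\<forall>a. \<tau> q a \<le> \<tau> r a))"

text \<open>
  Rows and columns follow the increasing enumeration of \<open>S\<close>; for \<open>S = {1..d}\<close>, the entry with
  index \<open>(i, j)\<close> belongs to the pair of states \<open>(i + 1, j + 1)\<close>.
\<close>

definition incidence_mat ::
    "('s::linorder \<Rightarrow> 'a::finite \<Rightarrow> 's) \<Rightarrow> 's set \<Rightarrow> 'b::comm_ring_1 mat" where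
  "incidence_mat \<tau> S =
     (let qs = sorted_list_of_set S
      in Matrix.mat (card S) (card S) (\<lambda>(i, j). of_nat (card {a. \<tau> (qs ! i) a = qs ! j})))"

definition trim_states :: "'s set \<Rightarrow> ('s \<Rightarrow> 'a \<Rightarrow> 's) \<Rightarrow> 's \<Rightarrow> 's set \<Rightarrow> 's set" where
  "trim_states Q \<tau> q0 F =
     {q\<in>Q. (\<exists>w. q = foldl \<tau> q0 w) \<and> (\<exists>w. foldl \<tau> q w \<in> F)}"

definition pisot_automaton ::
    "'s::linorder set \<Rightarrow> ('s \<Rightarrow> 'a::finite \<Rightarrow> 's) \<Rightarrow> 's \<Rightarrow> 's set \<Rightarrow> bool" where
  "pisot_automaton Q \<tau> q0 F \<longleftrightarrow>
     (let M = incidence_mat \<tau> (trim_states Q \<tau> q0 F) :: complex mat in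
      \<exists>\<beta>::real. \<beta> > 1 \<and> Polynomial.order (complex_of_real \<beta>) (char_poly M) = 1 \<and>
        (\<forall>\<alpha>. eigenvalue M \<alpha> \<and> \<alpha> \<noteq> complex_of_real \<beta> \<longrightarrow> cmod \<alpha> < 1))"

definition mirror_trans :: "nat \<Rightarrow> (nat \<Rightarrow> 'a \<Rightarrow> nat) \<Rightarrow> nat \<Rightarrow> 'a \<Rightarrow> nat" where
  "mirror_trans d \<tau> r a = card {q\<in>{0..d}. \<tau> q a + r > d}"

definition abstract_numeration_system :: "'a::{finite,linorder} list set \<Rightarrow> bool" where
  "abstract_numeration_system L \<longleftrightarrow> infinite L \<and> regular_language L"

definition ans_val :: "'a::linorder list set \<Rightarrow> 'a list \<Rightarrow> nat" where
  "ans_val L w = card {v\<in>L. shortlex_less v w}"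

definition ans_rep :: "'a::linorder list set \<Rightarrow> nat \<Rightarrow> 'a list" where
  "ans_rep L n = (THE w. w \<in> L \<and> ans_val L w = n)"

definition count_upto :: "'a list set \<Rightarrow> nat \<Rightarrow> nat" where
  "count_upto L k = card {v\<in>L. length v \<le> k}"

definition growth_base :: "'a list set \<Rightarrow> real" where
  "growth_base L =
     (THE \<beta>. \<beta> > 1 \<and> (\<lambda>k. ln (real (count_upto L k)) / real k) \<longlonglongrightarrow> ln \<beta>)"

definition word_limit :: "(nat \<Rightarrow> 'a list) \<Rightarrow> 'a stream \<Rightarrow> bool" where
  "word_limit w u \<longleftrightarrow> (\<forall>n. \<forall>\<^sub>F k in sequentially. prefix (stake n u) (w k))"

definition omega_language :: "'a list set \<Rightarrow> 'a stream set" where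
  "omega_language L = {u. \<exists>w. (\<forall>k. w k \<in> L) \<and> word_limit w u}"

text \<open>The limit is required to be the same for all sequences of words in \<open>L\<close> converging to \<open>u\<close>.\<close>

definition omega_val :: "'a::linorder list set \<Rightarrow> 'a stream \<Rightarrow> real" where
  "omega_val L u =
     (THE x. \<forall>w. (\<forall>k. w k \<in> L) \<and> word_limit w u \<longrightarrow>
        (\<lambda>k. real (ans_val L (w k)) / real (count_upto L (length (w k)))) \<longlonglongrightarrow> x)"

definition omega_value :: "'a::linorder list set \<Rightarrow> 'a stream \<Rightarrow> real" where
  "omega_value L u = (growth_base L * omega_val L u - 1) / (growth_base L - 1)"

definition least_extension :: "'a::linorder list set \<Rightarrow> 'a list \<Rightarrow> 'a stream" where
  "least_extension L w =
     (THE u. u \<in> omega_language L \<and> stake (length w) u = w \<and>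
        (\<forall>v\<in>omega_language L. stake (length w) v = w \<longrightarrow> u = v \<or> stream_lex_less u v))"

definition word_value :: "'a::linorder list set \<Rightarrow> 'a list \<Rightarrow> real" where
  "word_value L w = omega_value L (least_extension L w)"

definition reduced_language :: "'a::linorder list set \<Rightarrow> 'a list set" where
  "reduced_language L =
     {w\<in>L. \<forall>v\<in>L. shortlex_less v w \<longrightarrow> word_value L w \<noteq> word_value L v}"

definition van_der_corput :: "'a::linorder list set \<Rightarrow> nat \<Rightarrow> real" where
  "van_der_corput L n = word_value L (rev (ans_rep (rev ` reduced_language L) n))"

definition discrepancy :: "(nat \<Rightarrow> real) \<Rightarrow> nat \<Rightarrow> real set \<Rightarrow> real" where
  "discrepancy x N I = real (card {n. n < N \<and> x n \<in> I}) - real N * measure lborel I"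

text \<open>
  The least subfield containing \<open>b\<close>; as \<open>inverse 0 = 0\<close>, closure under inverses needs no exception.
\<close>

definition rat_adjoin :: "'b::field_char_0 \<Rightarrow> 'b set" where
  "rat_adjoin b = \<Inter> {K. b \<in> K \<and> 1 \<in> K \<and>
     (\<forall>x\<in>K. \<forall>y\<in>K. x - y \<in> K \<and> x * y \<in> K) \<and> (\<forall>x\<in>K. inverse x \<in> K)}"

definition conjugates :: "real \<Rightarrow> complex set" where
  "conjugates \<beta> = {\<gamma>. \<exists>p :: rat poly. irreducible p \<and>
     poly (map_poly of_rat p) \<beta> = 0 \<and> poly (map_poly of_rat p) \<gamma> = 0}"

definition adjoin_iso :: "real \<Rightarrow> complex \<Rightarrow> (real \<Rightarrow> complex) \<Rightarrow> bool" where
  "adjoin_iso \<beta> \<gamma> \<sigma> \<longleftrightarrow>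
     bij_betw \<sigma> (rat_adjoin \<beta>) (rat_adjoin \<gamma>) \<and> \<sigma> \<beta> = \<gamma> \<and>
     (\<forall>x\<in>rat_adjoin \<beta>. \<forall>y\<in>rat_adjoin \<beta>.
        \<sigma> (x + y) = \<sigma> x + \<sigma> y \<and> \<sigma> (x * y) = \<sigma> x * \<sigma> y)"

text \<open>
  The conjugate of \<open>z\<close> is meaningful for \<open>z \<in> rat_adjoin \<beta>\<close> and \<open>\<gamma> \<in> conjugates \<beta>\<close>, where the
  isomorphism sending \<open>\<beta>\<close> to \<open>\<gamma>\<close> is unique.
\<close>

definition conj_image :: "real \<Rightarrow> complex \<Rightarrow> real \<Rightarrow> complex" where
  "conj_image \<beta> \<gamma> z = (THE w. \<exists>\<sigma>. adjoin_iso \<beta> \<gamma> \<sigma> \<and> w = \<sigma> z)"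

definition zeta :: "real \<Rightarrow> (nat \<Rightarrow> real) \<Rightarrow> nat \<Rightarrow> real \<Rightarrow> complex" where
  "zeta \<beta> \<theta> r z = (\<Sum>\<gamma>\<in>conjugates \<beta>. conj_image \<beta> \<gamma> (\<theta> r) * conj_image \<beta> \<gamma> z)"

definition eps ::
    "nat \<Rightarrow> (nat \<Rightarrow> 'a::{finite,linorder} \<Rightarrow> nat) \<Rightarrow> (nat \<Rightarrow> real) \<Rightarrow> 'a stream \<Rightarrow> nat \<Rightarrow> real" where
  "eps d \<tau> \<eta> u j = (\<Sum>a | a < u !! (j - 1). \<eta> (foldl \<tau> d (stake (j - 1) u @ [a])))"

text \<open>The tail \<open>\<Sum>j\<ge>k. \<epsilon>\<^sub>j(u) \<beta>\<^bsup>k-j-1\<^esup>\<close>, written with \<open>j = k + i\<close>.\<close>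

definition tail_value ::
    "real \<Rightarrow> nat \<Rightarrow> (nat \<Rightarrow> 'a::{finite,linorder} \<Rightarrow> nat) \<Rightarrow> (nat \<Rightarrow> real) \<Rightarrow> 'a stream \<Rightarrow> nat \<Rightarrow> real"
  where
  "tail_value \<beta> d \<tau> \<eta> u k = (\<Sum>i. eps d \<tau> \<eta> u (k + i) / \<beta> ^ (i + 1))"

end

theory Submission
  imports Defs "HOL-Computational_Algebra.Field_as_Ring"
begin

text \<open>
  Let \<open>V\<close> be the value of \<open>u\<close>. Indexing the sequence by reversed words splits \<open>D(N, [0, V))\<close> into a
  sum of excesses \<open>f(j, s) = p(j, s) - V n(j, s)\<close>, where \<open>n(j, s)\<close> counts the words of \<open>L\<close> that
  consist of \<open>j\<close> free letters and the suffix \<open>s\<close>, and \<open>p(j, s)\<close> those among them that lie below \<open>u\<close>.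
  By the mirror automaton, \<open>n(j, s)\<close> depends only on \<open>j\<close> and on the state reached by the mirror image of
  \<open>s\<close>; if \<open>V\<close> lies in \<open>\<rat>(\<beta>)\<close>, expanding in conjugates gives \<open>f(j, s) = \<delta> - \<zeta> + O(\<rho>\<^sup>j)\<close> with \<open>\<rho> < 1\<close>,
  where \<open>\<delta>\<close> and \<open>\<zeta>\<close> are the two sides of the criterion. So the criterion implies boundedness.

  Conversely, blocks that are separated by long runs of \<open>a\<^sub>0\<close> contribute independently to the
  discrepancy. If it is bounded, the contribution of a block therefore tends to \<open>0\<close> uniformly as the
  block moves to infinity, and so does \<open>f(j, s)\<close>, being the difference of two such contributions.
  Pisot's argument then gives \<open>V \<in> \<rat>(\<beta>)\<close>. Finally \<open>p(j, s) - (\<delta> - \<zeta>)\<close> is a rational number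
  of bounded denominator whose difference from \<open>p(j, s)\<close> tends to \<open>0\<close>, so \<open>\<delta> = \<zeta>\<close> for large \<open>j\<close>.
\<close>

section \<open>The field generated by an algebraic number\<close>

text \<open>Boundedness is exploited through one device. After \<open>d\<close> letters
  \<open>a0\<close> the automaton is either dead in \<open>0\<close> or back in \<open>d\<close>,
  and a long run of \<open>a0\<close> also settles the comparison with \<open>u\<close>; hence
  contributions of distant blocks add. If blocks arbitrarily far out contributed more than a fixed
  \<epsilon> with one sign, chaining them would exceed every bound. The two contributions that
  differ by \<open>f(j, s)\<close> belong to \<open>s\<close> and to its successor in an odometer
  whose least significant letter is the one next to the free positions. The expansion behind the
  criterion makes sense only once V lies in Q(\<beta>), so the converse has to derive this
  membership from the counts alone, through the linear recurrence that they satisfy. Afterwards V is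
  written as p(\<beta>); the trace that occurs is then a combination of counts with the coefficients
  of p, which bounds its denominator. Since \<open>conj_image\<close> is a definite description over
  abstract field isomorphisms, all conjugation is reduced to evaluating one rational polynomial at
  \<beta> and at its conjugates, by means of \<open>rpoly\<close>.\<close>

definition rpoly :: "rat poly \<Rightarrow> 'b::field_char_0 \<Rightarrow> 'b" where
  "rpoly p x = poly (map_poly of_rat p) x"

lemma rpoly_add: "rpoly (p + q) x = rpoly p x + rpoly q x"
  and rpoly_diff: "rpoly (p - q) x = rpoly p x - rpoly q x"
  and rpoly_mult: "rpoly (p * q) x = rpoly p x * rpoly q x"
proof -
  interpret map_poly_comm_ring_hom "of_rat :: rat \<Rightarrow> 'a" ..
  show "rpoly (p + q) x = rpoly p x + rpoly q x" "rpoly (p - q) x = rpoly p x - rpoly q x"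
    "rpoly (p * q) x = rpoly p x * rpoly q x"
    by (simp_all add: rpoly_def hom_add hom_minus hom_mult)
qed

lemma rpoly_0 [simp]: "rpoly 0 x = 0"
  by (simp add: rpoly_def)

lemma rpoly_pCons [simp]: "rpoly (pCons a p) x = of_rat a + x * rpoly p x"
  by (simp add: rpoly_def of_rat_hom.map_poly_pCons_hom)

lemma rpoly_1 [simp]: "rpoly 1 x = 1"
  by (simp add: rpoly_def)

lemma rpoly_sum: "rpoly (\<Sum>i\<in>I. f i) x = (\<Sum>i\<in>I. rpoly (f i) x)"
  by (induction I rule: infinite_finite_induct) (simp_all add: rpoly_add)

lemma rpoly_monom: "rpoly (Polynomial.monom c n) x = of_rat c * x ^ n"
  by (simp add: rpoly_def poly_monom)

lemma rpoly_altdef: "rpoly p x = (\<Sum>i\<le>degree p. of_rat (coeff p i) * x ^ i)"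
  by (simp add: rpoly_def poly_altdef)

lemma of_real_of_rat: "of_real (of_rat r) = (of_rat r :: 'a::{real_field,field_char_0})"
  by (cases r) (simp add: of_rat_rat)

lemma rpoly_of_real: "rpoly p (complex_of_real x) = complex_of_real (rpoly p x)"
  by (induction p) (simp_all add: of_real_of_rat)

text \<open>If p did not divide q, both would be coprime, and a Bezout identity evaluated at the
  common root would read 0 = 1.\<close>

lemma irreducible_root_dvd:
  fixes p q :: "rat poly"
  assumes "irreducible p" "rpoly p x = 0" "rpoly q x = 0"
  shows "p dvd q"
proof (rule ccontr)
  assume "\<not> p dvd q"
  then have "coprime p q"
    using assms(1) by (meson irreducible_imp_prime_elem prime_elem_imp_coprime)
  then obtain a b where "a * p + b * q = 1"
    by (metis bezout_coefficients_fst_snd coprime_iff_gcd_eq_1)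
  then have "rpoly (a * p + b * q) x = 1"
    by simp
  then show False
    using assms by (simp add: rpoly_add rpoly_mult)
qed

text \<open>Every rational relation at x is a multiple of p and so survives at any other root of p,
  even in a different field. This makes conjugation well defined.\<close>

lemma rpoly_root_transfer:
  assumes "irreducible p" "rpoly p x = 0" "rpoly p y = 0" "rpoly q x = 0"
  shows "rpoly q y = 0"
  using irreducible_root_dvd[OF assms(1,2,4)] assms(3) by (auto simp: dvd_def rpoly_mult)

lemma rpoly_eq_transfer:
  assumes "irreducible p" "rpoly p x = 0" "rpoly p y = 0" "rpoly q x = rpoly q' x"
  shows "rpoly q y = rpoly q' y"
  using rpoly_root_transfer[OF assms(1-3), of "q - q'"] assms(4) by (simp add: rpoly_diff)

lemma conjugates_eq:
  assumes "irreducible p" "rpoly p \<beta> = 0"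
  shows "conjugates \<beta> = {\<gamma>. rpoly p \<gamma> = 0}"
proof (intro Set.set_eqI iffI)
  fix \<gamma> assume "\<gamma> \<in> conjugates \<beta>"
  then obtain q where q: "irreducible q" "rpoly q \<beta> = 0" "rpoly q \<gamma> = 0"
    by (auto simp: conjugates_def rpoly_def)
  show "\<gamma> \<in> {\<gamma>. rpoly p \<gamma> = 0}"
    using irreducible_root_dvd[OF q(1,2) assms(2)] q(3) by (auto simp: dvd_def rpoly_mult)
next
  fix \<gamma> :: complex assume "\<gamma> \<in> {\<gamma>. rpoly p \<gamma> = 0}"
  then show "\<gamma> \<in> conjugates \<beta>"
    using assms unfolding conjugates_def rpoly_def by blast
qed

section \<open>The field generated by \<open>b\<close> and its isomorphisms\<close>

lemma
  assumes "x \<in> rat_adjoin b" "y \<in> rat_adjoin b"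
  shows rat_adjoin_diff: "x - y \<in> rat_adjoin b" and rat_adjoin_mult: "x * y \<in> rat_adjoin b"
  using assms unfolding rat_adjoin_def by auto

lemma rat_adjoin_inverse: "x \<in> rat_adjoin b \<Longrightarrow> inverse x \<in> rat_adjoin b"
  unfolding rat_adjoin_def by auto

lemma rat_adjoin_gen: "b \<in> rat_adjoin b" and rat_adjoin_1: "1 \<in> rat_adjoin b"
  unfolding rat_adjoin_def by auto

lemma rat_adjoin_0: "0 \<in> rat_adjoin b"
  using rat_adjoin_diff[OF rat_adjoin_1 rat_adjoin_1] by simp

lemma rat_adjoin_add: "x \<in> rat_adjoin b \<Longrightarrow> y \<in> rat_adjoin b \<Longrightarrow> x + y \<in> rat_adjoin b"
  using rat_adjoin_diff[of x b "0 - y"] rat_adjoin_diff[OF rat_adjoin_0, of y b] by simp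

lemma rat_adjoin_of_nat: "of_nat n \<in> rat_adjoin b"
  by (induction n) (auto intro: rat_adjoin_0 rat_adjoin_1 rat_adjoin_add)

lemma rat_adjoin_of_rat: "of_rat r \<in> rat_adjoin b"
proof (cases r)
  case (Fract m n)
  have "of_int k \<in> rat_adjoin b" for k
    using rat_adjoin_diff[OF rat_adjoin_0, of "of_nat (nat (- k))" b]
      rat_adjoin_of_nat[of "nat k" b] rat_adjoin_of_nat[of "nat (- k)" b]
    by (cases "k \<ge> 0") auto
  then show ?thesis
    using Fract \<open>\<And>k. of_int k \<in> rat_adjoin b\<close> by (metis of_rat_rat divide_inverse rat_adjoin_mult rat_adjoin_inverse less_irrefl)
qed

lemma rat_adjoin_sum: "(\<And>i. i \<in> I \<Longrightarrow> f i \<in> rat_adjoin b) \<Longrightarrow> (\<Sum>i\<in>I. f i) \<in> rat_adjoin b"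
  by (induction I rule: infinite_finite_induct) (auto intro: rat_adjoin_0 rat_adjoin_add)

lemma rat_adjoin_power: "x \<in> rat_adjoin b \<Longrightarrow> x ^ n \<in> rat_adjoin b"
  by (induction n) (auto intro: rat_adjoin_1 rat_adjoin_mult)

lemma rpoly_in_rat_adjoin: "rpoly p b \<in> rat_adjoin b"
  unfolding rpoly_altdef
  by (intro rat_adjoin_sum rat_adjoin_mult rat_adjoin_of_rat rat_adjoin_power rat_adjoin_gen)

text \<open>The values of rational polynomials already form a field: a value other than 0 is
  inverted by a Bezout coefficient, and the convention \<open>inverse 0 = 0\<close> covers the value
  0.\<close>

lemma rat_adjoin_eq:
  assumes "irreducible p" "rpoly p b = 0"
  shows "rat_adjoin b = range (\<lambda>q. rpoly q b)"
proof
  let ?K = "range (\<lambda>q. rpoly q b)"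
  have "inverse (rpoly q b) \<in> ?K" for q
  proof (cases "rpoly q b = 0")
    case True
    then show ?thesis
      by (metis inverse_zero rangeI)
  next
    case False
    then have "\<not> p dvd q"
      using assms(2) by (auto simp: dvd_def rpoly_mult)
    then have "coprime p q"
      using assms(1) by (meson irreducible_imp_prime_elem prime_elem_imp_coprime)
    then obtain u v where "u * p + v * q = 1"
      by (metis bezout_coefficients_fst_snd coprime_iff_gcd_eq_1)
    then have "rpoly (u * p + v * q) b = 1"
      by simp
    then have "rpoly v b * rpoly q b = 1"
      using assms by (simp add: rpoly_add rpoly_mult)
    then have "inverse (rpoly q b) = rpoly v b"
      using False by (simp add: field_simps)
    then show ?thesis
      by simp
  qed
  moreover have "b \<in> ?K"
    by (rule range_eqI[of _ _ "[:0, 1:]"]) simp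
  moreover have "1 \<in> ?K"
    by (metis rangeI rpoly_1)
  moreover have "rpoly q b - rpoly q' b \<in> ?K" "rpoly q b * rpoly q' b \<in> ?K" for q q'
    by (metis rangeI rpoly_diff, metis rangeI rpoly_mult)
  ultimately show "rat_adjoin b \<subseteq> ?K"
    unfolding rat_adjoin_def by (intro Inter_lower) auto
qed (auto simp: rpoly_in_rat_adjoin)

text \<open>Additivity, multiplicativity and the image of \<beta> determine the map: the rationals
  are fixed, and every element of the field is a polynomial in \<beta>.\<close>

lemma adjoin_iso_rpoly:
  assumes "adjoin_iso \<beta> \<gamma> \<sigma>"
  shows "\<sigma> (rpoly q \<beta>) = rpoly q \<gamma>"
proof -
  have hom: "\<sigma> (x + y) = \<sigma> x + \<sigma> y" "\<sigma> (x * y) = \<sigma> x * \<sigma> y"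
    if "x \<in> rat_adjoin \<beta>" "y \<in> rat_adjoin \<beta>" for x y
    using assms that unfolding adjoin_iso_def by auto
  have bij: "bij_betw \<sigma> (rat_adjoin \<beta>) (rat_adjoin \<gamma>)" and \<beta>: "\<sigma> \<beta> = \<gamma>"
    using assms unfolding adjoin_iso_def by auto
  have 0: "\<sigma> 0 = 0"
    using hom(1)[OF rat_adjoin_0 rat_adjoin_0] by simp
  \<comment> \<open>Preservation of 1 is not part of \<open>adjoin_iso\<close>. Injectivity excludes
    the value 0, and then \<open>\<sigma> 1\<close> is an idempotent other than 0.\<close>
  have "\<sigma> 1 \<noteq> 0"
    using bij 0 rat_adjoin_0[of \<beta>] rat_adjoin_1[of \<beta>] unfolding bij_betw_def inj_on_def
    by (metis zero_neq_one)
  then have 1: "\<sigma> 1 = 1"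
    using hom(2)[OF rat_adjoin_1 rat_adjoin_1] by simp
  have nat: "\<sigma> (of_nat n) = of_nat n" for n
    by (induction n) (simp_all add: 0 1 hom rat_adjoin_1 rat_adjoin_of_nat)
  have neg: "\<sigma> (- x) = - \<sigma> x" if "x \<in> rat_adjoin \<beta>" for x
    using hom(1)[OF that, of "- x"] rat_adjoin_diff[OF rat_adjoin_0 that] 0
    by (simp add: add_eq_0_iff)
  have int: "\<sigma> (of_int k) = of_int k" for k
    using nat[of "nat k"] nat[of "nat (- k)"] neg[OF rat_adjoin_of_nat[of "nat (- k)"]]
    by (cases "k \<ge> 0") auto
  have rat: "\<sigma> (of_rat r) = of_rat r" for r
  proof (cases r)
    case (Fract m n)
    then have "of_rat r * of_int n = (of_int m :: real)"
      by (simp add: of_rat_rat)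
    then have "\<sigma> (of_rat r) * \<sigma> (of_int n) = \<sigma> (of_int m)"
      using hom(2)[OF rat_adjoin_of_rat[of r] rat_adjoin_of_rat[of "of_int n"]] by simp
    then show ?thesis
      using Fract by (simp add: int of_rat_rat field_simps)
  qed
  show ?thesis
  proof (induction q)
    case 0
    then show ?case by (simp add: \<open>\<sigma> 0 = 0\<close>)
  next
    case (pCons a q)
    then show ?case
      by (simp add: hom rat_adjoin_of_rat rat_adjoin_mult rat_adjoin_gen rpoly_in_rat_adjoin rat \<beta>)
  qed
qed

text \<open>An arbitrary polynomial representing z is chosen and evaluated at \<gamma>; the transfer
  of relations between roots of p makes the choice irrelevant and, used in the other direction,
  gives injectivity.\<close>

lemma adjoin_iso_exists:
  assumes p: "irreducible p" "rpoly p \<beta> = 0" and \<gamma>: "rpoly p \<gamma> = 0"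
  shows "\<exists>\<sigma>. adjoin_iso \<beta> \<gamma> \<sigma>"
proof -
  define \<sigma> where "\<sigma> z = rpoly (SOME q. rpoly q \<beta> = z) \<gamma>" for z
  have \<sigma>: "\<sigma> (rpoly q \<beta>) = rpoly q \<gamma>" for q
    unfolding \<sigma>_def by (rule rpoly_eq_transfer[OF p \<gamma>]) (rule someI, rule refl)
  note eqs = rat_adjoin_eq[OF p] rat_adjoin_eq[OF p(1) \<gamma>]
  have "bij_betw \<sigma> (rat_adjoin \<beta>) (rat_adjoin \<gamma>)"
    unfolding bij_betw_def eqs inj_on_def
    by (auto simp: \<sigma> image_image intro: rpoly_eq_transfer[OF p(1) \<gamma> p(2)])
  moreover have "\<sigma> \<beta> = \<gamma>"
    using \<sigma>[of "[:0, 1:]"] by (simp add: of_rat_0)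
  moreover have "\<sigma> (x + y) = \<sigma> x + \<sigma> y \<and> \<sigma> (x * y) = \<sigma> x * \<sigma> y"
    if xy: "x \<in> rat_adjoin \<beta>" "y \<in> rat_adjoin \<beta>" for x y
  proof -
    obtain a b where "x = rpoly a \<beta>" "y = rpoly b \<beta>"
      using xy unfolding eqs by auto
    then show ?thesis
      using \<sigma>[of "a + b"] \<sigma>[of "a * b"] by (simp add: rpoly_add rpoly_mult \<sigma>)
  qed
  ultimately show ?thesis
    unfolding adjoin_iso_def by blast
qed

lemma conj_image_rpoly:
  assumes "irreducible p" "rpoly p \<beta> = 0" "rpoly p \<gamma> = 0"
  shows "conj_image \<beta> \<gamma> (rpoly q \<beta>) = rpoly q \<gamma>"
  unfolding conj_image_def
  by (rule the_equality) (use adjoin_iso_exists[OF assms] adjoin_iso_rpoly in metis)+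

section \<open>Totally ordered automata\<close>

lemma stream_lex_less_linear:
  assumes "u \<noteq> v"
  shows "stream_lex_less u v \<or> stream_lex_less v u"
proof -
  have "\<exists>n. u !! n \<noteq> v !! n"
    using assms stream_smap_nats[of u] stream_smap_nats[of v] by (metis smap_alt)
  then obtain n where n: "u !! n \<noteq> v !! n" "\<And>i. i < n \<Longrightarrow> u !! i = v !! i"
    using exists_least_iff[of "\<lambda>n. u !! n \<noteq> v !! n"] by auto
  then have "stake n u = stake n v"
    by (intro nth_equalityI) auto
  with n show ?thesis
    unfolding stream_lex_less_def by (metis linorder_neqE)
qed

lemma stake_eqD: "stake n u = stake n v \<Longrightarrow> i < n \<Longrightarrow> u !! i = v !! i"
  by (metis stake_nth)

lemma stake_eq_mono: "stake n u = stake n v \<Longrightarrow> m \<le> n \<Longrightarrow> stake m u = stake m v"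
  using take_stake[of m n u] take_stake[of m n v] by (simp add: min_absorb1)

lemma stake_shift_eq: "n \<le> length w \<Longrightarrow> stake n (w @- u) = take n w"
  by (simp add: stake_shift)

lemma shift_nth: "n < length w \<Longrightarrow> (w @- u) !! n = w ! n"
  by (simp add: shift_snth)

lemma stake_shift_sconst:
  assumes "length w \<le> n"
  shows "stake n (w @- sconst a) = w @ replicate (n - length w) a"
proof -
  have "stake m (sconst a) = replicate m a" for m
    by (rule nth_equalityI) simp_all
  then show ?thesis
    using assms by (simp add: stake_shift)
qed

lemma finite_lists_eq: "finite {v :: 'a::finite list. length v = n}"
  using finite_lists_length_eq[of "UNIV :: 'a set" n] by simp

lemma card_lists_eq: "card {v :: 'a::finite list. length v = n} = CARD('a) ^ n"
  using card_lists_length_eq[of "UNIV :: 'a set" n] by simp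

text \<open>An upward closed subset of {0..d} is a final segment and hence encoded by its
  cardinality. This is why the mirror transition function can count states instead of recording sets
  of them.\<close>

lemma card_upward_closed:
  assumes "U \<subseteq> {0..d}" "\<And>q r. q \<in> U \<Longrightarrow> q \<le> r \<Longrightarrow> r \<le> d \<Longrightarrow> r \<in> U" "q \<le> d"
  shows "q \<in> U \<longleftrightarrow> q + card U > (d::nat)"
proof
  assume "q \<in> U"
  then have "{q..d} \<subseteq> U"
    using assms by auto
  then have "card {q..d} \<le> card U"
    using assms(1) finite_subset by (intro card_mono) auto
  then show "q + card U > d"
    using assms(3) by simp
next
  assume *: "q + card U > d"
  show "q \<in> U"
  proof (rule ccontr)
    assume "q \<notin> U"
    then have "U \<subseteq> {q<..d}"
      using assms by (metis atLeastAtMost_iff greaterThanAtMost_iff not_le subset_iff)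
    then have "card U \<le> card {q<..d}"
      by (intro card_mono) auto
    then show False
      using * assms(3) by simp
  qed
qed

locale ordered_automaton =
  fixes d :: nat and \<tau> :: "nat \<Rightarrow> 'a::{finite,linorder} \<Rightarrow> nat" and a0 :: 'a
  assumes d_pos: "d \<ge> 1"
    and \<tau>_le: "q \<le> d \<Longrightarrow> \<tau> q a \<le> d"
    and \<tau>_mono: "q \<le> r \<Longrightarrow> r \<le> d \<Longrightarrow> \<tau> q a \<le> \<tau> r a"
    and \<tau>_0: "\<tau> 0 a = 0"
    and a0_min: "a0 \<le> a"
    and \<tau>_a0_pos: "0 < q \<Longrightarrow> q \<le> d \<Longrightarrow> 0 < \<tau> q a0"
    and \<tau>_a0_incr: "0 < q \<Longrightarrow> q < d \<Longrightarrow> q < \<tau> q a0"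
begin

definition Lang :: "'a list set" where
  "Lang = recognized_language \<tau> d {1..d}"

text \<open>Prepending a letter to \<open>s\<close> is one mirror transition. By
  \<open>mir_iff\<close> and \<open>mir_le\<close>, this is the number of states from which
  \<open>s\<close> is accepted.\<close>

abbreviation mir :: "'a list \<Rightarrow> nat" where
  "mir s \<equiv> foldl (mirror_trans d \<tau>) d (rev s)"

text \<open>If \<open>r\<close> is the mirror state of a suffix \<open>s\<close>, the inequality
  says that \<open>v @ s\<close> is accepted from \<open>q\<close>. These are the counts for which
  the constants \<open>\<theta>\<close> are defined.\<close>

definition acc_count :: "nat \<Rightarrow> nat \<Rightarrow> nat \<Rightarrow> nat" where
  "acc_count q r k = card {v. length v = k \<and> foldl \<tau> q v + r > d}"

lemma foldl_le: "q \<le> d \<Longrightarrow> foldl \<tau> q w \<le> d"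
  by (induction w arbitrary: q) (auto simp: \<tau>_le)

lemma foldl_0 [simp]: "foldl \<tau> 0 w = 0"
  by (induction w) (auto simp: \<tau>_0)

lemma foldl_mono: "q \<le> r \<Longrightarrow> r \<le> d \<Longrightarrow> foldl \<tau> q w \<le> foldl \<tau> r w"
  by (induction w arbitrary: q r) (auto simp: \<tau>_le \<tau>_mono)

lemma in_Lang: "w \<in> Lang \<longleftrightarrow> 0 < foldl \<tau> d w"
  using foldl_le[of d w] by (auto simp: Lang_def recognized_language_def)

lemma mir_le: "mir s \<le> d"
proof (cases s)
  case (Cons a s')
  have "card {q \<in> {0..d}. \<tau> q a + r > d} \<le> card {1..d}" if "r \<le> d" for r
    using that \<tau>_0[of a] by (intro card_mono) (auto simp: Suc_le_eq intro!: gr0I)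
  moreover have "foldl (mirror_trans d \<tau>) d w \<le> d" if "w = rev s" for w
    using that[symmetric]
  proof (induction w arbitrary: s rule: rev_induct)
    case (snoc b w)
    have "foldl (mirror_trans d \<tau>) d w \<le> d"
      by (rule snoc.IH[of "rev w"]) simp
    then have "card {q \<in> {0..d}. \<tau> q b + foldl (mirror_trans d \<tau>) d w > d} \<le> card {1..d}"
      using \<tau>_0[of b] by (intro card_mono) (auto simp: Suc_le_eq intro!: gr0I)
    then show ?case
      by (simp add: mirror_trans_def[of d \<tau> "foldl _ _ _"])
  qed simp
  ultimately show ?thesis by simp
qed simp

text \<open>By monotonicity of the transitions, the states that accept \<open>a # s\<close> form an
  upward closed set, and the mirror transition computes its cardinality from that of the states
  accepting \<open>s\<close>.\<close>

lemma mir_iff: "q \<le> d \<Longrightarrow> 0 < foldl \<tau> q s \<longleftrightarrow> q + mir s > d"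
proof (induction s arbitrary: q)
  case (Cons a s)
  let ?U = "{q \<in> {0..d}. \<tau> q a + mir s > d}"
  have "0 < foldl \<tau> q (a # s) \<longleftrightarrow> q \<in> ?U"
    using Cons by (simp add: \<tau>_le)
  also have "\<dots> \<longleftrightarrow> q + card ?U > d"
    using Cons.prems
  proof (intro card_upward_closed)
    fix p r assume "p \<in> ?U" "p \<le> r" "r \<le> d"
    then show "r \<in> ?U"
      using \<tau>_mono[of p r a] by auto
  qed auto
  finally show ?case
    by (simp add: mirror_trans_def[of d \<tau> "foldl _ _ _"])
qed auto

lemma append_in_Lang: "v @ s \<in> Lang \<longleftrightarrow> foldl \<tau> d v + mir s > d"
  by (simp add: in_Lang mir_iff foldl_le)

lemma Lang_appendD1: "v @ s \<in> Lang \<Longrightarrow> v \<in> Lang"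
  by (auto simp: in_Lang intro!: gr0I)

lemma Lang_appendD2: "v @ s \<in> Lang \<Longrightarrow> s \<in> Lang"
  using foldl_mono[of "foldl \<tau> d v" d s] foldl_le[of d v] by (auto simp: in_Lang)

lemma \<tau>_d_a0: "\<tau> d a0 = d"
proof (cases "d = 1")
  case True
  then show ?thesis
    using \<tau>_a0_pos[of d] \<tau>_le[of d a0] by simp
next
  case False
  then show ?thesis
    using d_pos \<tau>_a0_incr[of "d - 1"] \<tau>_mono[of "d - 1" d a0] \<tau>_le[of d a0] by simp
qed

lemma foldl_a0_ge: "0 < q \<Longrightarrow> q \<le> d \<Longrightarrow> min d (q + m) \<le> foldl \<tau> q (replicate m a0)"
proof (induction m arbitrary: q)
  case (Suc m)
  have "min d (q + 1) \<le> \<tau> q a0"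
    using Suc.prems \<tau>_a0_incr[of q] \<tau>_d_a0 by (cases "q = d") auto
  with Suc.IH[of "\<tau> q a0"] Suc.prems show ?case
    by (auto simp: \<tau>_a0_pos \<tau>_le min_def split: if_splits)
qed auto

lemma foldl_a0_pos: "q \<le> d \<Longrightarrow> 0 < foldl \<tau> q (replicate m a0) \<longleftrightarrow> 0 < q"
  using foldl_a0_ge[of q m] d_pos by (cases "q = 0") auto

lemma foldl_a0_eq_d: "0 < q \<Longrightarrow> q \<le> d \<Longrightarrow> m \<ge> d \<Longrightarrow> foldl \<tau> q (replicate m a0) = d"
  using foldl_a0_ge[of q m] foldl_le[of q "replicate m a0"] by simp

lemma append_a0_in_Lang: "w @ replicate m a0 \<in> Lang \<longleftrightarrow> w \<in> Lang"
  by (simp add: in_Lang foldl_a0_pos foldl_le)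

lemma Nil_in_Lang: "[] \<in> Lang"
  using d_pos by (simp add: in_Lang)

lemma a0_append_in_Lang: "replicate m a0 @ s \<in> Lang \<longleftrightarrow> s \<in> Lang"
proof -
  have "foldl \<tau> d (replicate m a0) = d"
    by (induction m) (auto simp: \<tau>_d_a0)
  then show ?thesis
    by (simp add: in_Lang)
qed

text \<open>A run of at least \<open>d\<close> letters \<open>a0\<close> lifts every positive state
  to \<open>d\<close>, so the automaton forgets \<open>x\<close> except for whether it was
  accepted.\<close>

lemma gap_in_Lang:
  assumes "m \<ge> d" "s \<in> Lang"
  shows "x @ replicate m a0 @ s \<in> Lang \<longleftrightarrow> x \<in> Lang"
  using assms foldl_a0_eq_d[of "foldl \<tau> d x" m] foldl_le[of d x]
  by (cases "foldl \<tau> d x = 0") (auto simp: in_Lang)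

lemma acc_count_0 [simp]: "r \<le> d \<Longrightarrow> acc_count 0 r k = 0" "q \<le> d \<Longrightarrow> acc_count q 0 k = 0"
  by (auto simp: acc_count_def not_less card_eq_0_iff dest: foldl_le)

text \<open>The words are sorted by the position l < m at which they first drop below
  \<open>u\<close> and by the letter taken there; the remaining n - l - 1 letters are free.\<close>

lemma count_below:
  assumes "m \<le> n"
  shows "card {v. length v = n \<and> foldl \<tau> q v + r > d \<and>
           (\<exists>l<m. take l v = stake l u \<and> v ! l < u !! l)} =
    (\<Sum>l<m. \<Sum>a | a < u !! l. acc_count (foldl \<tau> q (stake l u @ [a])) r (n - l - 1))"
  using assms
proof (induction m)
  case (Suc m)
  let ?A = "\<lambda>m. {v. length v = n \<and> foldl \<tau> q v + r > d \<and>
              (\<exists>l<m. take l v = stake l u \<and> v ! l < u !! l)}"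
  let ?B = "{v. length v = n \<and> foldl \<tau> q v + r > d \<and> take m v = stake m u \<and> v ! m < u !! m}"
  have fin: "finite (?A m)" "finite ?B"
    by (auto intro: finite_subset[OF _ finite_lists_eq[of n]])
  have un: "?A (Suc m) = ?A m \<union> ?B"
    by (auto simp: less_Suc_eq)
  have "?A m \<inter> ?B = {}"
  proof (intro equals0I)
    fix v assume "v \<in> ?A m \<inter> ?B"
    then obtain l where l: "l < m" "v ! l < u !! l" "take m v = stake m u"
      by auto
    have "take m v ! l = stake m u ! l"
      using l(3) by simp
    with l(1,2) show False by simp
  qed
  then have "card (?A (Suc m)) = card (?A m) + card ?B"
    unfolding un by (rule card_Un_disjoint[OF fin])
  moreover have "card ?B = (\<Sum>a | a < u !! m. acc_count (foldl \<tau> q (stake m u @ [a])) r (n - m - 1))"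
  proof -
    let ?C = "\<lambda>a. {v. length v = n - m - 1 \<and> foldl \<tau> (foldl \<tau> q (stake m u @ [a])) v + r > d}"
    have "?B = (\<Union>a\<in>{a. a < u !! m}. (\<lambda>v. stake m u @ a # v) ` ?C a)" (is "_ = ?D")
    proof (intro equalityI subsetI)
      fix v assume v: "v \<in> ?B"
      then have eq: "v = stake m u @ v ! m # drop (Suc m) v"
        using Suc.prems id_take_nth_drop[of m v] by simp
      have "foldl \<tau> q v = foldl \<tau> q (stake m u @ v ! m # drop (Suc m) v)"
        using eq by (rule arg_cong)
      then have "drop (Suc m) v \<in> ?C (v ! m)"
        using v Suc.prems by simp
      then show "v \<in> ?D"
        using v eq by blast
    next
      fix v assume "v \<in> ?D"
      then show "v \<in> ?B"
        using Suc.prems by (auto simp: nth_append)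
    qed
    moreover have "card ?D = (\<Sum>a | a < u !! m. card ((\<lambda>v. stake m u @ a # v) ` ?C a))"
    proof (rule card_UN_disjoint)
      have "finite (?C a)" for a
        by (rule finite_subset[OF _ finite_lists_eq[of "n - m - 1"]]) auto
      then show "\<forall>a\<in>{a. a < u !! m}. finite ((\<lambda>v. stake m u @ a # v) ` ?C a)"
        by blast
    qed auto
    moreover have "card ((\<lambda>v. stake m u @ a # v) ` ?C a) = card (?C a)" for a
      by (rule card_image) (simp add: inj_on_def)
    ultimately show ?thesis
      by (simp add: acc_count_def)
  qed
  ultimately show ?case
    using Suc by simp
qed simp

end

section \<open>Eigenvectors and values of infinite words\<close>

text \<open>\<open>P\<close> stands for the characteristic polynomial of the incidence matrix. Only
  its arithmetic is recorded here, so that the analysis does not depend on matrices.\<close>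

locale pisot_numeration = ordered_automaton d \<tau> a0
  for d :: nat and \<tau> :: "nat \<Rightarrow> 'a::{finite,linorder} \<Rightarrow> nat" and a0 :: 'a +
  fixes \<beta> :: real and P :: "rat poly" and \<eta> \<theta> :: "nat \<Rightarrow> real"
  assumes \<beta>_gt_1: "\<beta> > 1"
    and P_irreducible: "irreducible P"
    and P_\<beta>: "rpoly P \<beta> = 0"
    and P_pisot: "rpoly P \<gamma> = 0 \<Longrightarrow> \<gamma> \<noteq> complex_of_real \<beta> \<Longrightarrow> cmod \<gamma> < 1"
    and \<eta>_in: "q \<le> d \<Longrightarrow> \<eta> q \<in> rat_adjoin \<beta>"
    and \<eta>_d: "\<eta> d = 1"
    and \<eta>_0: "\<eta> 0 = 0"
    and \<eta>_eigen: "q \<le> d \<Longrightarrow> (\<Sum>a\<in>UNIV. \<eta> (\<tau> q a)) = \<beta> * \<eta> q"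
    and \<theta>_in: "r \<le> d \<Longrightarrow> \<theta> r \<in> rat_adjoin \<beta>"
    and \<theta>_0: "\<theta> 0 = 0"
    and \<theta>_expansion: "1 \<le> q \<Longrightarrow> q \<le> d \<Longrightarrow> 1 \<le> r \<Longrightarrow> r \<le> d \<Longrightarrow>
      of_nat (card {v. length v = k \<and> foldl \<tau> q v + r > d})
        = (\<Sum>\<gamma>\<in>conjugates \<beta>. conj_image \<beta> \<gamma> (\<eta> q) * conj_image \<beta> \<gamma> (\<theta> r) * \<gamma> ^ k)"
begin

section \<open>Conjugation and the asymptotics of the counts\<close>

lemma conjugates_iff: "\<gamma> \<in> conjugates \<beta> \<longleftrightarrow> rpoly P \<gamma> = 0"
  using conjugates_eq[OF P_irreducible P_\<beta>] by simp

lemma finite_conjugates: "finite (conjugates \<beta>)"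
proof -
  have "map_poly of_rat P \<noteq> (0 :: complex poly)"
    using P_irreducible by auto
  then show ?thesis
    using poly_roots_finite[of "map_poly of_rat P :: complex poly"]
    by (simp add: conjugates_eq[OF P_irreducible P_\<beta>] rpoly_def)
qed

lemma \<beta>_in_conjugates: "complex_of_real \<beta> \<in> conjugates \<beta>"
  using P_\<beta> by (simp add: conjugates_iff rpoly_of_real)

abbreviation other_conj :: "complex set" where
  "other_conj \<equiv> conjugates \<beta> - {complex_of_real \<beta>}"

lemma other_conj_less_1: "\<gamma> \<in> other_conj \<Longrightarrow> cmod \<gamma> < 1"
  using P_pisot[of \<gamma>] by (simp add: conjugates_iff)

lemma conj_rpoly: "\<gamma> \<in> conjugates \<beta> \<Longrightarrow> conj_image \<beta> \<gamma> (rpoly q \<beta>) = rpoly q \<gamma>"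
  using conj_image_rpoly[OF P_irreducible P_\<beta>] by (simp add: conjugates_iff)

lemma rat_adjoin_rpoly: "z \<in> rat_adjoin \<beta> \<Longrightarrow> \<exists>p. z = rpoly p \<beta>"
  using rat_adjoin_eq[OF P_irreducible P_\<beta>] by auto

context
  fixes \<gamma> assumes \<gamma>: "\<gamma> \<in> conjugates \<beta>"
begin

lemma conj_add: "x \<in> rat_adjoin \<beta> \<Longrightarrow> y \<in> rat_adjoin \<beta> \<Longrightarrow>
    conj_image \<beta> \<gamma> (x + y) = conj_image \<beta> \<gamma> x + conj_image \<beta> \<gamma> y"
  using conj_rpoly[OF \<gamma>] by (auto dest!: rat_adjoin_rpoly simp flip: rpoly_add)

lemma conj_diff: "x \<in> rat_adjoin \<beta> \<Longrightarrow> y \<in> rat_adjoin \<beta> \<Longrightarrow>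
    conj_image \<beta> \<gamma> (x - y) = conj_image \<beta> \<gamma> x - conj_image \<beta> \<gamma> y"
  using conj_rpoly[OF \<gamma>] by (auto dest!: rat_adjoin_rpoly simp flip: rpoly_diff)

lemma conj_mult: "x \<in> rat_adjoin \<beta> \<Longrightarrow> y \<in> rat_adjoin \<beta> \<Longrightarrow>
    conj_image \<beta> \<gamma> (x * y) = conj_image \<beta> \<gamma> x * conj_image \<beta> \<gamma> y"
  using conj_rpoly[OF \<gamma>] by (auto dest!: rat_adjoin_rpoly simp flip: rpoly_mult)

lemma conj_0 [simp]: "conj_image \<beta> \<gamma> 0 = 0" and conj_1 [simp]: "conj_image \<beta> \<gamma> 1 = 1"
  and conj_\<beta> [simp]: "conj_image \<beta> \<gamma> \<beta> = \<gamma>"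
  using conj_rpoly[OF \<gamma>, of 0] conj_rpoly[OF \<gamma>, of 1] conj_rpoly[OF \<gamma>, of "[:0, 1:]"] by simp_all

lemma conj_power: "x \<in> rat_adjoin \<beta> \<Longrightarrow> conj_image \<beta> \<gamma> (x ^ n) = conj_image \<beta> \<gamma> x ^ n"
  by (induction n) (simp_all add: conj_mult rat_adjoin_power)

lemma conj_sum: "(\<And>i. i \<in> I \<Longrightarrow> f i \<in> rat_adjoin \<beta>) \<Longrightarrow>
    conj_image \<beta> \<gamma> (\<Sum>i\<in>I. f i) = (\<Sum>i\<in>I. conj_image \<beta> \<gamma> (f i))"
  by (induction I rule: infinite_finite_induct) (simp_all add: conj_add rat_adjoin_sum)

end

lemma conj_self: "z \<in> rat_adjoin \<beta> \<Longrightarrow> conj_image \<beta> (complex_of_real \<beta>) z = complex_of_real z"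
  using rat_adjoin_rpoly[of z] conj_rpoly[OF \<beta>_in_conjugates] by (auto simp: rpoly_of_real)

lemma acc_count_expansion:
  assumes "q \<le> d" "r \<le> d"
  shows "of_nat (acc_count q r k) =
    (\<Sum>\<gamma>\<in>conjugates \<beta>. conj_image \<beta> \<gamma> (\<eta> q) * conj_image \<beta> \<gamma> (\<theta> r) * \<gamma> ^ k)"
proof (cases "q = 0 \<or> r = 0")
  case True
  then have "acc_count q r k = 0"
    using assms by auto
  moreover have "conj_image \<beta> \<gamma> (\<eta> q) * conj_image \<beta> \<gamma> (\<theta> r) * \<gamma> ^ k = 0"
    if "\<gamma> \<in> conjugates \<beta>" for \<gamma>
    using True that by (auto simp: \<eta>_0 \<theta>_0)
  ultimately show ?thesis by simp
next
  case False
  then show ?thesis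
    using \<theta>_expansion[of q r k] assms by (simp add: acc_count_def)
qed

lemma acc_count_expansion':
  assumes "q \<le> d" "r \<le> d"
  shows "of_nat (acc_count q r k) = complex_of_real (\<eta> q * \<theta> r * \<beta> ^ k) +
    (\<Sum>\<gamma>\<in>other_conj. conj_image \<beta> \<gamma> (\<eta> q) * conj_image \<beta> \<gamma> (\<theta> r) * \<gamma> ^ k)"
  unfolding acc_count_expansion[OF assms]
  by (subst sum.remove[OF finite_conjugates \<beta>_in_conjugates])
    (simp add: conj_self \<eta>_in \<theta>_in assms)

text \<open>The Pisot property enters here: all conjugates other than \<beta> have modulus below 1,
  so together they contribute a bounded error, uniformly over the finitely many pairs of
  states.\<close>

lemma acc_count_approx:
  "\<exists>C\<ge>0. \<forall>q\<le>d. \<forall>r\<le>d. \<forall>k. \<bar>real (acc_count q r k) - \<eta> q * \<theta> r * \<beta> ^ k\<bar> \<le> C"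
proof -
  define D where "D q r = (\<Sum>\<gamma>\<in>other_conj. cmod (conj_image \<beta> \<gamma> (\<eta> q) * conj_image \<beta> \<gamma> (\<theta> r)))"
    for q r
  define C where "C = (\<Sum>q\<le>d. \<Sum>r\<le>d. D q r)"
  have D: "0 \<le> D q r" for q r
    unfolding D_def by (intro sum_nonneg) simp
  have DC: "D q r \<le> C" if "q \<le> d" "r \<le> d" for q r
  proof -
    have "D q r \<le> (\<Sum>r\<le>d. D q r)"
      using that D by (intro member_le_sum) auto
    also have "\<dots> \<le> C"
      unfolding C_def using that D by (intro member_le_sum sum_nonneg) auto
    finally show ?thesis .
  qed
  have "\<bar>real (acc_count q r k) - \<eta> q * \<theta> r * \<beta> ^ k\<bar> \<le> C" if qr: "q \<le> d" "r \<le> d" for q r k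
  proof -
    have "complex_of_real (real (acc_count q r k) - \<eta> q * \<theta> r * \<beta> ^ k) =
      (\<Sum>\<gamma>\<in>other_conj. conj_image \<beta> \<gamma> (\<eta> q) * conj_image \<beta> \<gamma> (\<theta> r) * \<gamma> ^ k)"
      using acc_count_expansion'[OF qr, of k] by simp
    then have "\<bar>real (acc_count q r k) - \<eta> q * \<theta> r * \<beta> ^ k\<bar> =
      cmod (\<Sum>\<gamma>\<in>other_conj. conj_image \<beta> \<gamma> (\<eta> q) * conj_image \<beta> \<gamma> (\<theta> r) * \<gamma> ^ k)"
      by (metis norm_of_real)
    also have "\<dots> \<le> D q r"
      unfolding D_def
    proof (rule sum_norm_le)
      fix \<gamma> assume "\<gamma> \<in> other_conj"
      then have "cmod \<gamma> ^ k \<le> 1"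
        using other_conj_less_1[of \<gamma>] by (intro power_le_one) auto
      then show "cmod (conj_image \<beta> \<gamma> (\<eta> q) * conj_image \<beta> \<gamma> (\<theta> r) * \<gamma> ^ k)
        \<le> cmod (conj_image \<beta> \<gamma> (\<eta> q) * conj_image \<beta> \<gamma> (\<theta> r))"
        by (simp add: norm_mult norm_power mult_left_le)
    qed
    finally show ?thesis
      using DC[OF qr] by simp
  qed
  moreover have "0 \<le> C"
    unfolding C_def using D by (intro sum_nonneg)
  ultimately show ?thesis by blast
qed

lemma acc_count_lim:
  assumes "q \<le> d" "r \<le> d"
  shows "(\<lambda>k. real (acc_count q r k) / \<beta> ^ k) \<longlonglongrightarrow> \<eta> q * \<theta> r"
proof -
  obtain C where C: "\<And>k. \<bar>real (acc_count q r k) - \<eta> q * \<theta> r * \<beta> ^ k\<bar> \<le> C"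
    using acc_count_approx assms by blast
  have "(\<lambda>k. C * (1 / \<beta>) ^ k) \<longlonglongrightarrow> C * 0"
    by (rule tendsto_mult_left[OF LIMSEQ_power_zero]) (use \<beta>_gt_1 in simp)
  then have "(\<lambda>k. C * (1 / \<beta>) ^ k) \<longlonglongrightarrow> 0"
    by simp
  moreover have "norm (real (acc_count q r k) / \<beta> ^ k - \<eta> q * \<theta> r) \<le> C * (1 / \<beta>) ^ k" for k
  proof -
    have "real (acc_count q r k) / \<beta> ^ k - \<eta> q * \<theta> r =
        (real (acc_count q r k) - \<eta> q * \<theta> r * \<beta> ^ k) / \<beta> ^ k"
      using \<beta>_gt_1 by (simp add: diff_divide_distrib)
    then show ?thesis
      using divide_right_mono[OF C[of k], of "\<beta> ^ k"] \<beta>_gt_1 by (simp add: power_divide)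
  qed
  ultimately have "(\<lambda>k. real (acc_count q r k) / \<beta> ^ k - \<eta> q * \<theta> r) \<longlonglongrightarrow> 0"
    by (rule Lim_null_comparison[OF always_eventually, OF allI, rotated])
  then show ?thesis
    by (simp add: LIM_zero_iff)
qed

lemma finite_acc: "finite {v. length v = k \<and> foldl \<tau> q v + r > d}"
  by (rule finite_subset[OF _ finite_lists_eq[of k]]) auto

text \<open>Nonnegativity passes to the limit of the counts. If \<open>\<theta> d\<close> vanished,
  so would all its conjugates, and the expansion would give no accepted word of length 0, although
  the empty word is accepted.\<close>

lemma \<theta>_d_pos: "\<theta> d > 0"
proof -
  have "0 \<le> \<eta> d * \<theta> d"
    by (rule LIMSEQ_le_const[OF acc_count_lim[of d d]]) (use \<beta>_gt_1 in auto)
  moreover have "\<theta> d \<noteq> 0"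
  proof
    assume "\<theta> d = 0"
    then have "of_nat (acc_count d d 0) = (0 :: complex)"
      unfolding acc_count_expansion[OF order_refl order_refl] by (intro sum.neutral) auto
    moreover have "[] \<in> {v. length v = 0 \<and> foldl \<tau> d v + d > d}"
      using d_pos by simp
    then have "acc_count d d 0 \<noteq> 0"
      using finite_acc[of 0 d d] unfolding acc_count_def by (auto simp: card_eq_0_iff)
    ultimately show False by simp
  qed
  ultimately show ?thesis
    by (simp add: \<eta>_d)
qed

text \<open>The word consisting of \<open>d\<close> letters \<open>a0\<close> leads from
  \<open>q\<close> to \<open>d\<close>; putting it in front embeds the words accepted from
  \<open>d\<close> into those accepted from \<open>q\<close>, at the price of the factor
  \<open>\<beta> ^ d\<close> in the limit.\<close>

lemma \<eta>_pos:
  assumes "0 < q" "q \<le> d"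
  shows "\<eta> q > 0"
proof -
  have le: "acc_count d d k \<le> acc_count q d (k + d)" for k
    unfolding acc_count_def
  proof (rule card_inj_on_le)
    show "(\<lambda>v. replicate d a0 @ v) ` {v. length v = k \<and> foldl \<tau> d v + d > d} \<subseteq>
        {v. length v = k + d \<and> foldl \<tau> q v + d > d}"
      using foldl_a0_eq_d[OF assms order_refl] by auto
    show "inj_on (\<lambda>v. replicate d a0 @ v) {v. length v = k \<and> foldl \<tau> d v + d > d}"
      by (simp add: inj_on_def)
  qed (rule finite_acc)
  have "(\<lambda>k. real (acc_count d d k) / \<beta> ^ k / \<beta> ^ d) \<longlonglongrightarrow> \<eta> d * \<theta> d / \<beta> ^ d"
    using acc_count_lim[of d d] \<beta>_gt_1 by (intro tendsto_divide tendsto_const) auto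
  moreover have "(\<lambda>k. real (acc_count q d (k + d)) / \<beta> ^ (k + d)) \<longlonglongrightarrow> \<eta> q * \<theta> d"
    using acc_count_lim[OF assms(2) order_refl] by (rule LIMSEQ_ignore_initial_segment)
  ultimately have "\<eta> d * \<theta> d / \<beta> ^ d \<le> \<eta> q * \<theta> d"
  proof (rule LIMSEQ_le)
    have "real (acc_count d d k) / \<beta> ^ k / \<beta> ^ d \<le> real (acc_count q d (k + d)) / \<beta> ^ (k + d)" for k
      using le[of k] \<beta>_gt_1 by (simp add: power_add divide_right_mono)
    then show "\<exists>N. \<forall>k\<ge>N. real (acc_count d d k) / \<beta> ^ k / \<beta> ^ d
        \<le> real (acc_count q d (k + d)) / \<beta> ^ (k + d)"
      by blast
  qed
  moreover have "0 < \<eta> d * \<theta> d / \<beta> ^ d"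
    using \<theta>_d_pos \<beta>_gt_1 by (simp add: \<eta>_d)
  ultimately have "0 < \<eta> q * \<theta> d"
    by linarith
  then show ?thesis
    using \<theta>_d_pos by (rule zero_less_mult_pos2)
qed

lemma \<eta>_nonneg: "q \<le> d \<Longrightarrow> \<eta> q \<ge> 0"
  using \<eta>_pos[of q] \<eta>_0 by (cases "q = 0") auto

section \<open>Values of infinite words as points of nested intervals\<close>

definition digit :: "'a stream \<Rightarrow> nat \<Rightarrow> real" where
  "digit u l = (\<Sum>a | a < u !! l. \<eta> (foldl \<tau> d (stake l u @ [a])))"

definition partial_value :: "nat \<Rightarrow> 'a stream \<Rightarrow> real" where
  "partial_value n u = (\<Sum>l<n. digit u l / \<beta> ^ (l + 1))"

text \<open>The series of the \<epsilon>_j divided by \<beta>^j, which turns out to be the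
  normalized value of \<open>u\<close>. It is defined for all streams, so order and continuity can
  be studied without the limit in \<open>omega_val\<close>.\<close>

definition stream_value :: "'a stream \<Rightarrow> real" where
  "stream_value u = (\<Sum>l. digit u l / \<beta> ^ (l + 1))"

lemma digit_eq_eps: "digit u l = eps d \<tau> \<eta> u (l + 1)"
  by (simp add: digit_def eps_def)

lemma digit_nonneg: "digit u l \<ge> 0"
  unfolding digit_def by (intro sum_nonneg \<eta>_nonneg foldl_le order_refl)

lemma digit_cong:
  assumes "stake (Suc l) u = stake (Suc l) v"
  shows "digit u l = digit v l"
  unfolding digit_def stake_eqD[OF assms lessI] stake_eq_mono[OF assms le_SucI[OF order_refl]] ..

lemma partial_value_cong:
  assumes "stake n u = stake n v"
  shows "partial_value n u = partial_value n v"
proof -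
  have "digit u l = digit v l" if "l < n" for l
    using that by (intro digit_cong stake_eq_mono[OF assms]) simp
  then show ?thesis
    by (simp add: partial_value_def)
qed

lemma incseq_partial_value: "incseq (\<lambda>n. partial_value n u)"
  unfolding partial_value_def using \<beta>_gt_1
  by (intro incseq_SucI) (simp add: digit_nonneg)

text \<open>A prefix of length n owns the interval that starts at \<open>partial_value n u\<close>
  and has length \<eta>_q / \<beta>^n, where q is the state reached. By the eigenvector equation the
  intervals of its one-letter extensions tile it, so right endpoints can only decrease.\<close>

lemma decseq_upper_value: "decseq (\<lambda>n. partial_value n u + \<eta> (foldl \<tau> d (stake n u)) / \<beta> ^ n)"
proof (rule decseq_SucI)
  fix n
  let ?q = "foldl \<tau> d (stake n u)"
  have "digit u n + \<eta> (\<tau> ?q (u !! n)) = (\<Sum>a\<in>insert (u !! n) {a. a < u !! n}. \<eta> (\<tau> ?q a))"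
    by (subst sum.insert) (auto simp: digit_def)
  also have "\<dots> \<le> (\<Sum>a\<in>UNIV. \<eta> (\<tau> ?q a))"
    by (intro sum_mono2) (auto intro!: \<eta>_nonneg \<tau>_le foldl_le)
  also have "\<dots> = \<beta> * \<eta> ?q"
    by (rule \<eta>_eigen) (simp add: foldl_le)
  finally have "(digit u n + \<eta> (\<tau> ?q (u !! n))) / \<beta> ^ (n + 1) \<le> \<beta> * \<eta> ?q / \<beta> ^ (n + 1)"
    using \<beta>_gt_1 by (intro divide_right_mono) auto
  then have "digit u n / \<beta> ^ (n + 1) + \<eta> (\<tau> ?q (u !! n)) / \<beta> ^ (n + 1) \<le> \<eta> ?q / \<beta> ^ n"
    using \<beta>_gt_1 by (simp add: add_divide_distrib)
  moreover have "foldl \<tau> d (stake (Suc n) u) = \<tau> ?q (u !! n)"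
    by (simp add: stake_Suc del: stake.simps)
  ultimately show "partial_value (Suc n) u + \<eta> (foldl \<tau> d (stake (Suc n) u)) / \<beta> ^ Suc n
      \<le> partial_value n u + \<eta> ?q / \<beta> ^ n"
    by (simp add: partial_value_def del: stake.simps)
qed

lemma upper_value_nonneg: "0 \<le> \<eta> (foldl \<tau> d (stake n u)) / \<beta> ^ n"
  using \<beta>_gt_1 by (simp add: \<eta>_nonneg foldl_le)

lemma partial_value_le_1: "partial_value n u \<le> 1"
  using decseqD[OF decseq_upper_value, of 0 n u] upper_value_nonneg[of n u]
  by (simp add: partial_value_def \<eta>_d)

lemma summable_digits: "summable (\<lambda>l. digit u l / \<beta> ^ (l + 1))"
  using \<beta>_gt_1 partial_value_le_1[of _ u]
  by (intro summableI_nonneg_bounded[of _ 1]) (auto simp: partial_value_def digit_nonneg)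

lemma partial_value_lim: "(\<lambda>n. partial_value n u) \<longlonglongrightarrow> stream_value u"
  using summable_LIMSEQ[OF summable_digits[of u]] by (simp add: partial_value_def stream_value_def)

lemma partial_value_le: "partial_value n u \<le> stream_value u"
  using incseq_le[OF incseq_partial_value partial_value_lim] .

lemma stream_value_le: "stream_value u \<le> partial_value n u + \<eta> (foldl \<tau> d (stake n u)) / \<beta> ^ n"
proof (rule LIMSEQ_le_const2[OF partial_value_lim])
  have "partial_value m u \<le> partial_value n u + \<eta> (foldl \<tau> d (stake n u)) / \<beta> ^ n"
    if "n \<le> m" for m
    using decseqD[OF decseq_upper_value that, of u] upper_value_nonneg[of m u] by linarith
  then show "\<exists>N. \<forall>m\<ge>N. partial_value m u \<le> partial_value n u + \<eta> (foldl \<tau> d (stake n u)) / \<beta> ^ n"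
    by blast
qed

lemma stream_value_nonneg: "0 \<le> stream_value u"
  using partial_value_le[of 0 u] by (simp add: partial_value_def)

text \<open>At the first difference the smaller letter owns an interval that lies to the left of the
  one owned by the larger letter.\<close>

lemma partial_value_less:
  assumes "stake n u = stake n v" "u !! n < v !! n"
  shows "partial_value (Suc n) u + \<eta> (foldl \<tau> d (stake (Suc n) u)) / \<beta> ^ Suc n
    \<le> partial_value (Suc n) v"
proof -
  let ?q = "foldl \<tau> d (stake n u)"
  have "digit u n + \<eta> (\<tau> ?q (u !! n)) = (\<Sum>a\<in>insert (u !! n) {a. a < u !! n}. \<eta> (\<tau> ?q a))"
    by (subst sum.insert) (auto simp: digit_def)
  also have "\<dots> \<le> (\<Sum>a | a < v !! n. \<eta> (\<tau> ?q a))"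
    using assms(2) by (intro sum_mono2) (auto intro!: \<eta>_nonneg \<tau>_le foldl_le)
  also have "\<dots> = digit v n"
    using assms(1) by (simp add: digit_def)
  finally have "(digit u n + \<eta> (\<tau> ?q (u !! n))) / \<beta> ^ (n + 1) \<le> digit v n / \<beta> ^ (n + 1)"
    using \<beta>_gt_1 by (intro divide_right_mono) auto
  moreover have "foldl \<tau> d (stake (Suc n) u) = \<tau> ?q (u !! n)"
    by (simp add: stake_Suc del: stake.simps)
  ultimately show ?thesis
    using partial_value_cong[OF assms(1)]
    by (simp add: partial_value_def add_divide_distrib del: stake.simps)
qed

lemma stream_value_mono:
  assumes "stream_lex_less u v"
  shows "stream_value u \<le> stream_value v"
proof -
  obtain n where n: "stake n u = stake n v" "u !! n < v !! n"
    using assms unfolding stream_lex_less_def by blast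
  show ?thesis
    using stream_value_le[of u "Suc n"] partial_value_less[OF n] partial_value_le[of "Suc n" v]
    by linarith
qed

lemma digit_sconst:
  assumes "length w \<le> l"
  shows "digit (w @- sconst a0) l = 0"
proof -
  have "(w @- sconst a0) !! l = a0"
    using assms by (simp add: shift_snth_ge)
  then have "{a. a < (w @- sconst a0) !! l} = {}"
    by (simp add: leD[OF a0_min])
  then show ?thesis
    by (simp only: digit_def sum.empty)
qed

lemma stream_value_sconst:
  assumes "length w \<le> n"
  shows "stream_value (w @- sconst a0) = partial_value n (w @- sconst a0)"
proof (rule LIMSEQ_unique[OF partial_value_lim])
  have "partial_value m (w @- sconst a0) = partial_value n (w @- sconst a0)" if "n \<le> m" for m
    unfolding partial_value_def using that assms
    by (intro sum.mono_neutral_right) (auto simp: digit_sconst)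
  then have "\<forall>\<^sub>F m in sequentially.
      partial_value m (w @- sconst a0) = partial_value n (w @- sconst a0)"
    unfolding eventually_sequentially by blast
  then show "(\<lambda>m. partial_value m (w @- sconst a0)) \<longlonglongrightarrow> partial_value n (w @- sconst a0)"
    by (rule tendsto_eventually)
qed

text \<open>Strictness can fail in general, because a right endpoint may coincide with the next left
  endpoint. A word of \<open>Lang\<close> padded with \<open>a0\<close> sits at the left endpoint of
  its intervals, and these have positive length since the state never becomes 0.\<close>

lemma stream_value_strict_mono:
  assumes "stream_lex_less (w @- sconst a0) v" "w \<in> Lang"
  shows "stream_value (w @- sconst a0) < stream_value v"
proof -
  let ?u = "w @- sconst a0"
  obtain n where n: "stake n ?u = stake n v" "?u !! n < v !! n"
    using assms(1) unfolding stream_lex_less_def by blast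
  define m where "m = max (Suc n) (length w)"
  have "0 < foldl \<tau> d (stake m ?u)"
    using assms(2) append_a0_in_Lang[of w "m - length w"]
    by (subst stake_shift_sconst) (auto simp: m_def in_Lang)
  then have "0 < \<eta> (foldl \<tau> d (stake m ?u))"
    by (intro \<eta>_pos foldl_le) auto
  then have "stream_value ?u < partial_value m ?u + \<eta> (foldl \<tau> d (stake m ?u)) / \<beta> ^ m"
    using stream_value_sconst[of w m] \<beta>_gt_1 by (simp add: m_def)
  also have "\<dots> \<le> partial_value (Suc n) ?u + \<eta> (foldl \<tau> d (stake (Suc n) ?u)) / \<beta> ^ Suc n"
    using decseqD[OF decseq_upper_value, of "Suc n" m ?u] by (simp add: m_def)
  also have "\<dots> \<le> partial_value (Suc n) v"
    using partial_value_less[OF n] .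
  also have "\<dots> \<le> stream_value v"
    by (rule partial_value_le)
  finally show ?thesis .
qed

lemma stream_value_less_iff:
  assumes "w \<in> Lang"
  shows "stream_value (w @- sconst a0) < stream_value v \<longleftrightarrow> stream_lex_less (w @- sconst a0) v"
proof
  assume *: "stream_value (w @- sconst a0) < stream_value v"
  then have "\<not> stream_lex_less v (w @- sconst a0)"
    using stream_value_mono leD by blast
  moreover have "v \<noteq> w @- sconst a0"
  proof
    assume "v = w @- sconst a0"
    from * show False
      unfolding \<open>v = w @- sconst a0\<close> by simp
  qed
  ultimately show "stream_lex_less (w @- sconst a0) v"
    using stream_lex_less_linear by blast
qed (rule stream_value_strict_mono[OF _ assms])

end

section \<open>The normalized value\<close>

lemma shortlex_less_iff:
  "shortlex_less v w \<longleftrightarrow> length v < length w \<or>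
    length v = length w \<and> (\<exists>l<length w. take l v = take l w \<and> v ! l < w ! l)"
proof -
  let ?R = "{(a, b). a < (b :: 'a)}"
  have "(v, w) \<in> lex ?R \<longleftrightarrow> (\<exists>l<length w. take l v = take l w \<and> v ! l < w ! l)"
    if len: "length v = length w"
  proof
    assume "(v, w) \<in> lex ?R"
    then show "\<exists>l<length w. take l v = take l w \<and> v ! l < w ! l"
      by (rule lex_take_index) auto
  next
    assume "\<exists>l<length w. take l v = take l w \<and> v ! l < w ! l"
    then obtain l where l: "l < length w" "take l v = take l w" "v ! l < w ! l"
      by blast
    have v: "v = take l v @ v ! l # drop (Suc l) v"
      using l(1) len by (simp add: id_take_nth_drop)
    have w: "w = take l v @ w ! l # drop (Suc l) w"
      using l(1,2) by (simp add: id_take_nth_drop)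
    have "\<exists>xys x y xs' ys'. v = xys @ x # xs' \<and> w = xys @ y # ys' \<and> (x, y) \<in> ?R"
      by (intro exI conjI) (rule v, rule w, simp add: l(3))
    then show "(v, w) \<in> lex ?R"
      by (simp add: lex_conv len)
  qed
  then show ?thesis
    by (auto simp: shortlex_less_def lenlex_conv)
qed

context ordered_automaton
begin

text \<open>As 0 is absorbing, \<open>Lang\<close> is closed under prefixes; the prefixes of
  \<open>u\<close> themselves then form a sequence converging to \<open>u\<close>.\<close>

lemma omega_language_iff: "u \<in> omega_language Lang \<longleftrightarrow> (\<forall>n. stake n u \<in> Lang)"
proof
  assume "u \<in> omega_language Lang"
  then obtain w where w: "\<And>k. w k \<in> Lang" "word_limit w u"
    by (auto simp: omega_language_def)
  show "\<forall>n. stake n u \<in> Lang"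
  proof
    fix n
    obtain k where "prefix (stake n u) (w k)"
      using w(2) unfolding word_limit_def by (meson eventually_happens' sequentially_bot)
    then show "stake n u \<in> Lang"
      using w(1)[of k] Lang_appendD1 by (auto simp: prefix_def)
  qed
next
  assume *: "\<forall>n. stake n u \<in> Lang"
  have "prefix (stake n u) (stake k u)" if "n \<le> k" for n k
    using take_is_prefix[of n "stake k u"] that by (simp add: take_stake min_absorb1)
  then have "word_limit (\<lambda>k. stake k u) u"
    unfolding word_limit_def eventually_sequentially by blast
  with * have "\<exists>w. (\<forall>k. w k \<in> Lang) \<and> word_limit w u"
    by (intro exI[of _ "\<lambda>k. stake k u"]) simp
  then show "u \<in> omega_language Lang"
    by (simp add: omega_language_def)
qed

lemma sconst_in_omega: "w \<in> Lang \<Longrightarrow> w @- sconst a0 \<in> omega_language Lang"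
proof -
  assume w: "w \<in> Lang"
  have "stake n (w @- sconst a0) \<in> Lang" for n
  proof -
    have "prefix (stake n (w @- sconst a0)) (stake (max n (length w)) (w @- sconst a0))"
      using take_is_prefix[of n "stake (max n (length w)) (w @- sconst a0)"]
      by (simp add: take_stake min_absorb1)
    moreover have "stake (max n (length w)) (w @- sconst a0) \<in> Lang"
      using w append_a0_in_Lang by (subst stake_shift_sconst) simp_all
    ultimately show ?thesis
      using Lang_appendD1 by (auto simp: prefix_def)
  qed
  then show ?thesis
    by (simp add: omega_language_iff)
qed

lemma length_eq_in_Lang: "{v \<in> Lang. length v = k} = {v. length v = k \<and> foldl \<tau> d v + d > d}"
  by (auto simp: in_Lang)

lemma card_Lang_eq: "card {v \<in> Lang. length v = k} = acc_count d d k"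
  by (simp only: length_eq_in_Lang acc_count_def)

lemma finite_Lang_le: "finite {v \<in> Lang. length v = k}"
  by (rule finite_subset[OF _ finite_lists_eq[of k]]) auto

lemma card_Lang_less: "card {v \<in> Lang. length v < n} = (\<Sum>i<n. acc_count d d i)"
proof -
  have "{v \<in> Lang. length v < n} = (\<Union>i\<in>{..<n}. {v \<in> Lang. length v = i})"
    by auto
  also have "card \<dots> = (\<Sum>i<n. card {v \<in> Lang. length v = i})"
    by (rule card_UN_disjoint) (auto simp: finite_Lang_le)
  finally show ?thesis
    by (simp add: card_Lang_eq)
qed

lemma count_upto_Lang: "count_upto Lang n = (\<Sum>i<Suc n. acc_count d d i)"
  using card_Lang_less[of "Suc n"] by (simp add: count_upto_def less_Suc_eq_le)

text \<open>Words below \<open>w\<close> are shorter, or of equal length and lexicographically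
  smaller. The padding only turns \<open>w\<close> into a stream to which \<open>count_below\<close>
  applies.\<close>

lemma ans_val_Lang:
  "ans_val Lang w = (\<Sum>i<length w. acc_count d d i) +
    (\<Sum>l<length w. \<Sum>a | a < (w @- sconst a0) !! l.
      acc_count (foldl \<tau> d (stake l (w @- sconst a0) @ [a])) d (length w - l - 1))"
proof -
  let ?n = "length w" and ?u = "w @- sconst a0"
  let ?B = "{v. length v = ?n \<and> foldl \<tau> d v + d > d \<and>
    (\<exists>l<?n. take l v = stake l ?u \<and> v ! l < ?u !! l)}"
  have "(\<exists>l<?n. take l v = take l w \<and> v ! l < w ! l) \<longleftrightarrow>
      (\<exists>l<?n. take l v = stake l ?u \<and> v ! l < ?u !! l)" for v
    by (intro ex_cong1 conj_cong refl) (simp_all add: stake_shift_eq shift_nth)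
  then have "{v \<in> Lang. shortlex_less v w} = {v \<in> Lang. length v < ?n} \<union> ?B"
    by (auto simp: shortlex_less_iff in_Lang)
  moreover have "finite {v \<in> Lang. length v < ?n}"
    by (rule finite_subset[of _ "\<Union>i<?n. {v \<in> Lang. length v = i}"]) (auto simp: finite_Lang_le)
  moreover have "finite ?B"
    by (rule finite_subset[OF _ finite_lists_eq[of ?n]]) auto
  ultimately have "ans_val Lang w = card {v \<in> Lang. length v < ?n} + card ?B"
    unfolding ans_val_def by (simp only:) (rule card_Un_disjoint, auto)
  then show ?thesis
    by (simp only: card_Lang_less count_below[OF order_refl])
qed

end

context pisot_numeration
begin

lemma \<eta>_le_sum: "q \<le> d \<Longrightarrow> \<eta> q \<le> (\<Sum>q\<le>d. \<eta> q)"
  by (rule member_le_sum) (auto simp: \<eta>_nonneg)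

lemma stream_value_close:
  assumes "stake m u = stake m v"
  shows "\<bar>stream_value u - stream_value v\<bar> \<le> (\<Sum>q\<le>d. \<eta> q) / \<beta> ^ m"
proof -
  have "\<eta> (foldl \<tau> d (stake m v)) / \<beta> ^ m \<le> (\<Sum>q\<le>d. \<eta> q) / \<beta> ^ m"
    using \<beta>_gt_1 by (intro divide_right_mono \<eta>_le_sum foldl_le) auto
  then show ?thesis
    using stream_value_le[of u m] stream_value_le[of v m] partial_value_le[of m u]
      partial_value_le[of m v] partial_value_cong[OF assms] assms
    by (simp only: abs_le_iff) linarith
qed

lemma stream_value_word_limit:
  assumes "word_limit w u"
  shows "(\<lambda>k. stream_value (w k @- sconst a0)) \<longlonglongrightarrow> stream_value u"
proof (rule LIMSEQ_I)
  fix r :: real assume "r > 0"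
  have "(\<lambda>m. (\<Sum>q\<le>d. \<eta> q) * (1 / \<beta>) ^ m) \<longlonglongrightarrow> (\<Sum>q\<le>d. \<eta> q) * 0"
    by (rule tendsto_mult_left[OF LIMSEQ_power_zero]) (use \<beta>_gt_1 in simp)
  then have "\<forall>\<^sub>F m in sequentially. (\<Sum>q\<le>d. \<eta> q) * (1 / \<beta>) ^ m < r"
    using \<open>r > 0\<close> by (intro order_tendstoD) auto
  then obtain m where m: "(\<Sum>q\<le>d. \<eta> q) / \<beta> ^ m < r"
    by (auto simp: eventually_sequentially power_divide)
  obtain K where K: "\<And>k. k \<ge> K \<Longrightarrow> prefix (stake m u) (w k)"
    using assms unfolding word_limit_def eventually_sequentially by blast
  have "norm (stream_value (w k @- sconst a0) - stream_value u) < r" if k: "k \<ge> K" for k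
  proof -
    obtain s where s: "w k = stake m u @ s"
      using K[OF k] by (auto simp: prefix_def)
    have "stake m (w k @- sconst a0) = stake m u"
      unfolding s by (subst stake_shift_eq) auto
    from stream_value_close[OF this] m show ?thesis
      by simp
  qed
  then show "\<exists>K. \<forall>k\<ge>K. norm (stream_value (w k @- sconst a0) - stream_value u) < r"
    by blast
qed

lemma word_limit_length:
  assumes "word_limit w u"
  shows "filterlim (\<lambda>k. length (w k)) at_top sequentially"
  unfolding filterlim_at_top
proof
  fix n
  have "\<forall>\<^sub>F k in sequentially. prefix (stake n u) (w k)"
    using assms by (simp add: word_limit_def)
  then show "\<forall>\<^sub>F k in sequentially. n \<le> length (w k)"
    by (rule eventually_mono) (auto dest: prefix_length_le)
qed

lemma linear_over_power: "(\<lambda>n. (C * real n) / \<beta> ^ n) \<longlonglongrightarrow> 0"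
proof -
  have "(\<lambda>n. C * (real n * (1 / \<beta>) ^ n)) \<longlonglongrightarrow> C * 0"
    using \<beta>_gt_1 by (intro tendsto_mult tendsto_const powser_times_n_limit_0) auto
  then show ?thesis
    by (simp add: power_divide)
qed

text \<open>The main terms form a geometric series. The bounded errors add up to at most C n, which
  is negligible against \<beta>^n.\<close>

lemma sum_count_lim:
  "(\<lambda>n. real (\<Sum>i<n. acc_count d d i) / \<beta> ^ n) \<longlonglongrightarrow> \<theta> d / (\<beta> - 1)"
proof -
  obtain C where C: "\<And>k. \<bar>real (acc_count d d k) - \<eta> d * \<theta> d * \<beta> ^ k\<bar> \<le> C"
    using acc_count_approx by blast
  have geo: "(\<Sum>i<n. \<theta> d * \<beta> ^ i) = \<theta> d / (\<beta> - 1) * (\<beta> ^ n - 1)" for n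
    using \<beta>_gt_1 by (simp add: geometric_sum flip: sum_distrib_left)
  have bound: "norm (real (\<Sum>i<n. acc_count d d i) / \<beta> ^ n - \<theta> d / (\<beta> - 1) * (1 - (1 / \<beta>) ^ n))
      \<le> (C * real n) / \<beta> ^ n" for n
  proof -
    have "\<bar>real (\<Sum>i<n. acc_count d d i) - (\<Sum>i<n. \<theta> d * \<beta> ^ i)\<bar> \<le> (\<Sum>i<n. C)"
      unfolding of_nat_sum sum_subtractf[symmetric]
      using C by (intro order.trans[OF sum_abs] sum_mono) (simp add: \<eta>_d)
    then have "\<bar>real (\<Sum>i<n. acc_count d d i) - \<theta> d / (\<beta> - 1) * (\<beta> ^ n - 1)\<bar> / \<beta> ^ n
        \<le> (C * real n) / \<beta> ^ n"
      unfolding geo using \<beta>_gt_1 by (intro divide_right_mono) (auto simp: mult.commute)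
    moreover have "real (\<Sum>i<n. acc_count d d i) / \<beta> ^ n - \<theta> d / (\<beta> - 1) * (1 - (1 / \<beta>) ^ n) =
        (real (\<Sum>i<n. acc_count d d i) - \<theta> d / (\<beta> - 1) * (\<beta> ^ n - 1)) / \<beta> ^ n"
      using \<beta>_gt_1 by (simp add: power_divide diff_divide_distrib right_diff_distrib)
    ultimately show ?thesis
      using \<beta>_gt_1 by (simp only: real_norm_def abs_divide) simp
  qed
  have "(\<lambda>n. real (\<Sum>i<n. acc_count d d i) / \<beta> ^ n - \<theta> d / (\<beta> - 1) * (1 - (1 / \<beta>) ^ n)) \<longlonglongrightarrow> 0"
    by (rule Lim_null_comparison[OF always_eventually linear_over_power[of C]]) (use bound in blast)
  moreover have "(\<lambda>n. \<theta> d / (\<beta> - 1) * (1 - (1 / \<beta>) ^ n)) \<longlonglongrightarrow> \<theta> d / (\<beta> - 1) * (1 - 0)"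
    by (rule tendsto_mult_left[OF tendsto_diff[OF tendsto_const LIMSEQ_power_zero]])
      (use \<beta>_gt_1 in simp)
  ultimately show ?thesis
    using tendsto_add by fastforce
qed

lemma count_upto_lim: "(\<lambda>n. real (count_upto Lang n) / \<beta> ^ n) \<longlonglongrightarrow> \<beta> * \<theta> d / (\<beta> - 1)"
proof -
  have "(\<lambda>n. \<beta> * (real (\<Sum>i<Suc n. acc_count d d i) / \<beta> ^ Suc n)) \<longlonglongrightarrow> \<beta> * (\<theta> d / (\<beta> - 1))"
    by (rule tendsto_mult_left[OF LIMSEQ_Suc[OF sum_count_lim]])
  then show ?thesis
    using \<beta>_gt_1 by (simp add: count_upto_Lang)
qed

lemma count_upto_pos: "count_upto Lang n > 0"
proof -
  have "[] \<in> {v \<in> Lang. length v = 0}"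
    by (simp add: Nil_in_Lang)
  then have "card {v \<in> Lang. length v = 0} > 0"
    using finite_Lang_le[of 0] by (auto simp: card_gt_0_iff)
  also have "\<dots> \<le> (\<Sum>i<Suc n. acc_count d d i)"
    unfolding card_Lang_eq by (rule member_le_sum) auto
  finally show ?thesis
    by (simp add: count_upto_Lang)
qed

text \<open>The quotient of the count by \<beta>^n has a positive limit, so its logarithm disappears
  after division by n.\<close>

lemma growth_base_Lang: "growth_base Lang = \<beta>"
proof -
  have "(\<lambda>n. ln (real (count_upto Lang n) / \<beta> ^ n)) \<longlonglongrightarrow> ln (\<beta> * \<theta> d / (\<beta> - 1))"
    using \<beta>_gt_1 \<theta>_d_pos by (intro tendsto_ln count_upto_lim) auto
  then have "(\<lambda>n. ln (real (count_upto Lang n) / \<beta> ^ n) * (1 / real n)) \<longlonglongrightarrow>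
      ln (\<beta> * \<theta> d / (\<beta> - 1)) * 0"
    by (intro tendsto_mult lim_1_over_n)
  then have "(\<lambda>n. ln (real (count_upto Lang n) / \<beta> ^ n) * (1 / real n) + ln \<beta>) \<longlonglongrightarrow> 0 + ln \<beta>"
    by (intro tendsto_add tendsto_const) simp
  moreover have "\<forall>\<^sub>F n in sequentially. ln (real (count_upto Lang n) / \<beta> ^ n) * (1 / real n) + ln \<beta> =
      ln (real (count_upto Lang n)) / real n"
    using eventually_gt_at_top[of 0]
  proof eventually_elim
    case (elim n)
    have "ln (real (count_upto Lang n) / \<beta> ^ n) = ln (real (count_upto Lang n)) - real n * ln \<beta>"
      using \<beta>_gt_1 count_upto_pos[of n] by (simp add: ln_div ln_realpow)
    then show ?case
      using elim by (simp add: field_simps)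
  qed
  ultimately have lim: "(\<lambda>n. ln (real (count_upto Lang n)) / real n) \<longlonglongrightarrow> ln \<beta>"
    using Lim_transform_eventually by fastforce
  show ?thesis
    unfolding growth_base_def
  proof (rule the_equality)
    show "\<beta> > 1 \<and> (\<lambda>n. ln (real (count_upto Lang n)) / real n) \<longlonglongrightarrow> ln \<beta>"
      using \<beta>_gt_1 lim by blast
    fix b assume b: "b > 1 \<and> (\<lambda>n. ln (real (count_upto Lang n)) / real n) \<longlonglongrightarrow> ln b"
    then have "ln b = ln \<beta>"
      using LIMSEQ_unique lim by blast
    then show "b = \<beta>"
      using b \<beta>_gt_1 by simp
  qed
qed

text \<open>Replacing each count by its main term costs at most C; there are at most
  \<open>CARD('a)\<close> terms for each position, hence an error linear in the length of
  \<open>w\<close>. The main terms sum to the multiple \<open>\<theta> d\<close> of the stream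
  value.\<close>

lemma ans_val_approx:
  "\<exists>C. \<forall>w. \<bar>real (ans_val Lang w) / \<beta> ^ length w -
      (real (\<Sum>i<length w. acc_count d d i) / \<beta> ^ length w + \<theta> d * stream_value (w @- sconst a0))\<bar>
    \<le> (C * real (length w)) / \<beta> ^ length w"
proof -
  obtain C where "C \<ge> 0" and
    C: "\<And>q k. q \<le> d \<Longrightarrow> \<bar>real (acc_count q d k) - \<eta> q * \<theta> d * \<beta> ^ k\<bar> \<le> C"
    using acc_count_approx by blast
  have "\<bar>real (ans_val Lang w) / \<beta> ^ length w -
      (real (\<Sum>i<length w. acc_count d d i) / \<beta> ^ length w + \<theta> d * stream_value (w @- sconst a0))\<bar>
    \<le> (C * real CARD('a) * real (length w)) / \<beta> ^ length w" for w
  proof -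
    let ?n = "length w" and ?u = "w @- sconst a0"
    define T where "T = (\<Sum>l<?n. \<Sum>a | a < ?u !! l.
      real (acc_count (foldl \<tau> d (stake l ?u @ [a])) d (?n - l - 1)))"
    define V where "V = (\<Sum>l<?n. \<Sum>a | a < ?u !! l.
      \<eta> (foldl \<tau> d (stake l ?u @ [a])) * \<theta> d * \<beta> ^ (?n - l - 1))"
    have "\<theta> d * \<beta> ^ ?n * (digit ?u l / \<beta> ^ (l + 1)) =
        (\<Sum>a | a < ?u !! l. \<eta> (foldl \<tau> d (stake l ?u @ [a])) * \<theta> d * \<beta> ^ (?n - l - 1))"
      if "l < ?n" for l
    proof -
      have "\<beta> ^ (?n - l - 1) * \<beta> ^ (l + 1) = \<beta> ^ ?n"
        unfolding power_add[symmetric] using that by (intro arg_cong[of _ _ "(^) \<beta>"]) simp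
      then have "\<beta> ^ ?n / \<beta> ^ (l + 1) = \<beta> ^ (?n - l - 1)"
        using \<beta>_gt_1 by (simp add: divide_eq_eq)
      then have "\<theta> d * \<beta> ^ ?n * (digit ?u l / \<beta> ^ (l + 1)) = digit ?u l * (\<theta> d * \<beta> ^ (?n - l - 1))"
        by (metis (no_types, lifting) mult.assoc mult.commute times_divide_eq_right)
      then show ?thesis
        by (simp add: digit_def sum_distrib_right mult.assoc)
    qed
    then have V: "V = \<theta> d * \<beta> ^ ?n * stream_value ?u"
      unfolding stream_value_sconst[OF order_refl] partial_value_def V_def
      by (simp add: sum_distrib_left)
    have "\<bar>T - V\<bar> \<le> (\<Sum>l<?n. C * real CARD('a))"
      unfolding T_def V_def sum_subtractf[symmetric]
    proof (rule order.trans[OF sum_abs], rule sum_mono)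
      fix l
      have "\<bar>\<Sum>a | a < ?u !! l. real (acc_count (foldl \<tau> d (stake l ?u @ [a])) d (?n - l - 1)) -
          \<eta> (foldl \<tau> d (stake l ?u @ [a])) * \<theta> d * \<beta> ^ (?n - l - 1)\<bar> \<le> (\<Sum>a | a < ?u !! l. C)"
        by (intro order.trans[OF sum_abs] sum_mono C foldl_le order_refl)
      also have "\<dots> = real (card {a. a < ?u !! l}) * C"
        by simp
      also have "\<dots> \<le> real CARD('a) * C"
        using \<open>C \<ge> 0\<close> by (intro mult_right_mono of_nat_mono card_mono) auto
      finally show "\<bar>\<Sum>a | a < ?u !! l. real (acc_count (foldl \<tau> d (stake l ?u @ [a])) d (?n - l - 1)) -
          \<eta> (foldl \<tau> d (stake l ?u @ [a])) * \<theta> d * \<beta> ^ (?n - l - 1)\<bar> \<le> C * real CARD('a)"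
        by (simp add: mult.commute)
    qed
    then have "\<bar>T - V\<bar> / \<beta> ^ ?n \<le> (C * real CARD('a) * real ?n) / \<beta> ^ ?n"
      using \<beta>_gt_1 by (intro divide_right_mono) (simp_all add: mult.commute)
    moreover have "real (ans_val Lang w) = real (\<Sum>i<?n. acc_count d d i) + T"
      unfolding ans_val_Lang T_def by simp
    then have "real (ans_val Lang w) / \<beta> ^ ?n - (real (\<Sum>i<?n. acc_count d d i) / \<beta> ^ ?n +
        \<theta> d * stream_value ?u) = (T - V) / \<beta> ^ ?n"
      using \<beta>_gt_1 by (simp add: V add_divide_distrib diff_divide_distrib)
    ultimately show ?thesis
      using \<beta>_gt_1 by (simp add: abs_divide)
  qed
  then show ?thesis
    by (intro exI[of _ "C * real CARD('a)"]) blast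
qed

text \<open>After division by \<beta>^n the numerator tends to \<theta>_d/(\<beta> - 1) + \<theta>_d
  V and the denominator to \<beta> \<theta>_d/(\<beta> - 1). The affine normalization in
  \<open>omega_value\<close> turns the quotient back into V.\<close>

lemma ans_val_lim:
  assumes "word_limit w u"
  shows "(\<lambda>k. real (ans_val Lang (w k)) / real (count_upto Lang (length (w k))))
    \<longlonglongrightarrow> (1 + (\<beta> - 1) * stream_value u) / \<beta>"
proof -
  note len = word_limit_length[OF assms]
  obtain C where C: "\<And>w. \<bar>real (ans_val Lang w) / \<beta> ^ length w -
      (real (\<Sum>i<length w. acc_count d d i) / \<beta> ^ length w + \<theta> d * stream_value (w @- sconst a0))\<bar>
    \<le> (C * real (length w)) / \<beta> ^ length w"
    using ans_val_approx by blast
  let ?E = "\<lambda>w. real (\<Sum>i<length w. acc_count d d i) / \<beta> ^ length w + \<theta> d * stream_value (w @- sconst a0)"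
  have "(\<lambda>k. real (ans_val Lang (w k)) / \<beta> ^ length (w k) - ?E (w k)) \<longlonglongrightarrow> 0"
    by (rule Lim_null_comparison[OF always_eventually filterlim_compose[OF linear_over_power[of C] len]])
      (use C in auto)
  moreover have "(\<lambda>k. ?E (w k)) \<longlonglongrightarrow> \<theta> d / (\<beta> - 1) + \<theta> d * stream_value u"
    by (intro tendsto_add tendsto_mult_left filterlim_compose[OF sum_count_lim len]
        stream_value_word_limit[OF assms])
  ultimately have "(\<lambda>k. (real (ans_val Lang (w k)) / \<beta> ^ length (w k) - ?E (w k)) + ?E (w k))
      \<longlonglongrightarrow> 0 + (\<theta> d / (\<beta> - 1) + \<theta> d * stream_value u)"
    by (rule tendsto_add)
  then have num: "(\<lambda>k. real (ans_val Lang (w k)) / \<beta> ^ length (w k))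
      \<longlonglongrightarrow> \<theta> d / (\<beta> - 1) + \<theta> d * stream_value u"
    by simp
  have den: "(\<lambda>k. real (count_upto Lang (length (w k))) / \<beta> ^ length (w k)) \<longlonglongrightarrow> \<beta> * \<theta> d / (\<beta> - 1)"
    by (rule filterlim_compose[OF count_upto_lim len])
  have "(\<lambda>k. (real (ans_val Lang (w k)) / \<beta> ^ length (w k)) /
        (real (count_upto Lang (length (w k))) / \<beta> ^ length (w k)))
      \<longlonglongrightarrow> (\<theta> d / (\<beta> - 1) + \<theta> d * stream_value u) / (\<beta> * \<theta> d / (\<beta> - 1))"
    using \<theta>_d_pos \<beta>_gt_1 by (intro tendsto_divide num den) auto
  moreover have "(\<theta> d / (\<beta> - 1) + \<theta> d * stream_value u) / (\<beta> * \<theta> d / (\<beta> - 1)) =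
      (1 + (\<beta> - 1) * stream_value u) / \<beta>"
    using \<theta>_d_pos \<beta>_gt_1 by (simp add: field_simps)
  ultimately show ?thesis
    using \<beta>_gt_1 by simp
qed

lemma omega_value_eq:
  assumes "u \<in> omega_language Lang"
  shows "omega_value Lang u = stream_value u"
proof -
  obtain w where w: "\<And>k. w k \<in> Lang" "word_limit w u"
    using assms by (auto simp: omega_language_def)
  have "omega_val Lang u = (1 + (\<beta> - 1) * stream_value u) / \<beta>"
    unfolding omega_val_def
  proof (rule the_equality)
    show "\<forall>w. (\<forall>k. w k \<in> Lang) \<and> word_limit w u \<longrightarrow>
        (\<lambda>k. real (ans_val Lang (w k)) / real (count_upto Lang (length (w k))))
          \<longlonglongrightarrow> (1 + (\<beta> - 1) * stream_value u) / \<beta>"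
      using ans_val_lim by blast
  next
    fix x
    assume "\<forall>w. (\<forall>k. w k \<in> Lang) \<and> word_limit w u \<longrightarrow>
        (\<lambda>k. real (ans_val Lang (w k)) / real (count_upto Lang (length (w k)))) \<longlonglongrightarrow> x"
    then show "x = (1 + (\<beta> - 1) * stream_value u) / \<beta>"
      using w ans_val_lim[OF w(2)] LIMSEQ_unique by blast
  qed
  then show ?thesis
    using \<beta>_gt_1 by (simp add: omega_value_def growth_base_Lang)
qed

text \<open>The least continuation of a word of \<open>Lang\<close> appends the minimal letter
  forever, which stays in the language because \<open>a0\<close> keeps positive states
  positive.\<close>

lemma word_value_eq:
  assumes "w \<in> Lang"
  shows "word_value Lang w = stream_value (w @- sconst a0)"
proof -
  have least: "u = w @- sconst a0 \<or> stream_lex_less (w @- sconst a0) u"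
    if "stake (length w) u = w" for u
  proof (rule disjCI)
    assume "\<not> stream_lex_less (w @- sconst a0) u"
    moreover have "\<not> stream_lex_less u (w @- sconst a0)"
    proof
      assume "stream_lex_less u (w @- sconst a0)"
      then obtain n where n: "u !! n < (w @- sconst a0) !! n"
        by (auto simp: stream_lex_less_def)
      show False
      proof (cases "n < length w")
        case True
        then have "stake (length w) u ! n = u !! n"
          by simp
        with n True that show False
          by (simp add: shift_nth)
      next
        case False
        then have "(w @- sconst a0) !! n = a0"
          by (simp add: shift_snth_ge)
        with n a0_min[of "u !! n"] show False
          by simp
      qed
    qed
    ultimately show "u = w @- sconst a0"
      using stream_lex_less_linear by metis
  qed
  have asym: "\<not> stream_lex_less v u" if uv: "stream_lex_less u v" for u v :: "'a stream"
  proof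
    assume "stream_lex_less v u"
    then obtain n where n: "stake n v = stake n u" "v !! n < u !! n"
      by (auto simp: stream_lex_less_def)
    obtain m where m: "stake m u = stake m v" "u !! m < v !! m"
      using uv by (auto simp: stream_lex_less_def)
    show False
      using n m stake_eqD[OF n(1), of m] stake_eqD[OF m(1), of n]
      by (cases n m rule: linorder_cases) auto
  qed
  have "least_extension Lang w = w @- sconst a0"
    unfolding least_extension_def
  proof (rule the_equality)
    show "w @- sconst a0 \<in> omega_language Lang \<and> stake (length w) (w @- sconst a0) = w \<and>
        (\<forall>v\<in>omega_language Lang. stake (length w) v = w \<longrightarrow>
          w @- sconst a0 = v \<or> stream_lex_less (w @- sconst a0) v)"
      using sconst_in_omega[OF assms] least by (auto simp: stake_shift_eq)
  next
    fix u
    assume u: "u \<in> omega_language Lang \<and> stake (length w) u = w \<and>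
        (\<forall>v\<in>omega_language Lang. stake (length w) v = w \<longrightarrow> u = v \<or> stream_lex_less u v)"
    then have "u = w @- sconst a0 \<or> stream_lex_less u (w @- sconst a0)"
      using sconst_in_omega[OF assms] by (auto simp: stake_shift_eq)
    with least[of u] u asym show "u = w @- sconst a0"
      by blast
  qed
  then show ?thesis
    by (simp add: word_value_def omega_value_eq[OF sconst_in_omega[OF assms]])
qed

end

section \<open>The discrepancy as a sum over suffixes\<close>

lemma shortlex_less_trans: "shortlex_less u v \<Longrightarrow> shortlex_less v w \<Longrightarrow> shortlex_less u w"
  using lenlex_transI[of "{(a, b). a < (b :: 'a)}"] unfolding shortlex_less_def trans_def by force

lemma shortlex_less_irrefl: "\<not> shortlex_less w w"
  by (simp add: shortlex_less_iff)

lemma shortlex_less_linear: "v \<noteq> w \<Longrightarrow> shortlex_less v w \<or> shortlex_less w v"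
proof -
  have "total (lenlex {(a, b). a < (b :: 'a)})"
    by (rule total_lenlex) (auto simp: total_on_def)
  then show "v \<noteq> w \<Longrightarrow> shortlex_less v w \<or> shortlex_less w v"
    unfolding shortlex_less_def total_on_def by blast
qed

lemma finite_shortlex_less: "finite {v \<in> X. shortlex_less v (w :: 'a::{finite,linorder} list)}"
proof (rule finite_subset)
  show "{v \<in> X. shortlex_less v w} \<subseteq> {v. set v \<subseteq> UNIV \<and> length v \<le> length w}"
    by (auto simp: shortlex_less_iff)
qed (rule finite_lists_length_le[OF finite])

lemma ans_val_less_iff:
  fixes v w :: "'a::{finite,linorder} list"
  assumes "v \<in> X" "w \<in> X"
  shows "ans_val X v < ans_val X w \<longleftrightarrow> shortlex_less v w"
proof -
  have mono: "ans_val X v < ans_val X w" if "v \<in> X" "shortlex_less v w" for v w :: "'a list"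
    unfolding ans_val_def
  proof (rule psubset_card_mono[OF finite_shortlex_less])
    show "{x \<in> X. shortlex_less x v} \<subset> {x \<in> X. shortlex_less x w}"
      using that shortlex_less_trans shortlex_less_irrefl by blast
  qed
  show ?thesis
    using mono[of v w] mono[of w v] shortlex_less_linear[of v w] assms by (cases "v = w") auto
qed

text \<open>The words below w have pairwise different values less than that of w, and their number
  is exactly this value, so they exhaust an initial segment. As X is infinite, these segments cover
  all numbers.\<close>

lemma bij_ans_val:
  fixes X :: "'a::{finite,linorder} list set"
  assumes "infinite X"
  shows "bij_betw (ans_val X) X UNIV"
proof -
  have inj: "inj_on (ans_val X) X"
  proof (rule inj_onI, rule ccontr)
    fix v w assume "v \<in> X" "w \<in> X" "ans_val X v = ans_val X w" "v \<noteq> w"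
    then show False
      using ans_val_less_iff[of v X w] ans_val_less_iff[of w X v] shortlex_less_linear[of v w] by simp
  qed
  have "n \<in> ans_val X ` X" for n
  proof -
    have "infinite (ans_val X ` X)"
      using assms inj finite_imageD by blast
    then obtain w where w: "w \<in> X" "n < ans_val X w"
      by (metis image_iff infinite_nat_iff_unbounded)
    let ?I = "{v \<in> X. shortlex_less v w}"
    have "ans_val X ` ?I \<subseteq> {..<ans_val X w}"
      using ans_val_less_iff[OF _ w(1)] by auto
    moreover have "card (ans_val X ` ?I) = card {..<ans_val X w}"
      using inj by (subst card_image) (auto simp: ans_val_def intro: inj_on_subset)
    ultimately have "ans_val X ` ?I = {..<ans_val X w}"
      by (intro card_subset_eq) auto
    then show ?thesis
      using w(2) by auto
  qed
  with inj show ?thesis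
    by (auto simp: bij_betw_def)
qed

lemma ans_rep_ans_val:
  fixes X :: "'a::{finite,linorder} list set"
  assumes "infinite X" "w \<in> X"
  shows "ans_rep X (ans_val X w) = w"
  unfolding ans_rep_def using assms bij_ans_val[OF assms(1)]
  by (intro the_equality) (auto simp: bij_betw_def inj_on_def)

lemma ans_val_surj:
  fixes X :: "'a::{finite,linorder} list set"
  assumes "infinite X"
  shows "\<exists>w\<in>X. ans_val X w = n"
  using bij_ans_val[OF assms] by (metis UNIV_I bij_betw_imp_surj_on image_iff)

lemma card_ans_rep_less:
  fixes X :: "'a::{finite,linorder} list set"
  assumes "infinite X" "w \<in> X"
  shows "card {n. n < ans_val X w \<and> Q (ans_rep X n)} = card {v \<in> X. shortlex_less v w \<and> Q v}"
proof -
  have "{n. n < ans_val X w \<and> Q (ans_rep X n)} = ans_val X ` {v \<in> X. shortlex_less v w \<and> Q v}"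
    using ans_val_surj[OF assms(1)] ans_val_less_iff[OF _ assms(2)] ans_rep_ans_val[OF assms(1)]
    by (auto simp: image_iff) metis
  moreover have "inj_on (ans_val X) {v \<in> X. shortlex_less v w \<and> Q v}"
    using bij_ans_val[OF assms(1)] by (auto simp: bij_betw_def intro: inj_on_subset)
  ultimately show ?thesis
    by (simp add: card_image)
qed

section \<open>Odometer order and counting along a word\<close>

definition lex_less :: "'a::linorder list \<Rightarrow> 'a list \<Rightarrow> bool" where
  "lex_less v w \<longleftrightarrow> (\<exists>l<length w. take l v = take l w \<and> v ! l < w ! l)"

lemma lex_less_Nil [simp]: "\<not> lex_less v []"
  by (simp add: lex_less_def)

lemma lex_less_Cons [simp]: "lex_less (b # v) (c # w) \<longleftrightarrow> b < c \<or> b = c \<and> lex_less v w"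
  unfolding lex_less_def by (auto simp: Ex_less_Suc2)

text \<open>Without leading letters \<open>a0\<close>, padding on the left turns shortlex into
  lexicographic order: the first letter of the longer word exceeds \<open>a0\<close>, as the first
  digit of a longer numeral exceeds 0.\<close>

lemma lex_less_padding:
  assumes min: "\<And>a. a0 \<le> a"
    and x: "x = [] \<or> hd x \<noteq> a0" and y: "y = [] \<or> hd y \<noteq> a0"
  shows "shortlex_less x y \<longleftrightarrow> length x \<le> length y \<and> lex_less (replicate (length y - length x) a0 @ x) y"
proof (cases "length x" "length y" rule: linorder_cases)
  case less
  then obtain c y' where "y = c # y'"
    by (cases y) auto
  moreover obtain m where "length y - length x = Suc m"
    using less by (metis Suc_diff_Suc)
  moreover have "a0 < c"
    using y min[of c] \<open>y = c # y'\<close> by auto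
  ultimately show ?thesis
    using less by (simp add: shortlex_less_iff)
qed (auto simp: shortlex_less_iff lex_less_def)

text \<open>The list is a reversed word, its most significant letter first, and \<open>s\<close> is
  the suffix fixed so far. Wherever a smaller letter \<open>b\<close> is taken, the remaining
  \<open>length xs\<close> letters become free and contribute
  \<open>f (length xs) (b # s)\<close>.\<close>

fun walk :: "(nat \<Rightarrow> 'a::linorder list \<Rightarrow> real) \<Rightarrow> 'a list \<Rightarrow> 'a list \<Rightarrow> real" where
  "walk f [] s = 0"
| "walk f (c # xs) s = (\<Sum>b | b < c. f (length xs) (b # s)) + walk f xs (c # s)"

lemma walk_diff: "walk (\<lambda>j s. f j s - x * g j s) xs s = walk f xs s - x * walk g xs s"
  by (induction xs arbitrary: s) (simp_all add: sum_subtractf sum_distrib_left algebra_simps)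

lemma walk_count:
  fixes xs :: "'a::{finite,linorder} list"
  shows "real (card {v. length v = length xs \<and> R (v @ s) \<and> lex_less (rev v) xs}) =
    walk (\<lambda>j t. real (card {v. length v = j \<and> R (v @ t)})) xs s"
proof (induction xs arbitrary: s)
  case (Cons c xs)
  let ?A = "\<lambda>b. {v. length v = length xs \<and> R (v @ b # s)}"
  let ?B = "{v. length v = length xs \<and> R (v @ c # s) \<and> lex_less (rev v) xs}"
  have fin: "finite (?A b)" "finite ?B" for b
    by (auto intro: finite_subset[OF _ finite_lists_eq[of "length xs"]])
  have "{v. length v = length (c # xs) \<and> R (v @ s) \<and> lex_less (rev v) (c # xs)} =
      (\<Union>b\<in>{b. b < c}. (\<lambda>v. v @ [b]) ` ?A b) \<union> (\<lambda>v. v @ [c]) ` ?B" (is "?L = ?U \<union> ?C")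
  proof (intro equalityI subsetI)
    fix v assume v: "v \<in> ?L"
    then obtain v' b where "v = v' @ [b]"
      by (cases v rule: rev_cases) auto
    with v show "v \<in> ?U \<union> ?C"
      by auto
  qed auto
  moreover have "finite ?U" "finite ?C" "?U \<inter> ?C = {}"
    using fin by auto
  moreover have "card ?U = (\<Sum>b | b < c. card ((\<lambda>v. v @ [b]) ` ?A b))"
    by (rule card_UN_disjoint) (use fin in auto)
  moreover have "card ((\<lambda>v. v @ [b]) ` Y) = card Y" for b and Y :: "'a list set"
    by (rule card_image) (simp add: inj_on_def)
  ultimately show ?case
    using Cons.IH[of "c # s"] by (simp add: card_Un_disjoint)
qed simp

lemma walk_append: "walk f (xs @ ys) s = walk (\<lambda>j. f (j + length ys)) xs s + walk f ys (rev xs @ s)"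
  by (induction xs arbitrary: s) (simp_all add: add.commute add.left_commute)

lemma walk_min:
  assumes "\<And>a. a0 \<le> a"
  shows "walk f (replicate m a0) s = 0"
proof -
  have "{b. b < a0} = {}"
    using assms by (auto simp: not_less)
  then show ?thesis
    by (induction m arbitrary: s) simp_all
qed

context ordered_automaton
begin

text \<open>A word and its extension by \<open>a0\<close> have the same value, so the words not
  ending in \<open>a0\<close> are the representatives that survive in
  \<open>reduced_language\<close>.\<close>

definition min_words :: "'a list set" where
  "min_words = {w \<in> Lang. w = [] \<or> last w \<noteq> a0}"

lemma replicate_dropWhile: "\<exists>k. w = replicate k a0 @ dropWhile ((=) a0) w"
proof -
  have "takeWhile ((=) a0) w = replicate (length (takeWhile ((=) a0) w)) a0"
    by (rule replicate_length_same[symmetric]) (auto dest: set_takeWhileD)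
  then show ?thesis
    by (metis takeWhile_dropWhile_id)
qed

lemma min_words_padding:
  assumes "w \<in> Lang"
  shows "\<exists>w0\<in>min_words. \<exists>k. w = w0 @ replicate k a0"
proof -
  obtain k where "rev w = replicate k a0 @ dropWhile ((=) a0) (rev w)"
    using replicate_dropWhile by blast
  then have w: "w = rev (dropWhile ((=) a0) (rev w)) @ replicate k a0" (is "_ = ?w0 @ _")
    by (metis rev_append rev_replicate rev_rev_ident)
  have "?w0 = [] \<or> last ?w0 \<noteq> a0"
    using hd_dropWhile[of "(=) a0" "rev w"] by (auto simp: last_rev simp del: dropWhile_eq_Nil_conv)
  moreover have "?w0 \<in> Lang"
    using assms append_a0_in_Lang w by metis
  ultimately show ?thesis
    using w unfolding min_words_def by blast
qed

text \<open>Padding with \<open>a0\<close> up to the length of \<open>w\<close> is a bijection onto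
  the words of that fixed length, where the condition becomes lexicographic. Counting can then be
  done letter by letter.\<close>

lemma card_min_words_less:
  assumes w: "w \<in> min_words"
    and R: "\<And>v k. R (v @ replicate k a0) \<longleftrightarrow> R v"
  shows "card {v \<in> min_words. shortlex_less (rev v) (rev w) \<and> R v} =
    card {v. length v = length w \<and> (v \<in> Lang \<and> R v) \<and> lex_less (rev v) (rev w)}"
    (is "card ?A = card ?B")
proof -
  let ?f = "\<lambda>v. v @ replicate (length w - length v) a0"
  let ?g = "\<lambda>v. rev (dropWhile ((=) a0) (rev v))"
  have hd: "rev v = [] \<or> hd (rev v) \<noteq> a0" if "v \<in> min_words" for v
    using that by (auto simp: min_words_def hd_rev)
  have less: "shortlex_less (rev v) (rev w) \<longleftrightarrow>
      length v \<le> length w \<and> lex_less (rev (?f v)) (rev w)" if "v \<in> min_words" for v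
    using lex_less_padding[OF a0_min hd[OF that] hd[OF w]] by simp
  have gf: "?g (?f v) = v" if "v \<in> min_words" for v
  proof -
    have "dropWhile ((=) a0) (replicate k a0 @ rev v) = rev v" for k
      using hd[OF that] by (induction k) (auto simp: dropWhile_eq_self_iff)
    then show ?thesis
      by simp
  qed
  have fg: "?f (?g v) = v \<and> ?g v \<in> min_words \<and> length (?g v) \<le> length w \<and> (R (?g v) \<longleftrightarrow> R v)"
    if v: "v \<in> Lang" "length v = length w" for v
  proof -
    obtain v0 k where v0: "v0 \<in> min_words" "v = v0 @ replicate k a0"
      using min_words_padding[OF v(1)] by blast
    have "k = length w - length v0"
      using v v0 by auto
    then have "v = ?f v0"
      using v0 by simp
    then have "?g v = v0"
      using gf[OF v0(1)] by simp
    then show ?thesis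
      using v v0 R[of v0 k] by auto
  qed
  have "bij_betw ?f ?A ?B"
  proof (rule bij_betw_byWitness[where f' = ?g])
    show "\<forall>v\<in>?A. ?g (?f v) = v"
      using gf by blast
    show "\<forall>v\<in>?B. ?f (?g v) = v"
      using fg by blast
    show "?f ` ?A \<subseteq> ?B"
    proof (rule image_subsetI)
      fix v assume v: "v \<in> ?A"
      then have "v \<in> min_words" "length v \<le> length w" "lex_less (rev (?f v)) (rev w)" "R v"
        using less[of v] by auto
      moreover from this have "?f v \<in> Lang"
        by (simp add: append_a0_in_Lang min_words_def)
      ultimately show "?f v \<in> ?B"
        using R by simp
    qed
    show "?g ` ?B \<subseteq> ?A"
    proof (rule image_subsetI)
      fix v assume v: "v \<in> ?B"
      then have *: "?f (?g v) = v" "?g v \<in> min_words" "length (?g v) \<le> length w" "R (?g v)"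
        using fg[of v] by auto
      have "lex_less (rev (?f (?g v))) (rev w)"
        unfolding *(1) using v by simp
      with * less[of "?g v"] show "?g v \<in> ?A"
        by blast
    qed
  qed
  then show ?thesis
    by (rule bij_betw_same_card)
qed

end

context pisot_numeration
begin

lemma stream_value_eq_iff:
  assumes "v \<in> Lang" "w \<in> Lang"
  shows "stream_value (v @- sconst a0) = stream_value (w @- sconst a0) \<longleftrightarrow> v @- sconst a0 = w @- sconst a0"
proof
  assume "stream_value (v @- sconst a0) = stream_value (w @- sconst a0)"
  then have "\<not> stream_lex_less (v @- sconst a0) (w @- sconst a0)"
    "\<not> stream_lex_less (w @- sconst a0) (v @- sconst a0)"
    using stream_value_strict_mono[OF _ assms(1)] stream_value_strict_mono[OF _ assms(2)] less_irrefl
    by metis+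
  then show "v @- sconst a0 = w @- sconst a0"
    using stream_lex_less_linear by metis
qed simp

text \<open>Values of padded words are strictly monotone, so equal values mean equal padded streams,
  that is, words differing only by trailing letters \<open>a0\<close>; the shortest of them is
  kept.\<close>

lemma reduced_language_Lang: "reduced_language Lang = min_words"
proof (intro equalityI subsetI)
  fix w assume "w \<in> reduced_language Lang"
  then have w: "w \<in> Lang" "\<And>v. v \<in> Lang \<Longrightarrow> shortlex_less v w \<Longrightarrow> word_value Lang w \<noteq> word_value Lang v"
    by (auto simp: reduced_language_def)
  show "w \<in> min_words"
  proof (rule ccontr)
    assume "w \<notin> min_words"
    then obtain v where v: "w = v @ [a0]"
      using w(1) by (cases w rule: rev_cases) (auto simp: min_words_def)
    then have "v \<in> Lang"
      using w(1) Lang_appendD1 by blast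
    have "a0 ## sconst a0 = sconst a0"
      by (rule stream.expand) simp
    then have "word_value Lang w = word_value Lang v"
      unfolding word_value_eq[OF w(1)] word_value_eq[OF \<open>v \<in> Lang\<close>] by (simp add: v)
    moreover have "shortlex_less v w"
      by (simp add: v shortlex_less_iff)
    ultimately show False
      using w(2) \<open>v \<in> Lang\<close> by blast
  qed
next
  fix w assume w: "w \<in> min_words"
  then have wL: "w \<in> Lang"
    by (simp add: min_words_def)
  have "word_value Lang w \<noteq> word_value Lang v" if v: "v \<in> Lang" "shortlex_less v w" for v
  proof
    assume "word_value Lang w = word_value Lang v"
    then have eq: "w @- sconst a0 = v @- sconst a0"
      using stream_value_eq_iff[OF wL v(1)] by (simp add: word_value_eq wL v)
    have len: "length v \<le> length w"
      using v(2) by (auto simp: shortlex_less_iff)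
    \<comment> \<open>Equality of the padded streams makes \<open>w\<close> the word
      \<open>v\<close> followed by letters \<open>a0\<close>; since \<open>w\<close> does not end in
      \<open>a0\<close>, no such letter is left.\<close>
    have "stake (length w) (w @- sconst a0) = stake (length w) (v @- sconst a0)"
      by (simp only: eq)
    then have "w = v @ replicate (length w - length v) a0"
      by (simp add: stake_shift_eq stake_shift_sconst[OF len])
    moreover from this have "length w - length v = 0"
      using w unfolding min_words_def
      by (cases "length w - length v") (auto simp: replicate_append_same[symmetric])
    ultimately show False
      using v(2) by (simp add: shortlex_less_irrefl)
  qed
  then show "w \<in> reduced_language Lang"
    using wL by (simp add: reduced_language_def)
qed

text \<open>If \<open>a0\<close> were the only letter in the language, the eigenvector equation at
  \<open>d\<close> would give \<beta> = 1.\<close>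

lemma second_letter: "\<exists>c. c \<noteq> a0 \<and> [c] \<in> Lang"
proof (rule ccontr)
  assume *: "\<not> ?thesis"
  have "\<beta> = (\<Sum>a\<in>UNIV. \<eta> (\<tau> d a))"
    using \<eta>_eigen[of d] by (simp add: \<eta>_d)
  also have "\<dots> = (\<Sum>a\<in>{a0}. \<eta> (\<tau> d a))"
    using * by (intro sum.mono_neutral_right) (auto simp: in_Lang \<eta>_0)
  also have "\<dots> = 1"
    by (simp add: \<tau>_d_a0 \<eta>_d)
  finally show False
    using \<beta>_gt_1 by simp
qed

lemma infinite_min_words: "infinite (rev ` min_words)"
proof -
  obtain c where c: "c \<noteq> a0" "[c] \<in> Lang"
    using second_letter by blast
  have "range (\<lambda>k. rev (replicate k a0 @ [c])) \<subseteq> rev ` min_words"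
    using c a0_append_in_Lang by (auto simp: min_words_def simp del: rev_append rev_replicate)
  moreover have "inj (\<lambda>k. rev (replicate k a0 @ [c]))"
    by (rule inj_on_inverseI[where g = "\<lambda>w. length w - 1"]) simp
  ultimately show ?thesis
    using range_inj_infinite infinite_super by blast
qed

text \<open>The quantity \<open>f(j, s)\<close> of the overview: the discrepancy contributed by the
  words with \<open>j\<close> free letters and suffix \<open>s\<close>.\<close>

definition seg_excess :: "'a stream \<Rightarrow> nat \<Rightarrow> 'a list \<Rightarrow> real" where
  "seg_excess u j s =
    real (card {v. length v = j \<and> v @ s \<in> Lang \<and> stream_lex_less ((v @ s) @- sconst a0) u}) -
    stream_value u * real (card {v. length v = j \<and> v @ s \<in> Lang})"

text \<open>Numbers below N correspond to the reversed minimal words below \<open>rev w\<close>. The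
  order-theoretic form of membership in the interval makes both the hits and N itself walks along
  \<open>rev w\<close>, and walks are linear in \<open>f\<close>.\<close>

lemma discrepancy_eq_walk:
  assumes u: "u \<in> omega_language Lang" and w: "w \<in> min_words"
  shows "discrepancy (van_der_corput Lang) (ans_val (rev ` min_words) (rev w))
    {0..<omega_value Lang u} = walk (seg_excess u) (rev w) []"
proof -
  let ?X = "rev ` min_words" and ?N = "ans_val (rev ` min_words) (rev w)"
  let ?R = "\<lambda>v. stream_lex_less (v @- sconst a0) u"
  have X: "infinite ?X" "rev w \<in> ?X"
    using infinite_min_words w by auto
  have rep: "rev (ans_rep ?X n) \<in> min_words" for n
    using ans_val_surj[OF X(1), of n] ans_rep_ans_val[OF X(1)] by auto
  have "van_der_corput Lang n \<in> {0..<omega_value Lang u} \<longleftrightarrow> ?R (rev (ans_rep ?X n))" for n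
  proof -
    have L: "rev (ans_rep ?X n) \<in> Lang"
      using rep[of n] by (simp add: min_words_def)
    show ?thesis
      unfolding van_der_corput_def reduced_language_Lang
      by (simp add: word_value_eq[OF L] omega_value_eq[OF u] stream_value_nonneg stream_value_less_iff[OF L])
  qed
  then have "card {n. n < ?N \<and> van_der_corput Lang n \<in> {0..<omega_value Lang u}} =
      card {x \<in> ?X. shortlex_less x (rev w) \<and> ?R (rev x)}"
    using card_ans_rep_less[OF X, of "\<lambda>x. ?R (rev x)"] by simp
  also have "{x \<in> ?X. shortlex_less x (rev w) \<and> ?R (rev x)} =
      rev ` {v \<in> min_words. shortlex_less (rev v) (rev w) \<and> ?R v}"
    by auto
  also have "card \<dots> = card {v \<in> min_words. shortlex_less (rev v) (rev w) \<and> ?R v}"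
    by (rule card_image) (simp add: inj_on_def)
  also have "\<dots> = card {v. length v = length w \<and> (v \<in> Lang \<and> ?R v) \<and> lex_less (rev v) (rev w)}"
    by (rule card_min_words_less[OF w]) simp
  finally have below: "real (card {n. n < ?N \<and> van_der_corput Lang n \<in> {0..<omega_value Lang u}}) =
      walk (\<lambda>j t. real (card {v. length v = j \<and> v @ t \<in> Lang \<and> ?R (v @ t)})) (rev w) []"
    using walk_count[of "rev w" "\<lambda>v. v \<in> Lang \<and> ?R v" "[]"] by simp
  have "?N = card {x \<in> ?X. shortlex_less x (rev w)}"
    by (simp add: ans_val_def)
  also have "{x \<in> ?X. shortlex_less x (rev w)} =
      rev ` {v \<in> min_words. shortlex_less (rev v) (rev w) \<and> True}"
    by auto
  also have "card \<dots> = card {v \<in> min_words. shortlex_less (rev v) (rev w) \<and> True}"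
    by (rule card_image) (simp add: inj_on_def)
  also have "\<dots> = card {v. length v = length w \<and> (v \<in> Lang \<and> True) \<and> lex_less (rev v) (rev w)}"
    by (rule card_min_words_less[OF w]) simp
  finally have N: "real ?N = walk (\<lambda>j t. real (card {v. length v = j \<and> v @ t \<in> Lang})) (rev w) []"
    using walk_count[of "rev w" "\<lambda>v. v \<in> Lang" "[]"] by simp
  have "discrepancy (van_der_corput Lang) ?N {0..<omega_value Lang u} =
      real (card {n. n < ?N \<and> van_der_corput Lang n \<in> {0..<omega_value Lang u}}) -
      stream_value u * real ?N"
    by (simp add: discrepancy_def omega_value_eq[OF u] stream_value_nonneg)
  also have "\<dots> = walk (seg_excess u) (rev w) []"
    unfolding below N walk_diff[symmetric] seg_excess_def[abs_def] ..
  finally show ?thesis .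
qed

lemma seg_excess_append_a0: "seg_excess u j (s @ replicate m a0) = seg_excess u j s"
proof -
  have "v @ s @ replicate m a0 \<in> Lang \<longleftrightarrow> v @ s \<in> Lang" for v
    using append_a0_in_Lang[of "v @ s" m] by simp
  then show ?thesis
    by (simp add: seg_excess_def)
qed

lemma walk_seg_excess_append_a0:
  "walk (seg_excess u) (rev (w @ replicate m a0)) [] = walk (seg_excess u) (rev w) []"
proof -
  have "walk (seg_excess u) xs (s @ replicate m a0) = walk (seg_excess u) xs s" for xs s
    by (induction xs arbitrary: s) (simp_all add: seg_excess_append_a0 flip: append_Cons)
  from this[of "rev w" "[]"] show ?thesis
    by (simp add: walk_append walk_min[OF a0_min])
qed

text \<open>Every N is the number of a minimal word, and every word of \<open>Lang\<close> is a
  minimal word padded with \<open>a0\<close>, which leaves the walk unchanged. Ranging over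
  \<open>Lang\<close> permits free concatenation of blocks.\<close>

lemma bounded_discrepancy_iff:
  assumes "u \<in> omega_language Lang"
  shows "bounded (range (\<lambda>N. discrepancy (van_der_corput Lang) N {0..<omega_value Lang u})) \<longleftrightarrow>
    (\<exists>C. \<forall>w\<in>Lang. \<bar>walk (seg_excess u) (rev w) []\<bar> \<le> C)"
proof
  assume "bounded (range (\<lambda>N. discrepancy (van_der_corput Lang) N {0..<omega_value Lang u}))"
  then obtain C where C: "\<And>N. \<bar>discrepancy (van_der_corput Lang) N {0..<omega_value Lang u}\<bar> \<le> C"
    by (auto simp: bounded_iff)
  have "\<bar>walk (seg_excess u) (rev w) []\<bar> \<le> C" if "w \<in> Lang" for w
  proof -
    obtain w0 k where w0: "w0 \<in> min_words" "w = w0 @ replicate k a0"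
      using min_words_padding \<open>w \<in> Lang\<close> by blast
    show ?thesis
      using C discrepancy_eq_walk[OF assms w0(1)] unfolding w0(2) walk_seg_excess_append_a0
      by metis
  qed
  then show "\<exists>C. \<forall>w\<in>Lang. \<bar>walk (seg_excess u) (rev w) []\<bar> \<le> C"
    by blast
next
  assume "\<exists>C. \<forall>w\<in>Lang. \<bar>walk (seg_excess u) (rev w) []\<bar> \<le> C"
  then obtain C where C: "\<And>w. w \<in> Lang \<Longrightarrow> \<bar>walk (seg_excess u) (rev w) []\<bar> \<le> C"
    by blast
  have "\<bar>discrepancy (van_der_corput Lang) N {0..<omega_value Lang u}\<bar> \<le> C" for N
  proof -
    obtain w where w: "w \<in> min_words" "ans_val (rev ` min_words) (rev w) = N"
      using ans_val_surj[OF infinite_min_words, of N] by blast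
    then have "w \<in> Lang"
      by (simp add: min_words_def)
    then show ?thesis
      using C discrepancy_eq_walk[OF assms w(1)] w(2) by simp
  qed
  then show "bounded (range (\<lambda>N. discrepancy (van_der_corput Lang) N {0..<omega_value Lang u}))"
    by (auto simp: bounded_iff)
qed

end

section \<open>Independence of distant blocks\<close>

lemma stream_lex_less_Cons: "stream_lex_less (a ## x) (b ## y) \<longleftrightarrow> a < b \<or> a = b \<and> stream_lex_less x y"
proof
  assume "stream_lex_less (a ## x) (b ## y)"
  then obtain n where "stake n (a ## x) = stake n (b ## y)" "(a ## x) !! n < (b ## y) !! n"
    by (auto simp: stream_lex_less_def)
  then show "a < b \<or> a = b \<and> stream_lex_less x y"
    by (cases n) (auto simp: stream_lex_less_def)
next
  assume "a < b \<or> a = b \<and> stream_lex_less x y"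
  then show "stream_lex_less (a ## x) (b ## y)"
  proof (elim disjE conjE)
    assume "a < b"
    then show ?thesis
      unfolding stream_lex_less_def by (intro exI[of _ 0]) simp
  next
    assume "a = b" "stream_lex_less x y"
    then obtain n where "stake n x = stake n y" "x !! n < y !! n"
      by (auto simp: stream_lex_less_def)
    with \<open>a = b\<close> show ?thesis
      unfolding stream_lex_less_def by (intro exI[of _ "Suc n"]) simp
  qed
qed

lemma stream_lex_less_shift:
  "stream_lex_less (v @- x) u \<longleftrightarrow>
    (\<exists>l<length v. take l v = stake l u \<and> v ! l < u !! l) \<or>
    v = stake (length v) u \<and> stream_lex_less x (sdrop (length v) u)"
proof (induction v arbitrary: u)
  case (Cons a v)
  have "stream_lex_less ((a # v) @- x) u \<longleftrightarrow> stream_lex_less (a ## (v @- x)) (shd u ## stl u)"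
    by simp
  also have "\<dots> \<longleftrightarrow> a < shd u \<or> a = shd u \<and> stream_lex_less (v @- x) (stl u)"
    by (rule stream_lex_less_Cons)
  finally show ?case
    by (auto simp: Cons.IH Ex_less_Suc2)
qed simp

lemma stream_lex_less_first_diff:
  assumes "stake n x = stake n u" "x !! n \<noteq> u !! n"
  shows "stream_lex_less x u \<longleftrightarrow> x !! n < u !! n"
proof
  assume "stream_lex_less x u"
  then obtain m where m: "stake m x = stake m u" "x !! m < u !! m"
    by (auto simp: stream_lex_less_def)
  then show "x !! n < u !! n"
    using assms stake_eqD[OF m(1), of n] stake_eqD[OF assms(1), of m]
    by (cases n m rule: linorder_cases) auto
qed (use assms in \<open>auto simp: stream_lex_less_def\<close>)

lemma card_lists_Suc:
  "card {v :: 'a::finite list. length v = Suc j \<and> R (v @ s)} =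
    (\<Sum>b\<in>UNIV. card {v. length v = j \<and> R (v @ b # s)})"
proof -
  let ?A = "\<lambda>b. {v. length v = j \<and> R (v @ b # s)}"
  have fin: "finite (?A b)" for b
    by (rule finite_subset[OF _ finite_lists_eq[of j]]) auto
  have "{v. length v = Suc j \<and> R (v @ s)} = (\<Union>b\<in>UNIV. (\<lambda>v. v @ [b]) ` ?A b)" (is "?L = ?U")
  proof (intro equalityI subsetI)
    fix v assume v: "v \<in> ?L"
    then obtain v' b where "v = v' @ [b]"
      by (cases v rule: rev_cases) auto
    with v show "v \<in> ?U"
      by auto
  qed auto
  also have "card ?U = (\<Sum>b\<in>UNIV. card ((\<lambda>v. v @ [b]) ` ?A b))"
    by (rule card_UN_disjoint) (use fin in auto)
  also have "\<dots> = (\<Sum>b\<in>UNIV. card (?A b))"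
    by (intro sum.cong refl card_image) (simp add: inj_on_def)
  finally show ?thesis .
qed

lemma walk_bound:
  fixes f :: "nat \<Rightarrow> 'a::{finite,linorder} list \<Rightarrow> real"
  assumes "\<And>j s. \<bar>f j s\<bar> \<le> B j"
  shows "\<bar>walk f xs s\<bar> \<le> real CARD('a) * (\<Sum>j<length xs. B j)"
proof (induction xs arbitrary: s)
  case (Cons c xs)
  have "0 \<le> B j" for j
    using assms[of j "[]"] by linarith
  then have "real (card {b. b < c}) * B (length xs) \<le> real CARD('a) * B (length xs)"
    by (intro mult_right_mono of_nat_mono card_mono) auto
  moreover have "\<bar>\<Sum>b | b < c. f (length xs) (b # s)\<bar> \<le> (\<Sum>b | b < c. B (length xs))"
    by (rule order.trans[OF sum_abs], rule sum_mono) (rule assms)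
  ultimately show ?case
    using Cons.IH[of "c # s"] by (simp add: distrib_left)
qed simp

lemma common_denominator:
  "finite I \<Longrightarrow> \<exists>N::nat. N > 0 \<and> (\<forall>i\<in>I. \<exists>z. of_nat N * (c i :: rat) = of_int z)"
proof (induction I rule: finite_induct)
  case (insert x I)
  then obtain N where N: "N > 0" "\<And>i. i \<in> I \<Longrightarrow> \<exists>z. of_nat N * c i = of_int z"
    by blast
  obtain m n where mn: "c x = Rat.Fract m n" "n > 0"
    by (cases "c x") auto
  have "of_nat (N * nat n) * c x = of_int (int N * m)"
    using mn by (simp add: Fract_of_int_quotient)
  moreover have "\<exists>z. of_nat (N * nat n) * c i = of_int z" if i: "i \<in> I" for i
  proof -
    obtain z where "of_nat N * c i = of_int z"
      using N(2)[OF i] by blast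
    then have "of_nat (N * nat n) * c i = of_int (z * n)"
      using mn(2) by (simp add: mult.commute mult.left_commute)
    then show ?thesis by blast
  qed
  ultimately have "\<forall>i\<in>insert x I. \<exists>z. of_nat (N * nat n) * c i = of_int z"
    by blast
  then show ?case
    using N(1) mn(2) by (intro exI[of _ "N * nat n"]) auto
qed (auto intro: exI[of _ 1])

lemma rpoly_pderiv:
  "rpoly (pderiv p) x = (\<Sum>i\<le>degree p. of_rat (coeff p i) * (of_nat i * x ^ (i - 1)))"
proof -
  have "pderiv p = (\<Sum>i\<le>degree p. pderiv (Polynomial.monom (coeff p i) i))"
    by (subst poly_as_sum_of_monoms[of p, symmetric]) (rule pderiv_sum)
  then show ?thesis
    by (simp add: rpoly_sum pderiv_monom rpoly_monom of_rat_mult mult.assoc mult.left_commute)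
qed

context ordered_automaton
begin

lemma card_append_in_Lang: "card {v. length v = j \<and> v @ s \<in> Lang} = acc_count d (mir s) j"
  by (simp add: acc_count_def append_in_Lang)

text \<open>The right-hand side of the criterion for k = j + 1, with streams indexed from 0.\<close>

definition meets :: "'a stream \<Rightarrow> nat \<Rightarrow> 'a list \<Rightarrow> bool" where
  "meets u j s \<longleftrightarrow> stream_lex_less (s @- sconst a0) (sdrop j u) \<and> stake j u @ s \<in> Lang"

text \<open>Either \<open>v\<close> drops below \<open>u\<close> within its own length, or
  \<open>v\<close> is the prefix of \<open>u\<close> and the suffix decides. The second case
  concerns a single word and yields the summand 0 or 1.\<close>

lemma card_append_below:
  "card {v. length v = j \<and> v @ s \<in> Lang \<and> stream_lex_less ((v @ s) @- sconst a0) u} =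
    (\<Sum>l<j. \<Sum>a | a < u !! l. acc_count (foldl \<tau> d (stake l u @ [a])) (mir s) (j - l - 1)) +
    of_bool (meets u j s)"
proof -
  let ?B = "{v. length v = j \<and> foldl \<tau> d v + mir s > d \<and> (\<exists>l<j. take l v = stake l u \<and> v ! l < u !! l)}"
  let ?C = "{v. v = stake j u \<and> meets u j s}"
  have "{v. length v = j \<and> v @ s \<in> Lang \<and> stream_lex_less ((v @ s) @- sconst a0) u} = ?B \<union> ?C"
    unfolding meets_def shift_append by (auto simp: stream_lex_less_shift append_in_Lang[symmetric])
  moreover have "finite ?B"
    by (rule finite_subset[OF _ finite_lists_eq[of j]]) auto
  moreover have "?B \<inter> ?C = {}"
  proof (intro equals0I)
    fix v assume "v \<in> ?B \<inter> ?C"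
    then obtain l where "v = stake j u" "l < j" "v ! l < u !! l"
      by blast
    then show False
      by simp
  qed
  moreover have "card ?C = of_bool (meets u j s)"
    by simp
  ultimately show ?thesis
    by (simp only: card_Un_disjoint count_below[OF order_refl] finite_Collect_conjI finite.intros)
      (simp add: card_Un_disjoint count_below)
qed

text \<open>The comparison is decided at the first position where \<open>x\<close> padded with
  \<open>a0\<close> differs from \<open>u\<close>; once the gap extends past it, what follows is
  invisible.\<close>

lemma eventually_below_gap:
  "\<forall>\<^sub>F m in sequentially. \<forall>s. stream_lex_less ((x @ replicate m a0 @ s) @- sconst a0) u \<longleftrightarrow>
    stream_lex_less (x @- sconst a0) u"
proof (cases "u = x @- sconst a0")
  \<comment> \<open>Here no such position exists, but both sides are false, because no stream is
    below the constant stream \<open>a0\<close>.\<close>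
  case True
  have "\<not> stream_lex_less v (sconst a0)" for v
    using a0_min by (auto simp: stream_lex_less_def dest: leD)
  then have "\<not> stream_lex_less ((x @ s) @- sconst a0) u" for s
    unfolding True shift_append stream_lex_less_shift
    by (auto simp: stake_shift_eq shift_nth sdrop_shift leD[OF a0_min])
  from this[of "replicate _ a0 @ _"] this[of "[]"] show ?thesis
    by simp
next
  case False
  then obtain n where n: "stake n (x @- sconst a0) = stake n u" "(x @- sconst a0) !! n \<noteq> u !! n"
    using stream_lex_less_linear[OF False] unfolding stream_lex_less_def by (metis less_irrefl)
  show ?thesis
    unfolding eventually_sequentially
  proof (intro exI[of _ "Suc n"] allI impI)
    fix m s assume m: "Suc n \<le> m"
    let ?z = "(x @ replicate m a0 @ s) @- sconst a0"
    have "?z = (x @ replicate m a0) @- s @- sconst a0"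
      by simp
    then have "stake (Suc n) ?z = take (Suc n) (x @ replicate m a0)"
      using m by (simp only: stake_shift_eq length_append length_replicate)
    moreover have "x @- sconst a0 = (x @ replicate m a0) @- sconst a0"
      by simp
    then have "stake (Suc n) (x @- sconst a0) = take (Suc n) (x @ replicate m a0)"
      using m by (simp only: stake_shift_eq length_append length_replicate)
    ultimately have eq: "stake (Suc n) ?z = stake (Suc n) (x @- sconst a0)"
      by simp
    have "stake n ?z = stake n u" "?z !! n = (x @- sconst a0) !! n"
      using stake_eq_mono[OF eq, of n] n(1) stake_eqD[OF eq, of n] by simp_all
    then show "stream_lex_less ?z u \<longleftrightarrow> stream_lex_less (x @- sconst a0) u"
      using stream_lex_less_first_diff[OF n] stream_lex_less_first_diff[of n ?z u] n(2) by simp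
  qed
qed

end

context pisot_numeration
begin

lemma seg_excess_not_Lang: "s \<notin> Lang \<Longrightarrow> seg_excess u j s = 0"
proof -
  assume "s \<notin> Lang"
  then have "v @ s \<notin> Lang" for v
    using Lang_appendD2 by blast
  then show ?thesis
    by (simp add: seg_excess_def)
qed

lemma seg_excess_Suc: "seg_excess u (Suc j) s = (\<Sum>b\<in>UNIV. seg_excess u j (b # s))"
  unfolding seg_excess_def
  using card_lists_Suc[of j "\<lambda>w. w \<in> Lang \<and> stream_lex_less (w @- sconst a0) u" s]
    card_lists_Suc[of j "\<lambda>w. w \<in> Lang" s]
  by (simp add: sum_subtractf sum_distrib_left)

text \<open>Only finitely many words of length \<open>l\<close> precede \<open>t\<close>, so one gap
  length serves them all; membership is insensitive to \<open>s\<close> as soon as the gap has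
  length \<open>d\<close>.\<close>

lemma eventually_seg_excess_gap:
  "\<forall>\<^sub>F m in sequentially. \<forall>s\<in>Lang. seg_excess u l (t @ replicate m a0 @ s) = seg_excess u l t"
proof -
  have "\<forall>\<^sub>F m in sequentially. \<forall>v\<in>{v. length v = l}. \<forall>s.
      stream_lex_less (((v @ t) @ replicate m a0 @ s) @- sconst a0) u \<longleftrightarrow>
      stream_lex_less ((v @ t) @- sconst a0) u"
    by (intro eventually_ball_finite finite_lists_eq ballI eventually_below_gap)
  with eventually_ge_at_top[of d] show ?thesis
  proof eventually_elim
    case (elim m)
    show ?case
    proof
      fix s assume s: "s \<in> Lang"
      have L: "v @ t @ replicate m a0 @ s \<in> Lang \<longleftrightarrow> v @ t \<in> Lang" for v
        using gap_in_Lang[OF elim(1) s, of "v @ t"] by simp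
      have "stream_lex_less ((v @ t @ replicate m a0 @ s) @- sconst a0) u \<longleftrightarrow>
          stream_lex_less ((v @ t) @- sconst a0) u" if "length v = l" for v
        using elim(2) that by (metis (mono_tags, lifting) append.assoc mem_Collect_eq)
      with L show "seg_excess u l (t @ replicate m a0 @ s) = seg_excess u l t"
        unfolding seg_excess_def by (simp cong: conj_cong)
    qed
  qed
qed

lemma eventually_walk_gap:
  "\<forall>\<^sub>F m in sequentially. \<forall>s\<in>Lang.
    walk (seg_excess u) xs (t @ replicate m a0 @ s) = walk (seg_excess u) xs t"
proof (induction xs arbitrary: t)
  case (Cons c xs)
  have "\<forall>\<^sub>F m in sequentially. \<forall>b\<in>UNIV. \<forall>s\<in>Lang.
      seg_excess u (length xs) ((b # t) @ replicate m a0 @ s) = seg_excess u (length xs) (b # t)"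
    by (intro eventually_ball_finite ballI eventually_seg_excess_gap) simp
  with Cons.IH[of "c # t"] show ?case
    by eventually_elim simp
qed simp

section \<open>Additivity over distant blocks and its consequences\<close>

definition excess :: "'a stream \<Rightarrow> 'a list \<Rightarrow> real" where
  "excess u w = walk (seg_excess u) (rev w) []"

lemma excess_append:
  "excess u (w @ s) = excess u (replicate (length w) a0 @ s) + walk (seg_excess u) (rev w) s"
  by (simp add: excess_def walk_append walk_min[OF a0_min])

text \<open>In the walk along \<open>w @ replicate m a0 @ s\<close> the letters of \<open>s\<close>
  come first and see only the positions below them as free, which gives the shifted excess of
  \<open>s\<close>; the letters of \<open>w\<close> do not notice \<open>s\<close> behind a long
  gap.\<close>

lemma eventually_excess_gap:
  "\<forall>\<^sub>F m in sequentially. \<forall>s\<in>Lang. excess u (w @ replicate m a0 @ s) =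
    excess u w + excess u (replicate (length w + m) a0 @ s)"
  using eventually_walk_gap[of u "rev w" "[]"]
proof eventually_elim
  case (elim m)
  show ?case
  proof
    fix s assume "s \<in> Lang"
    then have "walk (seg_excess u) (rev w) (replicate m a0 @ s) = excess u w"
      using elim by (simp add: excess_def)
    then show "excess u (w @ replicate m a0 @ s) = excess u w + excess u (replicate (length w + m) a0 @ s)"
      using excess_append[of u w "replicate m a0 @ s"] by (simp add: replicate_add)
  qed
qed

lemma excess_a0_Cons:
  "excess u (replicate j a0 @ c # s) =
    (\<Sum>b | b < c. seg_excess u j (b # s)) + excess u (replicate (Suc j) a0 @ s)"
proof -
  have "excess u (replicate j a0 @ c # s) = excess u ((replicate j a0 @ [c]) @ s)"
    by simp
  also have "\<dots> = excess u (replicate (Suc j) a0 @ s) + walk (seg_excess u) (c # replicate j a0) s"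
    by (subst excess_append) simp
  finally show ?thesis
    by (simp add: walk_min[OF a0_min])
qed

text \<open>Each block is placed far enough behind the word built so far for additivity to hold,
  adding at least \<epsilon> with the sign of \<open>\<sigma>\<close>.\<close>

lemma excess_unbounded_of_frequently:
  assumes \<sigma>: "\<exists>\<^sub>F j in sequentially. \<exists>s\<in>Lang. \<sigma> * excess u (replicate j a0 @ s) > \<epsilon>"
  shows "\<exists>w\<in>Lang. \<sigma> * excess u w \<ge> real n * \<epsilon>"
proof (induction n)
  case 0
  then show ?case
    using Nil_in_Lang by (intro bexI[of _ "[]"]) (simp_all add: excess_def)
next
  case (Suc n)
  then obtain w where w: "w \<in> Lang" "\<sigma> * excess u w \<ge> real n * \<epsilon>"
    by blast
  obtain M where M: "\<And>m s. m \<ge> M \<Longrightarrow> s \<in> Lang \<Longrightarrow> excess u (w @ replicate m a0 @ s) =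
      excess u w + excess u (replicate (length w + m) a0 @ s)"
    using eventually_excess_gap[of u w] unfolding eventually_sequentially by blast
  obtain j s where js: "j \<ge> length w + max M d" "s \<in> Lang" "\<sigma> * excess u (replicate j a0 @ s) > \<epsilon>"
    using \<sigma> unfolding frequently_sequentially by blast
  let ?m = "j - length w"
  have "excess u (w @ replicate ?m a0 @ s) = excess u w + excess u (replicate j a0 @ s)"
    using M[of ?m s] js by simp
  moreover have "w @ replicate ?m a0 @ s \<in> Lang"
    using gap_in_Lang[of ?m s w] js w by simp
  ultimately show ?case
    using w(2) js(3) by (intro bexI[of _ "w @ replicate ?m a0 @ s"]) (simp_all add: algebra_simps)
qed

lemma excess_shift_small:
  assumes bd: "\<And>w. w \<in> Lang \<Longrightarrow> \<bar>excess u w\<bar> \<le> C" and "\<epsilon> > 0"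
  shows "\<forall>\<^sub>F j in sequentially. \<forall>s\<in>Lang. \<bar>excess u (replicate j a0 @ s)\<bar> \<le> \<epsilon>"
proof -
  have ev: "\<forall>\<^sub>F j in sequentially. \<forall>s\<in>Lang. \<sigma> * excess u (replicate j a0 @ s) \<le> \<epsilon>"
    if \<sigma>: "\<sigma> = 1 \<or> \<sigma> = -1" for \<sigma> :: real
  proof (rule ccontr)
    assume "\<not> ?thesis"
    then have *: "\<exists>\<^sub>F j in sequentially. \<exists>s\<in>Lang. \<sigma> * excess u (replicate j a0 @ s) > \<epsilon>"
      unfolding not_eventually by (simp add: not_le)
    obtain n where "C < real n * \<epsilon>"
      using reals_Archimedean3[OF \<open>\<epsilon> > 0\<close>] by blast
    moreover obtain w where "w \<in> Lang" "\<sigma> * excess u w \<ge> real n * \<epsilon>"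
      using excess_unbounded_of_frequently[OF *] by blast
    ultimately show False
      using bd[of w] \<sigma> by auto
  qed
  show ?thesis
    using ev[OF disjI1[OF refl]] ev[OF disjI2[OF refl]]
    by eventually_elim (fastforce simp: abs_le_iff)
qed

text \<open>The word \<open>t\<close> follows \<open>s\<close> in the odometer: the words lying
  between the two, with \<open>j\<close> free letters in front, are exactly those with suffix
  \<open>s\<close>. The first letter of \<open>s\<close> is raised if possible; otherwise it becomes
  \<open>a0\<close> and the carry moves on, with one more free position. Hence the induction
  generalizes over \<open>j\<close>.\<close>

lemma excess_successor:
  assumes "s \<in> Lang"
  shows "\<exists>t\<in>Lang. excess u (replicate j a0 @ t) = excess u (replicate j a0 @ s) + seg_excess u j s"
  using assms
proof (induction s arbitrary: j)
  case Nil
  \<comment> \<open>The empty word acts as an endless run of \<open>a0\<close>, so its successor is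
    the least other one-letter word.\<close>
  define c where "c = Min {c. c \<noteq> a0 \<and> [c] \<in> Lang}"
  have "{c. c \<noteq> a0 \<and> [c] \<in> Lang} \<noteq> {}"
    using second_letter by blast
  then have c: "c \<noteq> a0" "[c] \<in> Lang"
    using Min_in[of "{c. c \<noteq> a0 \<and> [c] \<in> Lang}"] by (auto simp: c_def)
  have least: "c \<le> b" if "b \<noteq> a0" "[b] \<in> Lang" for b
    unfolding c_def using that by (intro Min_le) auto
  have "(\<Sum>b | b < c. seg_excess u j [b]) = (\<Sum>b\<in>{a0}. seg_excess u j [b])"
  proof (rule sum.mono_neutral_right)
    show "{a0} \<subseteq> {b. b < c}"
      using c(1) a0_min[of c] by simp
    show "\<forall>b\<in>{b. b < c} - {a0}. seg_excess u j [b] = 0"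
      using least by (auto intro!: seg_excess_not_Lang dest: leD)
  qed simp
  also have "\<dots> = seg_excess u j []"
    using seg_excess_append_a0[of u j "[]" 1] by simp
  finally have "excess u (replicate j a0 @ [c]) = excess u (replicate j a0 @ []) + seg_excess u j []"
    unfolding excess_a0_Cons using walk_min[OF a0_min] by (simp add: excess_def flip: replicate_Suc)
  with c show ?case
    by blast
next
  case (Cons c s)
  have s: "s \<in> Lang"
    using Lang_appendD2[of "[c]" s] Cons.prems by simp
  show ?case
  proof (cases "\<exists>c'>c. c' # s \<in> Lang")
    case True
    define c' where "c' = Min {c'. c' > c \<and> c' # s \<in> Lang}"
    have c': "c' > c" "c' # s \<in> Lang"
      using True Min_in[of "{c'. c' > c \<and> c' # s \<in> Lang}"] by (auto simp: c'_def)
    have least: "c' \<le> b" if "b > c" "b # s \<in> Lang" for b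
      unfolding c'_def using that by (intro Min_le) auto
    have "(\<Sum>b | b < c'. seg_excess u j (b # s)) = (\<Sum>b\<in>insert c {b. b < c}. seg_excess u j (b # s))"
    proof (rule sum.mono_neutral_right)
      show "insert c {b. b < c} \<subseteq> {b. b < c'}"
        using c'(1) by auto
      show "\<forall>b\<in>{b. b < c'} - insert c {b. b < c}. seg_excess u j (b # s) = 0"
      proof
        fix b assume "b \<in> {b. b < c'} - insert c {b. b < c}"
        then have "b > c" "b < c'"
          by auto
        then show "seg_excess u j (b # s) = 0"
          using least[of b] by (intro seg_excess_not_Lang) auto
      qed
    qed simp
    also have "\<dots> = (\<Sum>b | b < c. seg_excess u j (b # s)) + seg_excess u j (c # s)"
      by simp
    finally have "excess u (replicate j a0 @ c' # s) =
        excess u (replicate j a0 @ c # s) + seg_excess u j (c # s)"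
      unfolding excess_a0_Cons by simp
    with c' show ?thesis
      by blast
  next
    case False
    obtain t where t: "t \<in> Lang"
      "excess u (replicate (Suc j) a0 @ t) = excess u (replicate (Suc j) a0 @ s) + seg_excess u (Suc j) s"
      using Cons.IH[OF s] by blast
    \<comment> \<open>No letter above \<open>c\<close> is admissible, so the letters up to
      \<open>c\<close> already exhaust the segment of \<open>s\<close> with \<open>Suc j\<close>
      free positions; this is the carry.\<close>
    have "seg_excess u (Suc j) s = (\<Sum>b\<in>insert c {b. b < c}. seg_excess u j (b # s))"
      unfolding seg_excess_Suc
      using False by (intro sum.mono_neutral_right) (auto intro!: seg_excess_not_Lang)
    then have "excess u (replicate j a0 @ c # s) + seg_excess u j (c # s) =
        excess u (replicate (Suc j) a0 @ s) + seg_excess u (Suc j) s"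
      unfolding excess_a0_Cons by simp
    with t have "excess u (replicate j a0 @ a0 # t) =
        excess u (replicate j a0 @ c # s) + seg_excess u j (c # s)"
      by (simp add: replicate_app_Cons_same)
    moreover have "a0 # t \<in> Lang"
      using t(1) a0_append_in_Lang[of 1 t] by simp
    ultimately show ?thesis
      by blast
  qed
qed

lemma seg_excess_small:
  assumes bd: "\<And>w. w \<in> Lang \<Longrightarrow> \<bar>excess u w\<bar> \<le> C" and "\<epsilon> > 0"
  shows "\<forall>\<^sub>F j in sequentially. \<forall>s. \<bar>seg_excess u j s\<bar> \<le> \<epsilon>"
proof -
  have "\<forall>\<^sub>F j in sequentially. \<forall>s\<in>Lang. \<bar>excess u (replicate j a0 @ s)\<bar> \<le> \<epsilon> / 2"
    using excess_shift_small[OF bd, of "\<epsilon> / 2"] \<open>\<epsilon> > 0\<close> by simp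
  then show ?thesis
  proof eventually_elim
    case (elim j)
    show ?case
    proof
      fix s
      show "\<bar>seg_excess u j s\<bar> \<le> \<epsilon>"
      proof (cases "s \<in> Lang")
        case True
        then obtain t where "t \<in> Lang"
          "excess u (replicate j a0 @ t) = excess u (replicate j a0 @ s) + seg_excess u j s"
          using excess_successor by blast
        then show ?thesis
          using bspec[OF elim True] bspec[OF elim \<open>t \<in> Lang\<close>] by linarith
      qed (use \<open>\<epsilon> > 0\<close> in \<open>simp add: seg_excess_not_Lang\<close>)
    qed
  qed
qed

end

section \<open>Arithmetic of the excess\<close>

context pisot_numeration
begin

definition count_below_seg :: "'a stream \<Rightarrow> nat \<Rightarrow> 'a list \<Rightarrow> nat" where
  "count_below_seg u j s =
    card {v. length v = j \<and> v @ s \<in> Lang \<and> stream_lex_less ((v @ s) @- sconst a0) u}"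

text \<open>The trace of \<open>\<theta> r * \<beta> ^ j * x\<close> from Q(\<beta>) to Q.\<close>

definition trace_term :: "real \<Rightarrow> nat \<Rightarrow> nat \<Rightarrow> complex" where
  "trace_term x r j = (\<Sum>\<gamma>\<in>conjugates \<beta>. conj_image \<beta> \<gamma> (\<theta> r) * \<gamma> ^ j * conj_image \<beta> \<gamma> x)"

text \<open>What remains of the trace after subtracting x times the number of accepted words. The
  conjugate \<beta> cancels, so only powers of small numbers are left.\<close>

definition trace_error :: "real \<Rightarrow> nat \<Rightarrow> nat \<Rightarrow> complex" where
  "trace_error x r j =
    (\<Sum>\<gamma>\<in>other_conj. conj_image \<beta> \<gamma> (\<theta> r) * \<gamma> ^ j * (conj_image \<beta> \<gamma> x - complex_of_real x))"

lemma seg_excess_altdef: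
  "seg_excess u j s = real (count_below_seg u j s) - stream_value u * real (acc_count d (mir s) j)"
  unfolding seg_excess_def count_below_seg_def card_append_in_Lang ..

text \<open>The infinite tail is the value minus finitely many digits, rescaled. Hence it lies in
  Q(\<beta>) whenever the value does, and it can be conjugated term by term.\<close>

lemma tail_value_eq:
  "tail_value \<beta> d \<tau> \<eta> u (Suc j) =
    \<beta> ^ j * stream_value u - (\<Sum>l<j. digit u l * \<beta> ^ (j - l - 1))"
proof -
  have "tail_value \<beta> d \<tau> \<eta> u (Suc j) =
      (\<Sum>i. \<beta> ^ j * (digit u (i + j) / \<beta> ^ (i + j + 1)))"
    unfolding tail_value_def
    using \<beta>_gt_1 by (intro suminf_cong) (simp add: digit_eq_eps power_add add.commute)
  also have "\<dots> = \<beta> ^ j * (\<Sum>i. digit u (i + j) / \<beta> ^ (i + j + 1))"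
    using summable_ignore_initial_segment[OF summable_digits[of u], of j] by (intro suminf_mult)
  also have "(\<Sum>i. digit u (i + j) / \<beta> ^ (i + j + 1)) = stream_value u - partial_value j u"
    unfolding stream_value_def partial_value_def
    by (rule suminf_minus_initial_segment[OF summable_digits])
  finally have "tail_value \<beta> d \<tau> \<eta> u (Suc j) = \<beta> ^ j * (stream_value u - partial_value j u)" .
  moreover have "\<beta> ^ j * partial_value j u = (\<Sum>l<j. digit u l * \<beta> ^ (j - l - 1))"
    unfolding partial_value_def sum_distrib_left
  proof (rule sum.cong[OF refl])
    fix l assume "l \<in> {..<j}"
    then have "\<beta> ^ (j - l - 1) * \<beta> ^ (l + 1) = \<beta> ^ j"
      unfolding power_add[symmetric] by (intro arg_cong[of _ _ "(^) \<beta>"]) simp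
    then have "\<beta> ^ j / \<beta> ^ (l + 1) = \<beta> ^ (j - l - 1)"
      using \<beta>_gt_1 by (simp add: divide_eq_eq)
    then show "\<beta> ^ j * (digit u l / \<beta> ^ (l + 1)) = digit u l * \<beta> ^ (j - l - 1)"
      by (metis mult.commute times_divide_eq_right)
  qed
  ultimately show ?thesis
    by (simp only: right_diff_distrib)
qed

lemma digit_in: "digit u l \<in> rat_adjoin \<beta>"
  unfolding digit_def by (intro rat_adjoin_sum \<eta>_in foldl_le order_refl)

lemma \<beta>_power_in: "\<beta> ^ n \<in> rat_adjoin \<beta>"
  by (intro rat_adjoin_power rat_adjoin_gen)

text \<open>After conjugation and interchange of sums, the digit part becomes the expansions of the
  counts in \<open>card_append_below\<close>; only the trace of the value remains.\<close>

lemma zeta_tail_value: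
  assumes V: "stream_value u \<in> rat_adjoin \<beta>" and r: "r \<le> d"
  shows "zeta \<beta> \<theta> r (tail_value \<beta> d \<tau> \<eta> u (Suc j)) = trace_term (stream_value u) r j -
    of_nat (\<Sum>l<j. \<Sum>a | a < u !! l. acc_count (foldl \<tau> d (stake l u @ [a])) r (j - l - 1))"
proof -
  let ?q = "\<lambda>l a. foldl \<tau> d (stake l u @ [a])"
  have conj: "conj_image \<beta> \<gamma> (tail_value \<beta> d \<tau> \<eta> u (Suc j)) = \<gamma> ^ j * conj_image \<beta> \<gamma> (stream_value u) -
      (\<Sum>l<j. \<Sum>a | a < u !! l. conj_image \<beta> \<gamma> (\<eta> (?q l a)) * \<gamma> ^ (j - l - 1))"
    if \<gamma>: "\<gamma> \<in> conjugates \<beta>" for \<gamma>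
  proof -
    have "conj_image \<beta> \<gamma> (digit u l) = (\<Sum>a | a < u !! l. conj_image \<beta> \<gamma> (\<eta> (?q l a)))" for l
      unfolding digit_def by (rule conj_sum[OF \<gamma>]) (intro \<eta>_in foldl_le order_refl)
    then show ?thesis
      unfolding tail_value_eq
      by (simp add: conj_diff[OF \<gamma>] conj_mult[OF \<gamma>] conj_sum[OF \<gamma>] conj_power[OF \<gamma>] conj_\<beta>[OF \<gamma>] V
          digit_in \<beta>_power_in rat_adjoin_mult rat_adjoin_sum rat_adjoin_gen sum_distrib_right)
  qed
  have "(\<Sum>\<gamma>\<in>conjugates \<beta>. conj_image \<beta> \<gamma> (\<theta> r) *
        (\<Sum>l<j. \<Sum>a | a < u !! l. conj_image \<beta> \<gamma> (\<eta> (?q l a)) * \<gamma> ^ (j - l - 1))) =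
      (\<Sum>l<j. \<Sum>a | a < u !! l. \<Sum>\<gamma>\<in>conjugates \<beta>.
        conj_image \<beta> \<gamma> (\<eta> (?q l a)) * conj_image \<beta> \<gamma> (\<theta> r) * \<gamma> ^ (j - l - 1))"
    unfolding sum_distrib_left
    by (subst sum.swap, rule sum.cong[OF refl], subst sum.swap) (simp add: mult.assoc mult.left_commute)
  also have "\<dots> = (\<Sum>l<j. \<Sum>a | a < u !! l. of_nat (acc_count (?q l a) r (j - l - 1)))"
    by (intro sum.cong refl acc_count_expansion[symmetric] foldl_le order_refl r)
  finally show ?thesis
    unfolding zeta_def trace_term_def
    by (simp add: conj right_diff_distrib sum_subtractf mult.assoc)
qed

lemma count_below_seg_eq:
  assumes "stream_value u \<in> rat_adjoin \<beta>"
  shows "of_nat (count_below_seg u j s) = trace_term (stream_value u) (mir s) j -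
    zeta \<beta> \<theta> (mir s) (tail_value \<beta> d \<tau> \<eta> u (Suc j)) + of_bool (meets u j s)"
  unfolding zeta_tail_value[OF assms mir_le] count_below_seg_def card_append_below by simp

lemma trace_error_eq:
  assumes "x \<in> rat_adjoin \<beta>" "r \<le> d"
  shows "trace_error x r j = trace_term x r j - complex_of_real x * of_nat (acc_count d r j)"
proof -
  have "trace_error x r j =
      (\<Sum>\<gamma>\<in>conjugates \<beta>. conj_image \<beta> \<gamma> (\<theta> r) * \<gamma> ^ j * (conj_image \<beta> \<gamma> x - complex_of_real x))"
    unfolding trace_error_def
    using finite_conjugates assms(1) by (intro sum.mono_neutral_left) (auto simp: conj_self)
  then show ?thesis
    unfolding trace_term_def acc_count_expansion[OF order_refl assms(2)]
    by (simp add: right_diff_distrib sum_subtractf sum_distrib_left \<eta>_d mult.commute mult.left_commute)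
qed

lemma seg_excess_eq:
  assumes "stream_value u \<in> rat_adjoin \<beta>"
  shows "complex_of_real (seg_excess u j s) = of_bool (meets u j s) -
    zeta \<beta> \<theta> (mir s) (tail_value \<beta> d \<tau> \<eta> u (Suc j)) + trace_error (stream_value u) (mir s) j"
  using count_below_seg_eq[OF assms, of j s] trace_error_eq[OF assms mir_le, of s j]
  by (simp add: seg_excess_altdef)

lemma trace_error_geometric:
  "\<exists>C \<rho>. 0 \<le> C \<and> 0 \<le> \<rho> \<and> \<rho> < 1 \<and> (\<forall>r\<le>d. \<forall>j. cmod (trace_error x r j) \<le> C * \<rho> ^ j)"
proof -
  \<comment> \<open>The element 0 keeps the set nonempty when \<beta> is rational and has no other
    conjugate.\<close>
  define \<rho> where "\<rho> = Max (insert 0 (cmod ` other_conj))"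
  have fin: "finite (insert 0 (cmod ` other_conj))"
    using finite_conjugates by simp
  have "\<rho> < 1"
    unfolding \<rho>_def by (subst Max_less_iff[OF fin]) (simp_all add: other_conj_less_1)
  moreover have "0 \<le> \<rho>"
    unfolding \<rho>_def by (rule Max_ge[OF fin]) simp
  ultimately have \<rho>: "0 \<le> \<rho>" "\<rho> < 1"
    by simp_all
  have \<gamma>\<rho>: "cmod \<gamma> \<le> \<rho>" if "\<gamma> \<in> other_conj" for \<gamma>
    unfolding \<rho>_def using that by (intro Max_ge[OF fin]) blast
  define A where "A r = (\<Sum>\<gamma>\<in>other_conj. cmod (conj_image \<beta> \<gamma> (\<theta> r) *
    (conj_image \<beta> \<gamma> x - complex_of_real x)))" for r
  have A: "0 \<le> A r" for r
    unfolding A_def by (intro sum_nonneg) simp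
  have "cmod (trace_error x r j) \<le> (\<Sum>r\<le>d. A r) * \<rho> ^ j" if "r \<le> d" for r j
  proof -
    have "cmod (trace_error x r j) \<le> (\<Sum>\<gamma>\<in>other_conj. cmod (conj_image \<beta> \<gamma> (\<theta> r) *
        (conj_image \<beta> \<gamma> x - complex_of_real x)) * \<rho> ^ j)"
      unfolding trace_error_def
    proof (rule sum_norm_le)
      fix \<gamma> assume "\<gamma> \<in> other_conj"
      then have "cmod \<gamma> ^ j \<le> \<rho> ^ j"
        using \<gamma>\<rho> by (intro power_mono) auto
      then have "cmod (conj_image \<beta> \<gamma> (\<theta> r) * (conj_image \<beta> \<gamma> x - complex_of_real x)) * cmod \<gamma> ^ j \<le>
          cmod (conj_image \<beta> \<gamma> (\<theta> r) * (conj_image \<beta> \<gamma> x - complex_of_real x)) * \<rho> ^ j"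
        by (intro mult_left_mono) auto
      then show "cmod (conj_image \<beta> \<gamma> (\<theta> r) * \<gamma> ^ j * (conj_image \<beta> \<gamma> x - complex_of_real x)) \<le>
          cmod (conj_image \<beta> \<gamma> (\<theta> r) * (conj_image \<beta> \<gamma> x - complex_of_real x)) * \<rho> ^ j"
        by (simp add: norm_mult norm_power mult.commute mult.left_commute)
    qed
    also have "\<dots> = A r * \<rho> ^ j"
      by (simp add: A_def sum_distrib_right)
    also have "\<dots> \<le> (\<Sum>r\<le>d. A r) * \<rho> ^ j"
      using that A \<rho> by (intro mult_right_mono member_le_sum) auto
    finally show ?thesis .
  qed
  moreover have "0 \<le> (\<Sum>r\<le>d. A r)"
    using A by (intro sum_nonneg)
  ultimately show ?thesis
    using \<rho> by blast
qed

lemma seg_excess_trivial_bound: "\<bar>seg_excess u j s\<bar> \<le> (1 + stream_value u) * real CARD('a) ^ j"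
proof -
  have le: "real (card {v :: 'a list. length v = j \<and> R v}) \<le> real CARD('a) ^ j" for R
  proof -
    have "card {v :: 'a list. length v = j \<and> R v} \<le> card {v :: 'a list. length v = j}"
      by (rule card_mono[OF finite_lists_eq]) auto
    then show ?thesis
      unfolding card_lists_eq by (simp flip: of_nat_power)
  qed
  let ?b = "real (card {v. length v = j \<and> v @ s \<in> Lang \<and> stream_lex_less ((v @ s) @- sconst a0) u})"
  let ?n = "real (card {v. length v = j \<and> v @ s \<in> Lang})"
  have "\<bar>?b - stream_value u * ?n\<bar> \<le> ?b + stream_value u * ?n"
    using stream_value_nonneg[of u] by (intro order.trans[OF abs_triangle_ineq4]) simp
  also have "\<dots> \<le> real CARD('a) ^ j + stream_value u * real CARD('a) ^ j"
    by (intro add_mono mult_left_mono le stream_value_nonneg)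
  finally show ?thesis
    by (simp add: seg_excess_def distrib_right)
qed

text \<open>For j \<ge> m the criterion leaves only the geometrically small trace error; the
  finitely many smaller j are covered by the trivial bound. A walk meets each j once, with at most
  \<open>CARD('a)\<close> letters.\<close>

lemma excess_bounded_if:
  assumes V: "stream_value u \<in> rat_adjoin \<beta>"
    and m: "\<And>s j. j \<ge> m \<Longrightarrow>
      zeta \<beta> \<theta> (mir s) (tail_value \<beta> d \<tau> \<eta> u (Suc j)) = of_bool (meets u j s)"
  shows "\<exists>C. \<forall>w. \<bar>excess u w\<bar> \<le> C"
proof -
  obtain C \<rho> where C: "0 \<le> C" and \<rho>: "0 \<le> \<rho>" "\<rho> < 1"
    and err: "\<And>r j. r \<le> d \<Longrightarrow> cmod (trace_error (stream_value u) r j) \<le> C * \<rho> ^ j"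
    using trace_error_geometric[of "stream_value u"] by blast
  define D where "D j = (if j < m then (1 + stream_value u) * real CARD('a) ^ j else 0)" for j
  have "0 \<le> D j" for j
    by (simp add: D_def stream_value_nonneg)
  have "\<bar>seg_excess u j s\<bar> \<le> D j + C * \<rho> ^ j" for j s
  proof (cases "j < m")
    case True
    then show ?thesis
      using seg_excess_trivial_bound[of u j s] C \<rho> by (simp add: D_def add_increasing2)
  next
    case False
    then have "complex_of_real (seg_excess u j s) = trace_error (stream_value u) (mir s) j"
      using seg_excess_eq[OF V, of j s] m[of j s] by simp
    then show ?thesis
      using err[OF mir_le, of s j] False by (metis D_def add_0 norm_of_real)
  qed
  then have "\<bar>excess u w\<bar> \<le> real CARD('a) * (\<Sum>j<length w. D j + C * \<rho> ^ j)" for w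
    unfolding excess_def using walk_bound[of "seg_excess u" "\<lambda>j. D j + C * \<rho> ^ j" "rev w" "[]"] by simp
  moreover have "real CARD('a) * (\<Sum>j<n. D j + C * \<rho> ^ j) \<le>
      real CARD('a) * ((\<Sum>j<m. D j) + C * (1 / (1 - \<rho>)))" for n
  proof -
    have "(\<Sum>j<n. D j) \<le> (\<Sum>j<m. D j)"
    proof -
      have "(\<Sum>j<n. D j) \<le> (\<Sum>j<max n m. D j)"
        using \<open>\<And>j. 0 \<le> D j\<close> by (intro sum_mono2) auto
      also have "\<dots> = (\<Sum>j<m. D j)"
        by (intro sum.mono_neutral_right) (auto simp: D_def)
      finally show ?thesis .
    qed
    moreover have "(\<Sum>j<n. \<rho> ^ j) \<le> 1 / (1 - \<rho>)"
      using sum_le_suminf[of "\<lambda>j. \<rho> ^ j" "{..<n}"] \<rho> by (simp add: suminf_geometric)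
    then have "(\<Sum>j<n. C * \<rho> ^ j) \<le> C * (1 / (1 - \<rho>))"
      unfolding sum_distrib_left[symmetric] using C by (rule mult_left_mono)
    ultimately have "(\<Sum>j<n. D j + C * \<rho> ^ j) \<le> (\<Sum>j<m. D j) + C * (1 / (1 - \<rho>))"
      unfolding sum.distrib by (rule add_mono)
    then show ?thesis
      by (intro mult_left_mono) auto
  qed
  ultimately show ?thesis
    by (meson order_trans)
qed

section \<open>Linear recurrences and the rationality of the value\<close>

lemma acc_count_recurrence:
  assumes "r \<le> d"
  shows "(\<Sum>i\<le>degree P. of_rat (coeff P i) * real (acc_count d r (j + i))) = 0"
proof -
  have "complex_of_real (\<Sum>i\<le>degree P. of_rat (coeff P i) * real (acc_count d r (j + i))) =
      (\<Sum>i\<le>degree P. of_rat (coeff P i) * of_nat (acc_count d r (j + i)))"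
    by (simp add: of_real_of_rat)
  also have "\<dots> = (\<Sum>i\<le>degree P. of_rat (coeff P i) *
        (\<Sum>\<gamma>\<in>conjugates \<beta>. conj_image \<beta> \<gamma> (\<eta> d) * conj_image \<beta> \<gamma> (\<theta> r) * \<gamma> ^ (j + i)))"
    by (simp only: acc_count_expansion[OF order_refl assms])
  also have "\<dots> = (\<Sum>\<gamma>\<in>conjugates \<beta>. conj_image \<beta> \<gamma> (\<eta> d) * conj_image \<beta> \<gamma> (\<theta> r) * \<gamma> ^ j * rpoly P \<gamma>)"
    unfolding rpoly_altdef sum_distrib_left
    by (subst sum.swap) (simp add: power_add mult.assoc mult.left_commute)
  also have "\<dots> = 0"
    by (intro sum.neutral) (simp add: conjugates_iff)
  finally show ?thesis
    by (simp only: of_real_eq_0_iff)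
qed

text \<open>The operator \<open>P(E)/(E - \<beta>)\<close>, with \<open>E\<close> the shift of sequences.\<close>

definition quotient_shift :: "(nat \<Rightarrow> real) \<Rightarrow> nat \<Rightarrow> real" where
  "quotient_shift a j =
    (\<Sum>i\<le>degree P. of_rat (coeff P i) * (\<Sum>l<i. \<beta> ^ (i - Suc l) * a (j + l)))"

text \<open>The polynomials E^i - \<beta>^i are divisible by E - \<beta>, and their combination with
  the coefficients of P is P(E) because P(\<beta>) = 0.\<close>

lemma quotient_shift_Suc:
  "quotient_shift a (Suc j) - \<beta> * quotient_shift a j =
    (\<Sum>i\<le>degree P. of_rat (coeff P i) * a (j + i))"
proof -
  have tele: "(\<Sum>l<i. \<beta> ^ (i - Suc l) * a (Suc j + l)) - \<beta> * (\<Sum>l<i. \<beta> ^ (i - Suc l) * a (j + l)) =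
      a (j + i) - \<beta> ^ i * a j" for i
  proof -
    have "(\<Sum>l<i. \<beta> ^ (i - Suc l) * a (Suc j + l)) - \<beta> * (\<Sum>l<i. \<beta> ^ (i - Suc l) * a (j + l)) =
        (\<Sum>l<i. \<beta> ^ (i - Suc l) * a (j + Suc l) - \<beta> ^ (i - l) * a (j + l))"
      unfolding sum_distrib_left sum_subtractf[symmetric]
    proof (rule sum.cong[OF refl])
      fix l assume "l \<in> {..<i}"
      then have "\<beta> ^ (i - l) = \<beta> * \<beta> ^ (i - Suc l)"
        by (metis Suc_diff_Suc lessThan_iff power_Suc)
      then show "\<beta> ^ (i - Suc l) * a (Suc j + l) - \<beta> * (\<beta> ^ (i - Suc l) * a (j + l)) =
          \<beta> ^ (i - Suc l) * a (j + Suc l) - \<beta> ^ (i - l) * a (j + l)"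
        by simp
    qed
    also have "\<dots> = a (j + i) - \<beta> ^ i * a j"
      using sum_lessThan_telescope[of "\<lambda>l. \<beta> ^ (i - l) * a (j + l)" i] by simp
    finally show ?thesis .
  qed
  have "quotient_shift a (Suc j) - \<beta> * quotient_shift a j =
      (\<Sum>i\<le>degree P. of_rat (coeff P i) * (a (j + i) - \<beta> ^ i * a j))"
    unfolding quotient_shift_def tele[symmetric]
    by (simp add: sum_distrib_left sum_subtractf right_diff_distrib mult.left_commute)
  also have "\<dots> = (\<Sum>i\<le>degree P. of_rat (coeff P i) * a (j + i)) - rpoly P \<beta> * a j"
    unfolding rpoly_altdef
    by (simp add: right_diff_distrib sum_subtractf sum_distrib_right mult.assoc)
  finally show ?thesis
    by (simp add: P_\<beta>)
qed

lemma quotient_shift_geometric: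
  assumes "\<And>j. j \<ge> J \<Longrightarrow> (\<Sum>i\<le>degree P. of_rat (coeff P i) * a (j + i)) = 0"
  shows "quotient_shift a (J + n) = \<beta> ^ n * quotient_shift a J"
proof (induction n)
  case (Suc n)
  then show ?case
    using quotient_shift_Suc[of a "J + n"] assms[of "J + n"] by simp
qed simp

text \<open>Irreducible polynomials in characteristic 0 are separable: the derivative is nonzero and
  of smaller degree, so P cannot divide it.\<close>

lemma pderiv_P_\<beta>: "rpoly (pderiv P) \<beta> \<noteq> 0"
proof
  assume "rpoly (pderiv P) \<beta> = 0"
  then have "P dvd pderiv P"
    using irreducible_root_dvd[OF P_irreducible P_\<beta>] by blast
  moreover have "degree P > 0"
  proof (rule ccontr)
    assume "\<not> degree P > 0"
    then obtain c where "P = [:c:]"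
      using degree_eq_zeroE by blast
    with P_\<beta> P_irreducible show False
      by simp
  qed
  ultimately show False
    by (metis degree_pderiv dvd_imp_degree_le diff_less not_le pderiv_eq_0_iff less_numeral_extra(1) neq0_conv)
qed

text \<open>The counts behave like \<theta>_d \<beta>^k, and P(x)/(x - \<beta>) takes the value
  P'(\<beta>) at \<beta>. Since the shifted counts form an exact geometric progression, a nonzero
  limit of the quotients means that every single term is nonzero.\<close>

lemma quotient_shift_acc_count_nonzero: "quotient_shift (\<lambda>k. real (acc_count d d k)) J \<noteq> 0"
proof -
  let ?n = "\<lambda>k. real (acc_count d d k)"
  have "(\<lambda>k. quotient_shift ?n k / \<beta> ^ k) \<longlonglongrightarrow>
      (\<Sum>i\<le>degree P. of_rat (coeff P i) * (\<Sum>l<i. \<beta> ^ (i - Suc l) * (\<beta> ^ l * \<theta> d)))"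
  proof -
    have "(\<lambda>k. \<beta> ^ l * (?n (k + l) / \<beta> ^ (k + l))) \<longlonglongrightarrow> \<beta> ^ l * (\<eta> d * \<theta> d)" for l
      by (intro tendsto_mult_left LIMSEQ_ignore_initial_segment[OF acc_count_lim] order_refl)
    moreover have "\<beta> ^ l * (?n (k + l) / \<beta> ^ (k + l)) = ?n (k + l) / \<beta> ^ k" for k l
      using \<beta>_gt_1 by (simp add: power_add)
    ultimately have "(\<lambda>k. \<Sum>i\<le>degree P. of_rat (coeff P i) *
        (\<Sum>l<i. \<beta> ^ (i - Suc l) * (?n (k + l) / \<beta> ^ k))) \<longlonglongrightarrow>
        (\<Sum>i\<le>degree P. of_rat (coeff P i) * (\<Sum>l<i. \<beta> ^ (i - Suc l) * (\<beta> ^ l * \<theta> d)))"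
      by (intro tendsto_sum tendsto_mult_left) (simp add: \<eta>_d)
    then show ?thesis
      by (simp only: quotient_shift_def sum_divide_distrib times_divide_eq_right[symmetric])
  qed
  also have "(\<Sum>i\<le>degree P. of_rat (coeff P i) * (\<Sum>l<i. \<beta> ^ (i - Suc l) * (\<beta> ^ l * \<theta> d))) =
      \<theta> d * rpoly (pderiv P) \<beta>"
  proof -
    have "(\<Sum>l<i. \<beta> ^ (i - Suc l) * (\<beta> ^ l * \<theta> d)) = \<theta> d * (of_nat i * \<beta> ^ (i - 1))" for i
    proof -
      have "(\<Sum>l<i. \<beta> ^ (i - Suc l) * (\<beta> ^ l * \<theta> d)) = (\<Sum>l<i. \<beta> ^ (i - 1) * \<theta> d)"
        unfolding mult.assoc[symmetric] power_add[symmetric]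
        by (intro sum.cong refl arg_cong2[of _ _ _ _ "(*)"] arg_cong[of _ _ "(^) \<beta>"]) auto
      then show ?thesis
        by simp
    qed
    then show ?thesis
      by (simp add: rpoly_pderiv sum_distrib_left mult.left_commute)
  qed
  finally have lim: "(\<lambda>k. quotient_shift ?n k / \<beta> ^ k) \<longlonglongrightarrow> \<theta> d * rpoly (pderiv P) \<beta>" .
  have "(\<lambda>k. quotient_shift ?n (k + J) / \<beta> ^ (k + J)) \<longlonglongrightarrow> \<theta> d * rpoly (pderiv P) \<beta>"
    by (rule LIMSEQ_ignore_initial_segment[OF lim])
  moreover have "quotient_shift ?n (k + J) / \<beta> ^ (k + J) = quotient_shift ?n J / \<beta> ^ J" for k
    using quotient_shift_geometric[of J ?n k] acc_count_recurrence[OF order_refl] \<beta>_gt_1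
    by (simp add: power_add add.commute)
  ultimately have "quotient_shift ?n J / \<beta> ^ J = \<theta> d * rpoly (pderiv P) \<beta>"
    by (simp add: LIMSEQ_const_iff)
  then show ?thesis
    using \<theta>_d_pos pderiv_P_\<beta> by auto
qed

lemma quotient_shift_in:
  assumes "\<And>j. a j \<in> rat_adjoin \<beta>"
  shows "quotient_shift a j \<in> rat_adjoin \<beta>"
  unfolding quotient_shift_def
  by (intro rat_adjoin_sum rat_adjoin_mult rat_adjoin_of_rat \<beta>_power_in assms)

lemma quotient_shift_diff:
  "quotient_shift (\<lambda>j. a j - x * b j) j = quotient_shift a j - x * quotient_shift b j"
  by (simp add: quotient_shift_def right_diff_distrib sum_subtractf sum_distrib_left mult.left_commute)

lemma quotient_shift_null:
  assumes "a \<longlonglongrightarrow> 0"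
  shows "quotient_shift a \<longlonglongrightarrow> 0"
proof -
  have "(\<lambda>j. quotient_shift a j) \<longlonglongrightarrow>
      (\<Sum>i\<le>degree P. of_rat (coeff P i) * (\<Sum>l<i. \<beta> ^ (i - Suc l) * 0))"
    unfolding quotient_shift_def
    by (intro tendsto_sum tendsto_mult_left LIMSEQ_ignore_initial_segment assms)
  then show ?thesis
    by simp
qed

lemma eventually_int_zero:
  fixes f :: "nat \<Rightarrow> real"
  assumes "f \<longlonglongrightarrow> 0" "\<And>j. f j \<in> \<int>"
  shows "\<forall>\<^sub>F j in sequentially. f j = 0"
proof -
  have "\<forall>\<^sub>F j in sequentially. \<bar>f j\<bar> < 1"
    using order_tendstoD(2)[OF tendsto_rabs[OF assms(1)], of 1] by simp
  then show ?thesis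
    by eventually_elim (use assms(2) Ints_nonzero_abs_less1 in blast)
qed

text \<open>
  Pisot's argument: the integers \<open>p\<^sub>j\<close> differ from \<open>V n\<^sub>j\<close> by a null sequence and \<open>n\<^sub>j\<close> satisfies the
  recurrence \<open>P\<close>, hence so does \<open>p\<^sub>j\<close> from some point on.
\<close>

lemma value_in_rat_adjoin:
  fixes p :: "nat \<Rightarrow> nat"
  assumes lim: "(\<lambda>j. real (p j) - V * real (acc_count d d j)) \<longlonglongrightarrow> 0"
  shows "V \<in> rat_adjoin \<beta>"
proof -
  let ?n = "\<lambda>k. real (acc_count d d k)" and ?p = "\<lambda>k. real (p k)"
  let ?R = "\<lambda>a j. \<Sum>i\<le>degree P. of_rat (coeff P i) * a (j + i)"
  \<comment> \<open>Clearing the denominators of \<open>P\<close> makes the recurrence defect an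
    integer, so that its convergence to 0 forces it to vanish eventually.\<close>
  obtain N where N: "N > 0" "\<And>i. i \<le> degree P \<Longrightarrow> \<exists>z. of_nat N * coeff P i = of_int z"
    using common_denominator[of "{..degree P}" "coeff P"] by auto
  have "?R ?p j = ?R (\<lambda>j. ?p j - V * ?n j) j" for j
  proof -
    have "?R (\<lambda>j. ?p j - V * ?n j) j = ?R ?p j - V * ?R ?n j"
      by (simp add: right_diff_distrib sum_subtractf sum_distrib_left mult.left_commute)
    then show ?thesis
      using acc_count_recurrence[OF order_refl, of j] by simp
  qed
  moreover have "(\<lambda>j. ?R (\<lambda>j. ?p j - V * ?n j) j) \<longlonglongrightarrow> (\<Sum>i\<le>degree P. of_rat (coeff P i) * 0)"
    by (intro tendsto_sum tendsto_mult_left LIMSEQ_ignore_initial_segment[OF lim])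
  ultimately have "(\<lambda>j. real N * ?R ?p j) \<longlonglongrightarrow> real N * 0"
    by (intro tendsto_mult_left) simp
  moreover have "real N * ?R ?p j \<in> \<int>" for j
  proof -
    have "real N * of_rat (coeff P i) \<in> \<int>" if i: "i \<le> degree P" for i
    proof -
      obtain z where "of_nat N * coeff P i = of_int z"
        using N(2)[OF i] by blast
      then have "of_rat (of_nat N * coeff P i) = (of_int z :: real)"
        by simp
      then show ?thesis
        by (simp add: of_rat_mult)
    qed
    then show ?thesis
      unfolding sum_distrib_left mult.assoc[symmetric]
      by (intro Ints_sum Ints_mult[OF _ Ints_of_nat]) simp
  qed
  ultimately have "\<forall>\<^sub>F j in sequentially. real N * ?R ?p j = 0"
    by (intro eventually_int_zero) simp_all
  then obtain J where J: "\<And>j. j \<ge> J \<Longrightarrow> ?R ?p j = 0"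
    using N(1) unfolding eventually_sequentially by auto
  \<comment> \<open>Both quotient shifts are geometric with ratio \<beta> > 1 from \<open>J\<close>
    on, while their combination tends to 0. Hence \<open>?W\<close> vanishes, which expresses V as a
    quotient of elements of Q(\<beta>).\<close>
  let ?W = "quotient_shift ?p J - V * quotient_shift ?n J"
  have W: "quotient_shift (\<lambda>j. ?p j - V * ?n j) (k + J) = \<beta> ^ k * ?W" for k
    using quotient_shift_geometric[of J ?p k, OF J] quotient_shift_geometric[of J ?n k]
      acc_count_recurrence[OF order_refl]
    by (simp add: quotient_shift_diff add.commute right_diff_distrib mult.left_commute)
  have "?W = 0"
  proof (rule ccontr)
    assume "?W \<noteq> 0"
    have "(\<lambda>k. \<beta> ^ k * ?W) \<longlonglongrightarrow> 0"
      unfolding W[symmetric] by (rule LIMSEQ_ignore_initial_segment[OF quotient_shift_null[OF lim]])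
    moreover have "norm ?W \<le> norm (\<beta> ^ k * ?W)" for k
      using \<beta>_gt_1 by (simp add: abs_mult mult_le_cancel_right1)
    ultimately have "norm ?W \<le> norm (0 :: real)"
      by (intro LIMSEQ_le_const[OF tendsto_norm]) auto
    with \<open>?W \<noteq> 0\<close> show False
      by simp
  qed
  then have "V = quotient_shift ?p J * inverse (quotient_shift ?n J)"
    using quotient_shift_acc_count_nonzero[of J] by (simp add: field_simps)
  also have "\<dots> \<in> rat_adjoin \<beta>"
    by (intro rat_adjoin_mult rat_adjoin_inverse quotient_shift_in rat_adjoin_of_nat)
  finally show ?thesis .
qed

text \<open>For x = p(\<beta>) the trace is the combination of the integers
  \<open>acc_count d r (j + i)\<close> with the coefficients of p, so one denominator of p serves
  all r and j.\<close>

lemma trace_term_denominator: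
  assumes "x \<in> rat_adjoin \<beta>"
  shows "\<exists>N>0. \<forall>r\<le>d. \<forall>j. \<exists>z. of_nat N * trace_term x r j = of_int z"
proof -
  obtain p where x: "x = rpoly p \<beta>"
    using rat_adjoin_rpoly[OF assms] by blast
  obtain N where N: "N > 0" "\<And>i. i \<le> degree p \<Longrightarrow> \<exists>z. of_nat N * coeff p i = of_int z"
    using common_denominator[of "{..degree p}" "coeff p"] by auto
  obtain z where z: "\<And>i. i \<le> degree p \<Longrightarrow> of_nat N * coeff p i = of_int (z i)"
    using N(2) by metis
  have "of_nat N * trace_term x r j = of_int (\<Sum>i\<le>degree p. z i * int (acc_count d r (j + i)))"
    if r: "r \<le> d" for r j
  proof -
    have "trace_term x r j = (\<Sum>\<gamma>\<in>conjugates \<beta>. conj_image \<beta> \<gamma> (\<theta> r) * \<gamma> ^ j * rpoly p \<gamma>)"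
      unfolding trace_term_def x by (intro sum.cong refl) (simp add: conj_rpoly)
    also have "\<dots> = (\<Sum>i\<le>degree p. of_rat (coeff p i) *
        (\<Sum>\<gamma>\<in>conjugates \<beta>. conj_image \<beta> \<gamma> (\<eta> d) * conj_image \<beta> \<gamma> (\<theta> r) * \<gamma> ^ (j + i)))"
      unfolding rpoly_altdef sum_distrib_left
      by (subst sum.swap) (simp add: power_add mult.assoc mult.left_commute \<eta>_d)
    also have "\<dots> = (\<Sum>i\<le>degree p. of_rat (coeff p i) * of_nat (acc_count d r (j + i)))"
      by (simp only: acc_count_expansion[OF order_refl r])
    finally have "of_nat N * trace_term x r j =
        (\<Sum>i\<le>degree p. of_rat (of_nat N * coeff p i) * of_nat (acc_count d r (j + i)))"
      by (simp add: sum_distrib_left of_rat_mult mult.assoc)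
    also have "\<dots> = (\<Sum>i\<le>degree p. of_int (z i) * of_nat (acc_count d r (j + i)))"
      by (intro sum.cong refl) (simp add: z)
    finally show ?thesis
      by simp
  qed
  with N(1) show ?thesis
    by blast
qed

lemma excess_bounded_only_if:
  assumes bd: "\<And>w. w \<in> Lang \<Longrightarrow> \<bar>excess u w\<bar> \<le> C"
  shows "stream_value u \<in> rat_adjoin \<beta>"
    and "\<exists>m. \<forall>s. \<forall>j\<ge>m. zeta \<beta> \<theta> (mir s) (tail_value \<beta> d \<tau> \<eta> u (Suc j)) = of_bool (meets u j s)"
proof -
  have "(\<lambda>j. real (count_below_seg u j []) - stream_value u * real (acc_count d d j)) \<longlonglongrightarrow> 0"
  proof (rule LIMSEQ_I)
    fix e :: real assume "e > 0"
    then obtain J where J: "\<And>j s. j \<ge> J \<Longrightarrow> \<bar>seg_excess u j s\<bar> \<le> e / 2"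
      using seg_excess_small[OF bd, of "e / 2"] unfolding eventually_sequentially by auto
    have "\<bar>real (count_below_seg u j []) - stream_value u * real (acc_count d d j)\<bar> < e" if "j \<ge> J" for j
      using J[OF that, of "[]"] \<open>e > 0\<close> by (simp add: seg_excess_altdef)
    then show "\<exists>J. \<forall>j\<ge>J. norm (real (count_below_seg u j []) - stream_value u * real (acc_count d d j) - 0) < e"
      by auto
  qed
  then show V: "stream_value u \<in> rat_adjoin \<beta>"
    by (rule value_in_rat_adjoin)
  obtain N where N: "N > 0" "\<And>r j. r \<le> d \<Longrightarrow> \<exists>z. of_nat N * trace_term (stream_value u) r j = of_int z"
    using trace_term_denominator[OF V] by blast
  obtain D \<rho> where D: "0 \<le> D" and \<rho>: "0 \<le> \<rho>" "\<rho> < 1"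
    and err: "\<And>r j. r \<le> d \<Longrightarrow> cmod (trace_error (stream_value u) r j) \<le> D * \<rho> ^ j"
    using trace_error_geometric[of "stream_value u"] by blast
  have "(\<lambda>j. D * \<rho> ^ j) \<longlonglongrightarrow> D * 0"
    by (rule tendsto_mult_left[OF LIMSEQ_power_zero]) (use \<rho> in simp)
  \<comment> \<open>Half of 1/N is allotted to the trace error and half to the excess: an integer
    multiple of 1/N of modulus below 1/N is 0.\<close>
  then have "\<forall>\<^sub>F j in sequentially. D * \<rho> ^ j < 1 / (2 * real N)"
    using N(1) by (intro order_tendstoD) auto
  moreover have "\<forall>\<^sub>F j in sequentially. \<forall>s. \<bar>seg_excess u j s\<bar> \<le> 1 / (2 * real N)"
    using N(1) by (intro seg_excess_small[OF bd]) auto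
  ultimately have "\<forall>\<^sub>F j in sequentially. \<forall>s.
      zeta \<beta> \<theta> (mir s) (tail_value \<beta> d \<tau> \<eta> u (Suc j)) = of_bool (meets u j s)"
  proof eventually_elim
    case (elim j)
    show ?case
    proof
      fix s
      let ?x = "of_nat (count_below_seg u j s) - trace_term (stream_value u) (mir s) j"
      have "?x = complex_of_real (seg_excess u j s) - trace_error (stream_value u) (mir s) j"
        unfolding trace_error_eq[OF V mir_le] seg_excess_altdef by simp
      then have "cmod ?x \<le> \<bar>seg_excess u j s\<bar> + cmod (trace_error (stream_value u) (mir s) j)"
        by (metis norm_of_real norm_triangle_ineq4)
      also have "\<dots> < 1 / (2 * real N) + 1 / (2 * real N)"
        using elim err[OF mir_le, of s j] by (intro add_le_less_mono) auto
      also have "\<dots> = 1 / real N"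
        by simp
      finally have "real N * cmod ?x < 1"
        using N(1) by (simp add: field_simps)
      then have "cmod (of_nat N * ?x) < 1"
        by (simp only: norm_mult norm_of_nat)
      moreover obtain z where "of_nat N * trace_term (stream_value u) (mir s) j = of_int z"
        using N(2)[OF mir_le] by blast
      then have "of_nat N * ?x = of_int (int N * int (count_below_seg u j s) - z)"
        by (simp add: right_diff_distrib)
      ultimately have "\<bar>int N * int (count_below_seg u j s) - z\<bar> < 1"
        by (simp only: norm_of_int)
      then have "of_nat N * ?x = 0"
        using \<open>of_nat N * ?x = of_int _\<close> by simp
      then have "?x = 0"
        using N(1) by simp
      then show "zeta \<beta> \<theta> (mir s) (tail_value \<beta> d \<tau> \<eta> u (Suc j)) = of_bool (meets u j s)"
        using count_below_seg_eq[OF V, of j s] by simp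
    qed
  qed
  then show "\<exists>m. \<forall>s. \<forall>j\<ge>m. zeta \<beta> \<theta> (mir s) (tail_value \<beta> d \<tau> \<eta> u (Suc j)) = of_bool (meets u j s)"
    unfolding eventually_sequentially by blast
qed

lemma bounded_discrepancy_criterion:
  assumes u: "u \<in> omega_language Lang"
  shows "bounded (range (\<lambda>N. discrepancy (van_der_corput Lang) N {0..<omega_value Lang u})) \<longleftrightarrow>
    omega_value Lang u \<in> rat_adjoin \<beta> \<and>
    (\<exists>m::nat. \<forall>v. \<forall>k>m.
        zeta \<beta> \<theta> (foldl (mirror_trans d \<tau>) d (rev v)) (tail_value \<beta> d \<tau> \<eta> u k)
          = (if stream_lex_less (v @- sconst a0) (sdrop (k - 1) u) \<and> stake (k - 1) u @ v \<in> Lang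
             then 1 else 0))"
    (is "?bounded \<longleftrightarrow> _ \<and> (\<exists>m. ?cond m)")
proof -
  have cond: "?cond m \<longleftrightarrow> (\<forall>s. \<forall>j\<ge>m. zeta \<beta> \<theta> (mir s) (tail_value \<beta> d \<tau> \<eta> u (Suc j)) =
      of_bool (meets u j s))" for m
  proof -
    have shift: "(\<forall>k>m. Q k) \<longleftrightarrow> (\<forall>j\<ge>m. Q (Suc j))" for Q
    proof (intro iffI allI impI)
      fix k assume Q: "\<forall>j\<ge>m. Q (Suc j)" and "m < k"
      then obtain j where "k = Suc j" "m \<le> j"
        by (cases k) auto
      with Q show "Q k"
        by blast
    next
      fix j assume "\<forall>k>m. Q k" "m \<le> j"
      then show "Q (Suc j)"
        by (simp add: less_Suc_eq_le)
    qed
    show ?thesis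
      unfolding shift meets_def of_bool_def diff_Suc_1 ..
  qed
  show ?thesis
    unfolding cond bounded_discrepancy_iff[OF u] excess_def[symmetric]
    unfolding omega_value_eq[OF u]
  proof
    assume "\<exists>C. \<forall>w\<in>Lang. \<bar>excess u w\<bar> \<le> C"
    then obtain C where C: "\<And>w. w \<in> Lang \<Longrightarrow> \<bar>excess u w\<bar> \<le> C"
      by blast
    show "stream_value u \<in> rat_adjoin \<beta> \<and> (\<exists>m. \<forall>s. \<forall>j\<ge>m.
        zeta \<beta> \<theta> (mir s) (tail_value \<beta> d \<tau> \<eta> u (Suc j)) = of_bool (meets u j s))"
      using excess_bounded_only_if[of u C, OF C] by (rule conjI)
  next
    assume *: "stream_value u \<in> rat_adjoin \<beta> \<and> (\<exists>m. \<forall>s. \<forall>j\<ge>m.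
        zeta \<beta> \<theta> (mir s) (tail_value \<beta> d \<tau> \<eta> u (Suc j)) = of_bool (meets u j s))"
    then obtain m where "\<And>s j. j \<ge> m \<Longrightarrow>
        zeta \<beta> \<theta> (mir s) (tail_value \<beta> d \<tau> \<eta> u (Suc j)) = of_bool (meets u j s)"
      by blast
    from excess_bounded_if[OF conjunct1[OF *] this]
    show "\<exists>C. \<forall>w\<in>Lang. \<bar>excess u w\<bar> \<le> C"
      by blast
  qed
qed

end

section \<open>Incidence matrices\<close>

lemma sum_sorted_list_of_set:
  fixes f :: "'s::linorder \<Rightarrow> 'b::comm_monoid_add"
  assumes "finite S"
  shows "(\<Sum>j<card S. f (sorted_list_of_set S ! j)) = (\<Sum>r\<in>S. f r)"
  using sum.reindex_bij_betw[OF bij_betw_nth[of "sorted_list_of_set S" "{..<card S}" S], of f] assms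
  by simp

lemma incidence_mat_carrier [simp]: "incidence_mat \<tau> S \<in> carrier_mat (card S) (card S)"
  by (simp add: incidence_mat_def Let_def)

lemma incidence_mat_hom:
  "map_mat of_rat (incidence_mat \<tau> S :: rat mat) = (incidence_mat \<tau> S :: 'b::field_char_0 mat)"
  by (rule eq_matI) (simp_all add: incidence_mat_def Let_def)

text \<open>The entries are natural numbers, so the real and the complex matrix share the rational
  characteristic polynomial.\<close>

lemma eigenvalue_incidence_mat_iff:
  "eigenvalue (incidence_mat \<tau> S :: 'b::field_char_0 mat) x \<longleftrightarrow>
    rpoly (char_poly (incidence_mat \<tau> S :: rat mat)) x = 0"
proof -
  have "char_poly (incidence_mat \<tau> S :: 'b mat) =
      map_poly of_rat (char_poly (incidence_mat \<tau> S :: rat mat))"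
    using of_rat_hom.char_poly_hom[OF incidence_mat_carrier, of \<tau> S, where 'a = 'b]
    unfolding incidence_mat_hom .
  then show ?thesis
    by (simp add: eigenvalue_root_char_poly[OF incidence_mat_carrier] rpoly_def)
qed

lemma incidence_mat_mult_vec:
  fixes \<tau> :: "'s::linorder \<Rightarrow> 'a::finite \<Rightarrow> 's" and f :: "'s \<Rightarrow> 'b::comm_ring_1"
  assumes "finite S" "i < card S"
  shows "vec_index (incidence_mat \<tau> S *\<^sub>v Matrix.vec (card S) (\<lambda>j. f (sorted_list_of_set S ! j))) i =
    (\<Sum>a | \<tau> (sorted_list_of_set S ! i) a \<in> S. f (\<tau> (sorted_list_of_set S ! i) a))"
proof -
  let ?q = "sorted_list_of_set S ! i"
  have "vec_index (incidence_mat \<tau> S *\<^sub>v Matrix.vec (card S) (\<lambda>j. f (sorted_list_of_set S ! j))) i =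
      (\<Sum>j<card S. of_nat (card {a. \<tau> ?q a = sorted_list_of_set S ! j}) * f (sorted_list_of_set S ! j))"
    using assms by (simp add: incidence_mat_def Let_def scalar_prod_def lessThan_atLeast0)
  also have "\<dots> = (\<Sum>r\<in>S. of_nat (card {a. \<tau> ?q a = r}) * f r)"
    by (rule sum_sorted_list_of_set[OF assms(1)])
  also have "\<dots> = (\<Sum>r\<in>S. \<Sum>a | a \<in> {a. \<tau> ?q a \<in> S} \<and> \<tau> ?q a = r. f (\<tau> ?q a))"
  proof (rule sum.cong[OF refl])
    fix r assume "r \<in> S"
    then have "{a. a \<in> {a. \<tau> ?q a \<in> S} \<and> \<tau> ?q a = r} = {a. \<tau> ?q a = r}"
      by auto
    then show "of_nat (card {a. \<tau> ?q a = r}) * f r =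
        (\<Sum>a | a \<in> {a. \<tau> ?q a \<in> S} \<and> \<tau> ?q a = r. f (\<tau> ?q a))"
      by simp
  qed
  also have "\<dots> = (\<Sum>a | \<tau> ?q a \<in> S. f (\<tau> ?q a))"
    by (rule sum.group) (use assms(1) in auto)
  finally show ?thesis .
qed

lemma sorted_list_of_set_atLeastAtMost_nth: "i < d \<Longrightarrow> sorted_list_of_set {1..d} ! i = Suc i"
proof -
  have "sorted_list_of_set {1..d} = [1..<Suc d]"
    by (metis atLeastLessThanSuc_atLeastAtMost sorted_list_of_set_range)
  then show "i < d \<Longrightarrow> ?thesis"
    by (simp del: upt_Suc)
qed

context ordered_automaton
begin

lemma sum_nonzero_states:
  fixes \<eta> :: "nat \<Rightarrow> 'b::comm_monoid_add"
  assumes "\<eta> 0 = 0" "\<And>a. \<tau> q a \<noteq> 0 \<Longrightarrow> \<tau> q a \<in> S"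
  shows "(\<Sum>a | \<tau> q a \<in> S. \<eta> (\<tau> q a)) = (\<Sum>a\<in>UNIV. \<eta> (\<tau> q a))"
proof (rule sum.mono_neutral_left)
  show "\<forall>a\<in>UNIV - {a. \<tau> q a \<in> S}. \<eta> (\<tau> q a) = 0"
  proof
    fix a assume "a \<in> UNIV - {a. \<tau> q a \<in> S}"
    then have "\<tau> q a = 0"
      using assms(2) by blast
    then show "\<eta> (\<tau> q a) = 0"
      by (simp add: assms(1))
  qed
qed auto

lemma eigenvector_sum:
  fixes \<eta> :: "nat \<Rightarrow> real"
  assumes ev: "eigenvector (incidence_mat \<tau> {1..d} :: real mat) (Matrix.vec d (\<lambda>i. \<eta> (i + 1))) \<beta>"
    and 0: "\<eta> 0 = 0" and q: "q \<le> d"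
  shows "(\<Sum>a\<in>UNIV. \<eta> (\<tau> q a)) = \<beta> * \<eta> q"
proof (cases q)
  case 0
  then show ?thesis
    using assms(2) by (simp add: \<tau>_0)
next
  case (Suc i)
  then have i: "i < d" "sorted_list_of_set {1..d} ! i = q"
    using q sorted_list_of_set_atLeastAtMost_nth[of i d] by auto
  have "Matrix.vec d (\<lambda>i. \<eta> (i + 1)) = Matrix.vec (card {1..d}) (\<lambda>j. \<eta> (sorted_list_of_set {1..d} ! j))"
    by (rule eq_vecI) (simp_all add: sorted_list_of_set_atLeastAtMost_nth del: One_nat_def flip: Suc_eq_plus1)
  then have "vec_index (incidence_mat \<tau> {1..d} *\<^sub>v Matrix.vec d (\<lambda>i. \<eta> (i + 1))) i =
      (\<Sum>a | \<tau> q a \<in> {1..d}. \<eta> (\<tau> q a))"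
    using incidence_mat_mult_vec[of "{1..d}" i \<tau> \<eta>] i by (simp del: One_nat_def)
  also have "\<dots> = (\<Sum>a\<in>UNIV. \<eta> (\<tau> q a))"
    using \<tau>_le[OF q] by (intro sum_nonzero_states assms(2)) (auto simp: Suc_le_eq)
  finally show ?thesis
    using ev i(1) Suc by (simp add: eigenvector_def)
qed

text \<open>The Pisot property concerns the matrix of the trimmed automaton, whereas
  \<open>P\<close> comes from all positive states. Successors of trimmed states are trimmed or 0, so
  \<open>\<eta>\<close> restricts to an eigenvector of the smaller matrix for \<beta>. Thus
  \<open>P\<close> divides its characteristic polynomial, and the roots of \<open>P\<close> are
  among its eigenvalues.\<close>

lemma conjugates_of_pisot:
  fixes \<eta> :: "nat \<Rightarrow> real"
  assumes pisot: "pisot_automaton {0..d} \<tau> d {1..d}"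
    and irr: "irreducible P" and P: "rpoly P \<beta> = 0" and \<beta>: "\<beta> > 1"
    and eig: "\<And>q. q \<le> d \<Longrightarrow> (\<Sum>a\<in>UNIV. \<eta> (\<tau> q a)) = \<beta> * \<eta> q"
    and 0: "\<eta> 0 = 0" and \<eta>d: "\<eta> d = 1"
    and \<gamma>: "rpoly P \<gamma> = 0" "\<gamma> \<noteq> complex_of_real \<beta>"
  shows "cmod \<gamma> < 1"
proof -
  let ?S = "trim_states {0..d} \<tau> d {1..d}"
  let ?R = "char_poly (incidence_mat \<tau> ?S :: rat mat)"
  let ?v = "Matrix.vec (card ?S) (\<lambda>j. \<eta> (sorted_list_of_set ?S ! j))"
  have fin: "finite ?S"
    by (simp add: trim_states_def)
  have dS: "d \<in> ?S"
  proof -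
    have "\<exists>w. d = foldl \<tau> d w" "\<exists>w. foldl \<tau> d w \<in> {1..d}"
      using d_pos by (auto intro: exI[of _ "[]"])
    then show ?thesis
      by (simp add: trim_states_def)
  qed
  have closed: "\<tau> q a \<in> ?S" if q: "q \<in> ?S" "\<tau> q a \<noteq> 0" for q a
  proof -
    obtain w where w: "q = foldl \<tau> d w" and "q \<le> d"
      using q(1) by (auto simp: trim_states_def)
    then have "\<tau> q a = foldl \<tau> d (w @ [a])" "\<tau> q a \<le> d"
      by (simp_all add: \<tau>_le)
    moreover have "foldl \<tau> (\<tau> q a) [] \<in> {1..d}"
      using \<open>\<tau> q a \<le> d\<close> q(2) by simp
    ultimately have "\<tau> q a \<in> {0..d}" "\<exists>w. \<tau> q a = foldl \<tau> d w"
      "\<exists>w. foldl \<tau> (\<tau> q a) w \<in> {1..d}"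
      by (simp, blast, blast)
    then show ?thesis
      by (simp only: trim_states_def mem_Collect_eq)
  qed
  have "eigenvector (incidence_mat \<tau> ?S :: real mat) ?v \<beta>"
    unfolding eigenvector_def
  proof (intro conjI)
    obtain i where i: "i < card ?S" "sorted_list_of_set ?S ! i = d"
      using dS fin by (metis in_set_conv_nth set_sorted_list_of_set sorted_list_of_set.length_sorted_key_list_of_set)
    then have "vec_index ?v i \<noteq> 0"
      by (simp add: \<eta>d)
    then show "?v \<noteq> 0\<^sub>v (dim_row (incidence_mat \<tau> ?S :: real mat))"
      using i(1) by (metis carrier_matD(1) incidence_mat_carrier index_zero_vec(1))
    show "(incidence_mat \<tau> ?S :: real mat) *\<^sub>v ?v = \<beta> \<cdot>\<^sub>v ?v"
    proof (rule eq_vecI)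
      fix i assume "i < dim_vec (\<beta> \<cdot>\<^sub>v ?v)"
      then have i: "i < card ?S"
        by simp
      let ?q = "sorted_list_of_set ?S ! i"
      have q: "?q \<in> ?S"
        using i fin by (metis nth_mem set_sorted_list_of_set sorted_list_of_set.length_sorted_key_list_of_set)
      have "vec_index ((incidence_mat \<tau> ?S :: real mat) *\<^sub>v ?v) i = (\<Sum>a | \<tau> ?q a \<in> ?S. \<eta> (\<tau> ?q a))"
        by (rule incidence_mat_mult_vec[OF fin i])
      also have "\<dots> = (\<Sum>a\<in>UNIV. \<eta> (\<tau> ?q a))"
        using closed[OF q] by (intro sum_nonzero_states 0) auto
      also have "\<dots> = \<beta> * \<eta> ?q"
        using q by (intro eig) (simp add: trim_states_def)
      finally show "vec_index ((incidence_mat \<tau> ?S :: real mat) *\<^sub>v ?v) i = vec_index (\<beta> \<cdot>\<^sub>v ?v) i"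
        using i by simp
    qed (simp add: incidence_mat_def Let_def)
  qed (simp add: incidence_mat_def Let_def)
  then have R: "rpoly ?R \<beta> = 0"
    unfolding eigenvalue_incidence_mat_iff[symmetric] eigenvalue_def by blast
  obtain b :: real where b: "b > 1"
    "\<And>\<alpha>. eigenvalue (incidence_mat \<tau> ?S :: complex mat) \<alpha> \<Longrightarrow> \<alpha> \<noteq> complex_of_real b \<Longrightarrow> cmod \<alpha> < 1"
    using pisot unfolding pisot_automaton_def Let_def by blast
  \<comment> \<open>All eigenvalues other than \<open>b\<close> have modulus below 1, and \<beta> >
    1 is an eigenvalue.\<close>
  have "b = \<beta>"
  proof (rule ccontr)
    assume "b \<noteq> \<beta>"
    then have "cmod (complex_of_real \<beta>) < 1"
      using R by (intro b(2)) (simp_all add: eigenvalue_incidence_mat_iff rpoly_of_real)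
    then show False
      using \<beta> by simp
  qed
  moreover have "rpoly ?R \<gamma> = 0"
  proof -
    have "P dvd ?R"
      by (rule irreducible_root_dvd[OF irr P R])
    then show ?thesis
      using \<gamma>(1) by (auto simp: dvd_def rpoly_mult)
  qed
  ultimately show ?thesis
    using b(2) \<gamma>(2) by (simp add: eigenvalue_incidence_mat_iff)
qed

text \<open>
  The numbers of paths from \<open>d\<close> to \<open>r\<close> of the lengths \<open>k < d\<close> form a rational matrix that maps
  \<open>(\<eta>\<^sub>r)\<close> to \<open>(\<beta>\<^sup>k)\<close>. It is invertible because \<open>\<beta>\<close> has degree \<open>d\<close>.
\<close>

lemma eigenvector_in_rat_adjoin:
  fixes \<eta> :: "nat \<Rightarrow> real" and P :: "rat poly"
  assumes irr: "irreducible P" and P: "rpoly P \<beta> = 0" and deg: "degree P = d"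
    and eig: "\<And>q. q \<le> d \<Longrightarrow> (\<Sum>a\<in>UNIV. \<eta> (\<tau> q a)) = \<beta> * \<eta> q"
    and 0: "\<eta> 0 = 0" and \<eta>d: "\<eta> d = 1" and q: "q \<le> d"
  shows "\<eta> q \<in> rat_adjoin \<beta>"
proof -
  define N where "N k r = card {v. length v = k \<and> foldl \<tau> d v = r}" for k r
  have power: "(\<Sum>v | length v = k. \<eta> (foldl \<tau> p v)) = \<beta> ^ k * \<eta> p" if "p \<le> d" for k p
    using that
  proof (induction k arbitrary: p)
    case (Suc k)
    have "{v :: 'a list. length v = Suc k} = (\<lambda>(a, v). a # v) ` (UNIV \<times> {v. length v = k})"
      by (auto simp: length_Suc_conv image_iff)
    then have "(\<Sum>v | length v = Suc k. \<eta> (foldl \<tau> p v)) =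
        (\<Sum>(a, v)\<in>UNIV \<times> {v. length v = k}. \<eta> (foldl \<tau> (\<tau> p a) v))"
      by (simp add: sum.reindex inj_on_def case_prod_unfold)
    also have "\<dots> = (\<Sum>a\<in>UNIV. \<Sum>v | length v = k. \<eta> (foldl \<tau> (\<tau> p a) v))"
      by (rule sum.cartesian_product[symmetric])
    also have "\<dots> = \<beta> ^ k * (\<beta> * \<eta> p)"
      using Suc by (simp add: \<tau>_le eig flip: sum_distrib_left)
    finally show ?case
      by (simp add: mult.commute mult.left_commute)
  qed simp
  have N: "(\<Sum>r<d. real (N k (Suc r)) * \<eta> (Suc r)) = \<beta> ^ k" for k
  proof -
    have "(\<Sum>v | length v = k. \<eta> (foldl \<tau> d v)) =
        (\<Sum>r\<in>{..d}. \<Sum>v | v \<in> {v. length v = k} \<and> foldl \<tau> d v = r. \<eta> (foldl \<tau> d v))"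
      by (rule sum.group[symmetric]) (auto simp: finite_lists_eq foldl_le)
    also have "\<dots> = (\<Sum>r\<in>{..d}. real (N k r) * \<eta> r)"
      by (intro sum.cong refl) (simp add: N_def)
    also have "\<dots> = (\<Sum>r<d. real (N k (Suc r)) * \<eta> (Suc r))"
      by (simp only: lessThan_Suc_atMost[symmetric] sum.lessThan_Suc_shift 0 mult_zero_right add_0)
    finally show ?thesis
      using power[OF order_refl, of k] by (simp add: \<eta>d)
  qed
  define B where "B = Matrix.mat d d (\<lambda>(r, k). rat_of_nat (N k (Suc r)))"
  have B: "B \<in> carrier_mat d d"
    by (simp add: B_def)
  \<comment> \<open>A kernel vector would be the coefficient list of a nonzero polynomial of degree
    less than \<open>d\<close> vanishing at \<beta>, contradicting the degree of
    \<open>P\<close>.\<close>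
  have "Determinant.det B \<noteq> 0"
  proof
    assume "Determinant.det B = 0"
    then obtain c where c: "c \<in> carrier_vec d" "c \<noteq> 0\<^sub>v d" "B *\<^sub>v c = 0\<^sub>v d"
      using det_0_iff_vec_prod_zero_field[OF B] by blast
    define p where "p = (\<Sum>k<d. Polynomial.monom (vec_index c k) k)"
    have Bc: "(\<Sum>k<d. rat_of_nat (N k (Suc r)) * vec_index c k) = 0" if "r < d" for r
    proof -
      have "vec_index (B *\<^sub>v c) r = (\<Sum>k<d. rat_of_nat (N k (Suc r)) * vec_index c k)"
        using that c(1) by (simp add: B_def scalar_prod_def lessThan_atLeast0)
      with c(3) that show ?thesis
        by simp
    qed
    have "rpoly p \<beta> = (\<Sum>k<d. of_rat (vec_index c k) * (\<Sum>r<d. real (N k (Suc r)) * \<eta> (Suc r)))"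
      unfolding p_def N by (simp add: rpoly_sum rpoly_monom)
    also have "\<dots> = (\<Sum>r<d. of_rat (\<Sum>k<d. rat_of_nat (N k (Suc r)) * vec_index c k) * \<eta> (Suc r))"
      unfolding of_rat_sum sum_distrib_left sum_distrib_right
      by (subst sum.swap) (simp add: of_rat_mult mult.assoc mult.left_commute)
    also have "\<dots> = 0"
      by (simp add: Bc)
    finally have "P dvd p"
      by (rule irreducible_root_dvd[OF irr P])
    moreover have "degree p < d"
      unfolding p_def using d_pos
      by (intro degree_sum_less) (auto intro: le_less_trans[OF degree_monom_le])
    moreover have "p \<noteq> 0"
    proof
      assume "p = 0"
      have "vec_index c i = 0" if "i < d" for i
      proof -
        have "coeff p i = vec_index c i"
          unfolding p_def using that by (simp add: coeff_sum)
        then show ?thesis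
          using \<open>p = 0\<close> by simp
      qed
      then have "c = 0\<^sub>v d"
        using c(1) by (intro eq_vecI) auto
      then show False
        using c(2) by blast
    qed
    ultimately show False
      using deg dvd_imp_degree_le[of P p] by simp
  qed
  show ?thesis
  proof (cases q)
    case (Suc i)
    then have i: "i < d"
      using q by simp
    have adj: "adj_mat B \<in> carrier_mat d d" "B * adj_mat B = Determinant.det B \<cdot>\<^sub>m 1\<^sub>m d"
      using adj_mat[OF B] by blast+
    \<comment> \<open>Column \<open>i\<close> of the inverse of \<open>B\<close>, written with the
      adjugate: these coefficients combine the powers of \<beta> to the single coordinate
      \<open>\<eta> (Suc i)\<close>.\<close>
    define c where "c k = adj_mat B $$ (k, i) / Determinant.det B" for k
    have c: "(\<Sum>k<d. rat_of_nat (N k (Suc r)) * c k) = (if r = i then 1 else 0)" if "r < d" for r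
    proof -
      have "(B * adj_mat B) $$ (r, i) = (\<Sum>k<d. rat_of_nat (N k (Suc r)) * adj_mat B $$ (k, i))"
        using that i adj(1) by (simp add: B_def scalar_prod_def lessThan_atLeast0)
      then have "(\<Sum>k<d. rat_of_nat (N k (Suc r)) * adj_mat B $$ (k, i)) =
          Determinant.det B * (if r = i then 1 else 0)"
        using that i by (simp add: adj(2))
      then show ?thesis
        using \<open>Determinant.det B \<noteq> 0\<close> by (simp add: c_def flip: sum_divide_distrib)
    qed
    have "(\<Sum>k<d. of_rat (c k) * \<beta> ^ k) = (\<Sum>k<d. of_rat (c k) * (\<Sum>r<d. real (N k (Suc r)) * \<eta> (Suc r)))"
      by (simp add: N)
    also have "\<dots> = (\<Sum>r<d. of_rat (\<Sum>k<d. rat_of_nat (N k (Suc r)) * c k) * \<eta> (Suc r))"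
      unfolding of_rat_sum sum_distrib_left sum_distrib_right
      by (subst sum.swap) (simp add: of_rat_mult mult.assoc mult.left_commute)
    also have "\<dots> = (\<Sum>r<d. if r = i then \<eta> (Suc r) else 0)"
      by (intro sum.cong refl) (simp add: c)
    also have "\<dots> = \<eta> q"
      using i Suc by simp
    finally have "\<eta> q = (\<Sum>k<d. of_rat (c k) * \<beta> ^ k)" ..
    also have "\<dots> \<in> rat_adjoin \<beta>"
      by (intro rat_adjoin_sum rat_adjoin_mult rat_adjoin_of_rat rat_adjoin_power rat_adjoin_gen)
    finally show ?thesis .
  qed (simp add: 0 rat_adjoin_0)
qed

end

theorem theorem2:
  fixes L :: "'a::{finite,linorder} list set"
    and d :: nat
    and \<tau> :: "nat \<Rightarrow> 'a \<Rightarrow> nat"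
    and a0 :: 'a
    and \<beta> :: real
    and \<eta> \<theta> :: "nat \<Rightarrow> real"
    and u :: "'a stream"
  assumes "d \<ge> 1"
    and "abstract_numeration_system L"
    and "det_automaton {0..d} \<tau> d {1..d}"
    and "L = recognized_language \<tau> d {1..d}"
    and "totally_ordered_automaton {0..d} \<tau>"
    and "pisot_automaton {0..d} \<tau> d {1..d}"
    and "irreducible (char_poly (incidence_mat \<tau> {1..d} :: rat mat))"
    and "a0 = Min UNIV"
    and "\<forall>a. \<tau> 0 a = 0"
    and "\<forall>q\<in>{1..d}. \<tau> q a0 > 0"
    and "\<forall>q\<in>{1..d - 1}. \<tau> q a0 > q"
    and "\<beta> > 1" and "eigenvalue (incidence_mat \<tau> {1..d} :: real mat) \<beta>"
    and "eigenvector (incidence_mat \<tau> {1..d} :: real mat) (Matrix.vec d (\<lambda>i. \<eta> (i + 1))) \<beta>"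
    and "\<eta> d = 1" and "\<eta> 0 = 0"
    and "\<forall>r\<in>{1..d}. \<theta> r \<in> rat_adjoin \<beta>"
    and "\<theta> 0 = 0"
    and "\<forall>q\<in>{1..d}. \<forall>r\<in>{1..d}. \<forall>k.
           of_nat (card {v. length v = k \<and> foldl \<tau> q v + r > d})
             = (\<Sum>\<gamma>\<in>conjugates \<beta>. conj_image \<beta> \<gamma> (\<eta> q) * conj_image \<beta> \<gamma> (\<theta> r) * \<gamma> ^ k)"
    and "u \<in> omega_language L"
  shows "bounded (range (\<lambda>N. discrepancy (van_der_corput L) N {0..<omega_value L u}))
     \<longleftrightarrow>
     omega_value L u \<in> rat_adjoin \<beta> \<and>
     (\<exists>m::nat. \<forall>v. \<forall>k>m.
        zeta \<beta> \<theta> (foldl (mirror_trans d \<tau>) d (rev v)) (tail_value \<beta> d \<tau> \<eta> u k)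
          = (if stream_lex_less (v @- sconst a0) (sdrop (k - 1) u) \<and> stake (k - 1) u @ v \<in> L
             then 1 else 0))"
proof -
  let ?P = "char_poly (incidence_mat \<tau> {1..d} :: rat mat)"
  interpret ordered_automaton d \<tau> a0
  proof
    show "d \<ge> 1"
      by (rule assms(1))
    show "\<tau> q a \<le> d" if "q \<le> d" for q a
      using assms(3) that by (auto simp: det_automaton_def)
    show "\<tau> q a \<le> \<tau> r a" if "q \<le> r" "r \<le> d" for q r a
      using assms(5) that by (auto simp: totally_ordered_automaton_def)
    show "\<tau> 0 a = 0" for a
      using assms(9) by blast
    show "a0 \<le> a" for a
      unfolding assms(8) by (rule Min_le) auto
    show "0 < \<tau> q a0" if "0 < q" "q \<le> d" for q
      using assms(10) that by auto
    show "q < \<tau> q a0" if "0 < q" "q < d" for q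
      using assms(11) that by auto
  qed
  have P: "rpoly ?P \<beta> = 0"
    using assms(13) by (simp add: eigenvalue_incidence_mat_iff)
  have deg: "degree ?P = d"
  proof -
    have "degree ?P = card {1..d}"
      using degree_monic_char_poly[OF incidence_mat_carrier] by blast
    then show ?thesis
      by (simp only: card_atLeastAtMost diff_Suc_1)
  qed
  have eig: "(\<Sum>a\<in>UNIV. \<eta> (\<tau> q a)) = \<beta> * \<eta> q" if "q \<le> d" for q
    by (rule eigenvector_sum[OF assms(14,16) that])
  interpret pisot_numeration d \<tau> a0 \<beta> ?P \<eta> \<theta>
  proof
    show "\<beta> > 1" "irreducible ?P" "rpoly ?P \<beta> = 0" "\<eta> d = 1" "\<eta> 0 = 0" "\<theta> 0 = 0"
      by (fact assms P)+
    show "cmod \<gamma> < 1" if "rpoly ?P \<gamma> = 0" "\<gamma> \<noteq> complex_of_real \<beta>" for \<gamma>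
      by (rule conjugates_of_pisot[OF assms(6,7) P assms(12) eig assms(16,15) that])
    show "\<eta> q \<in> rat_adjoin \<beta>" if "q \<le> d" for q
      by (rule eigenvector_in_rat_adjoin[OF assms(7) P deg eig assms(16,15) that])
    show "(\<Sum>a\<in>UNIV. \<eta> (\<tau> q a)) = \<beta> * \<eta> q" if "q \<le> d" for q
      by (rule eig[OF that])
    show "\<theta> r \<in> rat_adjoin \<beta>" if "r \<le> d" for r
      using assms(17,18) that rat_adjoin_0 by (cases "r = 0") auto
    show "of_nat (card {v. length v = k \<and> foldl \<tau> q v + r > d}) =
        (\<Sum>\<gamma>\<in>conjugates \<beta>. conj_image \<beta> \<gamma> (\<eta> q) * conj_image \<beta> \<gamma> (\<theta> r) * \<gamma> ^ k)"
      if "1 \<le> q" "q \<le> d" "1 \<le> r" "r \<le> d" for q r k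
      using assms(19) that by simp
  qed
  have L: "L = Lang"
    unfolding Lang_def by (rule assms(4))
  show ?thesis
    using assms(20) unfolding L by (rule bounded_discrepancy_criterion)
qed

end
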